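(* Let $p$ be a prime and $1\le k,n<p$ distinct integers, let $r=\gcd(k,n)$ and assume $r\le 0.5\sqrt n$. Let $$F_{k,n}(X,Y)=(X^n+Y^n-1)^{k/r}-(X^k+Y^k-1)^{n/r}\in\mathbb F_p[X,Y],\qquad N_{k,n}=\#\{(x,y)\in\mathbb F_p^2:\ F_{k,n}(x,y)=0\}.$$ Then $$N_{k,n}\ll \frac{k\sqrt n\,p}{r}+\left(\frac{kn}{r}\right)^{4/3}p^{2/3}.$$
   Context: $\mathbb F_p$ is the finite field with $p$ elements. The notation $U\ll V$ means $|U|\le cV$ for an absolute constant $c>0$. *)

theory Defs
  imports Complex_Main "HOL-Number_Theory.Residues"
begin

text \<open>
  \<open>R[X,Y]\<close> is rendered as \<open>R[X][Y]\<close>, i.e. \<open>UP (UP R)\<close>: the inner variable is \<open>X\<close>, the outer one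
  is \<open>Y\<close>, and a polynomial is evaluated at \<open>(x, y)\<close> by sending coefficients in \<open>R[X]\<close> to their
  values at \<open>x\<close> and the outer variable to \<open>y\<close>.
\<close>

abbreviation UP2 :: "('a, 'm) ring_scheme \<Rightarrow> (nat \<Rightarrow> 'a, nat \<Rightarrow> nat \<Rightarrow> 'a) up_ring"
  where "UP2 R \<equiv> UP (UP R)"

definition var_X :: "('a, 'm) ring_scheme \<Rightarrow> nat \<Rightarrow> nat \<Rightarrow> 'a"
  where "var_X R = monom (UP2 R) (monom (UP R) \<one>\<^bsub>R\<^esub> 1) 0"

definition var_Y :: "('a, 'm) ring_scheme \<Rightarrow> nat \<Rightarrow> nat \<Rightarrow> 'a"
  where "var_Y R = monom (UP2 R) \<one>\<^bsub>UP R\<^esub> 1"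

definition eval2 :: "('a, 'm) ring_scheme \<Rightarrow> 'a \<Rightarrow> 'a \<Rightarrow> (nat \<Rightarrow> nat \<Rightarrow> 'a) \<Rightarrow> 'a"
  where "eval2 R x y = UnivPoly.eval (UP R) R (UnivPoly.eval R R id x) y"

text \<open>
  Used both for polynomials (ring \<open>UP2 R\<close>) and for their values (ring \<open>R\<close>).
\<close>

definition fermat_expr :: "('a, 'm) ring_scheme \<Rightarrow> nat \<Rightarrow> 'a \<Rightarrow> 'a \<Rightarrow> 'a"
  where "fermat_expr R n x y = (x [^]\<^bsub>R\<^esub> n \<oplus>\<^bsub>R\<^esub> y [^]\<^bsub>R\<^esub> n) \<ominus>\<^bsub>R\<^esub> \<one>\<^bsub>R\<^esub>"

text \<open>Both exponent divisions are exact, as they divide by the gcd.\<close>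

definition F_poly :: "('a, 'm) ring_scheme \<Rightarrow> nat \<Rightarrow> nat \<Rightarrow> nat \<Rightarrow> nat \<Rightarrow> 'a"
  where "F_poly R k n =
    fermat_expr (UP2 R) n (var_X R) (var_Y R) [^]\<^bsub>UP2 R\<^esub> (k div gcd k n)
    \<ominus>\<^bsub>UP2 R\<^esub> fermat_expr (UP2 R) k (var_X R) (var_Y R) [^]\<^bsub>UP2 R\<^esub> (n div gcd k n)"

text \<open>The field with \<open>p\<close> elements is \<open>residue_ring p\<close>, a field for prime \<open>p\<close> (locale \<open>residues_prime\<close>).\<close>

definition N_zeros :: "nat \<Rightarrow> nat \<Rightarrow> nat \<Rightarrow> nat"
  where "N_zeros p k n =
    (let R = residue_ring (int p)
     in card {(x, y). x \<in> carrier R \<and> y \<in> carrier R \<and> eval2 R x y (F_poly R k n) = \<zero>\<^bsub>R\<^esub>})"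

context cring
begin

lemma UP2_cring: "cring (UP2 R)"
  using UP_cring.UP_cring[of R] UP_cring.UP_cring[of "UP R"] is_cring by (simp add: UP_cring_def)

lemma var_X_closed: "var_X R \<in> carrier (UP2 R)"
proof -
  interpret P: UP_cring R "UP R" by (simp add: UP_cring_def is_cring)
  interpret PP: UP_cring "UP R" "UP2 R" by (simp add: UP_cring_def P.UP_cring)
  show ?thesis by (simp add: var_X_def)
qed

lemma var_Y_closed: "var_Y R \<in> carrier (UP2 R)"
proof -
  interpret P: UP_cring R "UP R" by (simp add: UP_cring_def is_cring)
  interpret PP: UP_cring "UP R" "UP2 R" by (simp add: UP_cring_def P.UP_cring)
  show ?thesis by (simp add: var_Y_def)
qed

lemma eval2_facts:
  assumes x: "x \<in> carrier R" and y: "y \<in> carrier R"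
  shows "ring_hom_cring (UP2 R) R (eval2 R x y)"
    and "eval2 R x y (var_X R) = x" and "eval2 R x y (var_Y R) = y"
proof -
  interpret P: UP_cring R "UP R" by (simp add: UP_cring_def is_cring)
  have hom: "UnivPoly.eval R R id x \<in> ring_hom (UP R) R"
    by (rule UP_pre_univ_prop.eval_ring_hom[OF _ x])
       (simp add: UP_pre_univ_prop_def UP_cring_def ring_hom_cring_def is_cring
          ring_hom_cring_axioms_def)
  interpret I: UP_pre_univ_prop R R id "UP R"
    by (simp add: UP_pre_univ_prop_def UP_cring_def ring_hom_cring_def is_cring
          ring_hom_cring_axioms_def)
  interpret O: UP_pre_univ_prop "UP R" R "UnivPoly.eval R R id x" "UP2 R"
    by (simp add: UP_pre_univ_prop_def UP_cring_def ring_hom_cring_def is_cring P.UP_cring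
          ring_hom_cring_axioms_def hom)
  show "ring_hom_cring (UP2 R) R (eval2 R x y)"
    unfolding eval2_def ring_hom_cring_def ring_hom_cring_axioms_def
    using O.eval_ring_hom[OF y] UP2_cring is_cring by simp
  show "eval2 R x y (var_X R) = x"
    unfolding eval2_def var_X_def
    using O.eval_const[OF y, of "monom (UP R) \<one> 1"] I.eval_monom1[OF x] by simp
  show "eval2 R x y (var_Y R) = y"
    unfolding eval2_def var_Y_def using O.eval_monom1[OF y] by simp
qed

lemma eval2_F_poly:
  assumes x: "x \<in> carrier R" and y: "y \<in> carrier R"
  shows "eval2 R x y (F_poly R k n) =
    fermat_expr R n x y [^] (k div gcd k n) \<ominus> fermat_expr R k x y [^] (n div gcd k n)"
proof -
  interpret H: ring_hom_cring "UP2 R" R "eval2 R x y" by (rule eval2_facts[OF x y])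
  note [simp] = var_X_closed var_Y_closed eval2_facts(2,3)[OF x y]
  have [simp]: "fermat_expr (UP2 R) m (var_X R) (var_Y R) \<in> carrier (UP2 R)" for m
    by (simp add: fermat_expr_def)
  have [simp]: "eval2 R x y (fermat_expr (UP2 R) m (var_X R) (var_Y R)) = fermat_expr R m x y" for m
    by (simp add: fermat_expr_def H.R.minus_eq minus_eq)
  show ?thesis by (simp add: F_poly_def H.R.minus_eq minus_eq)
qed

end

text \<open>The zero count in terms of integer congruences modulo \<open>p\<close>.\<close>

lemma N_zeros_eq:
  assumes "prime p"
  shows "N_zeros p k n = card {(x, y). x \<in> {0..<int p} \<and> y \<in> {0..<int p} \<and>
    [(x ^ n + y ^ n - 1) ^ (k div gcd k n) = (x ^ k + y ^ k - 1) ^ (n div gcd k n)] (mod int p)}"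
proof -
  define R where "R = residue_ring (int p)"
  interpret residues "int p" R
    using prime_gt_1_nat[OF assms] by unfold_locales (simp_all add: R_def)
  have carr: "x \<in> carrier R \<longleftrightarrow> x \<in> {0..<int p}" for x
    by (auto simp: res_carrier_eq)
  have mod_id: "x mod int p = x" if "x \<in> carrier R" for x
    using that by (simp add: carr)
  have pow: "(a mod int p) [^]\<^bsub>R\<^esub> m = a ^ m mod int p" for a :: int and m :: nat
    by (rule pow_cong)
  have fe: "fermat_expr R m x y = (x ^ m + y ^ m - 1) mod int p"
    if "x \<in> carrier R" "y \<in> carrier R" for m x y
  proof -
    have "x [^]\<^bsub>R\<^esub> m = x ^ m mod int p" "y [^]\<^bsub>R\<^esub> m = y ^ m mod int p"
      using pow[of x m] pow[of y m] that by (simp_all add: mod_id)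
    then show ?thesis
      by (simp add: fermat_expr_def minus_eq one_cong add_cong neg_cong)
  qed
  have "eval2 R x y (F_poly R k n) = \<zero>\<^bsub>R\<^esub> \<longleftrightarrow>
      [(x ^ n + y ^ n - 1) ^ (k div gcd k n) = (x ^ k + y ^ k - 1) ^ (n div gcd k n)] (mod int p)"
    if "x \<in> carrier R" "y \<in> carrier R" for x y
    using that
    by (simp add: eval2_F_poly fe pow minus_eq neg_cong add_cong res_zero_eq cong_iff_dvd_diff
        mod_eq_0_iff_dvd)
  then show ?thesis
    unfolding N_zeros_def Let_def R_def[symmetric] carr[symmetric]
    by (intro arg_cong[where f = card]) auto
qed

end

theory Submission
  imports Defs "HOL-Computational_Algebra.Computational_Algebra" "Berlekamp_Zassenhaus.Finite_Field"
begin

text \<open>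
  Let \<open>d = kn/r\<close> and factor \<open>F\<close> into primes \<open>f\<close> over the prime field. Apart from at most
  \<open>2 min(k, n) p\<close> points on lines parallel to the axes, every zero lies on some \<open>f\<close> that involves
  both variables. Fix an integer \<open>m\<close> of size about \<open>min(n\<^sup>1\<^sup>/\<^sup>2, (p/d)\<^sup>1\<^sup>/\<^sup>3)\<close>.

  If \<open>f\<close> has bidegree \<open>\<ge> m\<close>, Stepanov's method applies. The \<open>m\<^sup>2\<close> monomials of bidegree below \<open>m\<close>
  span a space with basis \<open>\<phi>\<^sub>j\<close>. With the derivation \<open>\<delta> = f\<^sub>Y \<partial>\<^sub>X - f\<^sub>X \<partial>\<^sub>Y\<close>, linear algebra modulo \<open>f\<close>
  yields \<open>w\<^sub>j\<close> with \<open>\<Sum> w\<^sub>j \<delta>\<^sup>i \<phi>\<^sub>j \<equiv> 0\<close> for \<open>i < m\<^sup>2 - 1\<close>, and then \<open>\<Sum> w\<^sub>j \<phi>\<^sub>j\<^sup>p\<close> vanishes to order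
  \<open>m\<^sup>2 - 1\<close> at every smooth rational point of \<open>f\<close> without vanishing on \<open>f\<close>. Bezout's inequality bounds
  the number of these points by \<open>O(p deg f / m + m\<^sup>2 (deg f)\<^sup>2)\<close>, and the sum over \<open>f\<close> is
  \<open>O(pd/m + m\<^sup>2 d\<^sup>2)\<close>.

  If \<open>f\<close> has bidegree \<open>< m\<close>, write \<open>A = X\<^sup>n + Y\<^sup>n - 1\<close>, \<open>B = X\<^sup>k + Y\<^sup>k - 1\<close>. Applying \<open>\<delta>\<close> to
  \<open>A\<^sup>k\<^sup>/\<^sup>r \<equiv> B\<^sup>n\<^sup>/\<^sup>r\<close> gives \<open>B a \<equiv> A b\<close> modulo \<open>f\<close>, where \<open>\<delta> A = n a\<close> and \<open>\<delta> B = k b\<close>. When \<open>k\<close> is not much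
  smaller than \<open>n\<close>, this relation and its derivative force a high order of contact of \<open>f\<^sub>Y\<close> with \<open>f\<close>
  along \<open>Y = 0\<close>. When \<open>k\<close> is much smaller than \<open>n\<close>, eliminating \<open>X\<^sup>n\<close> and \<open>Y\<^sup>n\<close> as in the proof of
  Mason's theorem gives the same for a polynomial of bidegree \<open>O(k + deg f)\<close>. Either way \<open>f\<close> meets
  \<open>Y = 0\<close> mostly at \<open>X = 0\<close> or at infinity, where the whole curve \<open>F = 0\<close> has intersection number at
  most \<open>2 min(k, n)\<close>. So the total degree of these \<open>f\<close> is \<open>O(min(k, n))\<close>, and each of them has at most
  \<open>p deg f\<close> zeros.
\<close>

hide_const (open) UnivPoly.coeff UnivPoly.monom Module.smult

unbundle fps_syntax

section \<open>Bivariate polynomials\<close>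

definition swapXY :: "'a::comm_ring_1 poly poly \<Rightarrow> 'a poly poly" where
  "swapXY g = (\<Sum>i\<le>degree g. map_poly (\<lambda>c. monom c i) (coeff g i))"

lemma coeff_swapXY: "coeff (coeff (swapXY g) j) i = coeff (coeff g i) j"
proof -
  have "coeff (coeff (swapXY g) j) i
      = (\<Sum>l\<le>degree g. coeff (monom (coeff (coeff g l) j) l) i)"
    by (simp add: swapXY_def coeff_sum coeff_map_poly)
  also have "\<dots> = (\<Sum>l\<le>degree g. if l = i then coeff (coeff g l) j else 0)"
    by (intro sum.cong) auto
  also have "\<dots> = coeff (coeff g i) j"
    by (auto simp: coeff_eq_0)
  finally show ?thesis .
qed

lemma poly_poly_eqI: "(\<And>i j. coeff (coeff f i) j = coeff (coeff g i) j) \<Longrightarrow> f = g"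
  by (intro poly_eqI) auto

lemma swapXY_swapXY [simp]: "swapXY (swapXY g) = g"
  by (rule poly_poly_eqI) (simp add: coeff_swapXY)

lemma swapXY_0 [simp]: "swapXY 0 = 0"
  by (rule poly_poly_eqI) (simp add: coeff_swapXY)

lemma swapXY_1 [simp]: "swapXY 1 = 1"
  by (rule poly_poly_eqI) (auto simp: coeff_swapXY)

lemma swapXY_add: "swapXY (f + g) = swapXY f + swapXY g"
  by (rule poly_poly_eqI) (simp add: coeff_swapXY)

lemma swapXY_uminus: "swapXY (- g) = - swapXY g"
  by (rule poly_poly_eqI) (simp add: coeff_swapXY)

lemma swapXY_diff: "swapXY (f - g) = swapXY f - swapXY g"
  by (rule poly_poly_eqI) (simp add: coeff_swapXY)

lemma swapXY_mult: "swapXY (f * g) = swapXY f * swapXY g"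
proof (rule poly_poly_eqI)
  fix i j
  have "coeff (coeff (swapXY (f * g)) i) j
      = (\<Sum>a\<le>j. \<Sum>b\<le>i. coeff (coeff f a) b * coeff (coeff g (j - a)) (i - b))"
    by (simp add: coeff_swapXY coeff_mult coeff_sum)
  also have "\<dots> = (\<Sum>b\<le>i. \<Sum>a\<le>j. coeff (coeff f a) b * coeff (coeff g (j - a)) (i - b))"
    by (rule sum.swap)
  also have "\<dots> = coeff (coeff (swapXY f * swapXY g) i) j"
    by (simp add: coeff_swapXY coeff_mult coeff_sum)
  finally show "coeff (coeff (swapXY (f * g)) i) j = coeff (coeff (swapXY f * swapXY g) i) j" .
qed

lemma swapXY_power: "swapXY (f ^ n) = swapXY f ^ n"
  by (induction n) (simp_all add: swapXY_mult)

lemma swapXY_eq_0_iff [simp]: "swapXY g = 0 \<longleftrightarrow> g = 0"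
  using swapXY_swapXY[of g] swapXY_0 by (metis (no_types))

lemma swapXY_dvd_iff [simp]: "swapXY f dvd swapXY g \<longleftrightarrow> f dvd g"
proof -
  have *: "swapXY f dvd swapXY g" if "f dvd g" for f g :: "'a poly poly"
    using that by (auto simp: dvd_def swapXY_mult)
  show ?thesis
    using *[of f g] *[of "swapXY f" "swapXY g"] by auto
qed

lemma swapXY_dvd_left_iff: "swapXY f dvd g \<longleftrightarrow> f dvd swapXY g"
  using swapXY_dvd_iff[of f "swapXY g"] by simp

lemma prime_elem_swapXY:
  assumes "prime_elem f"
  shows "prime_elem (swapXY f)"
proof (rule prime_elemI)
  show "swapXY f \<noteq> 0"
    using assms by (simp add: prime_elem_not_zeroI)
  show "\<not> swapXY f dvd 1"
    using prime_elem_not_unit[OF assms] swapXY_dvd_iff[of f 1] by simp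
  fix a b
  assume "swapXY f dvd a * b"
  then have "f dvd swapXY a * swapXY b"
    by (simp add: swapXY_dvd_left_iff swapXY_mult)
  then show "swapXY f dvd a \<or> swapXY f dvd b"
    using prime_elem_dvd_multD[OF assms] by (simp add: swapXY_dvd_left_iff)
qed

definition degX :: "'a::comm_ring_1 poly poly \<Rightarrow> nat" where "degX g = degree (swapXY g)"

abbreviation degY :: "'a::zero poly poly \<Rightarrow> nat" where "degY g \<equiv> degree g"

lemma degX_swapXY [simp]: "degX (swapXY g) = degY g"
  and degY_swapXY: "degY (swapXY g) = degX g"
  by (simp_all add: degX_def)

lemma degX_0 [simp]: "degX 0 = 0" and degX_1 [simp]: "degX 1 = 0"
  by (simp_all add: degX_def)

lemma degX_uminus [simp]: "degX (- g) = degX g"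
  by (simp add: degX_def swapXY_uminus)

lemma degX_le: "(\<And>i j. m < j \<Longrightarrow> coeff (coeff g i) j = 0) \<Longrightarrow> degX g \<le> m"
  unfolding degX_def by (intro degree_le allI impI poly_eqI) (simp add: coeff_swapXY)

lemma degY_le: "(\<And>i j. m < i \<Longrightarrow> coeff (coeff g i) j = 0) \<Longrightarrow> degY g \<le> m"
  by (intro degree_le allI impI poly_eqI) simp

lemma coeff_eq_0_degX: "degX g < j \<Longrightarrow> coeff (coeff g i) j = 0"
  using coeff_eq_0[of "swapXY g" j] coeff_swapXY[of g j i] by (simp add: degX_def)

lemma degree_coeff_le_degX: "degree (coeff g i) \<le> degX g"
  by (intro degree_le) (auto simp: coeff_eq_0_degX)

lemma degX_mult: "f \<noteq> 0 \<Longrightarrow> g \<noteq> 0 \<Longrightarrow> degX (f * g) = degX f + degX (g :: 'a::idom poly poly)"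
  by (simp add: degX_def swapXY_mult degree_mult_eq)

lemma degX_mult_le: "degX (f * g) \<le> degX f + degX g"
  by (simp add: degX_def swapXY_mult degree_mult_le)

lemma degX_power_le: "degX (f ^ n) \<le> degX f * n"
  by (simp add: degX_def swapXY_power degree_power_le)

lemma degX_add_le: "degX f \<le> m \<Longrightarrow> degX g \<le> m \<Longrightarrow> degX (f + g) \<le> m"
  by (simp add: degX_def swapXY_add degree_add_le)

lemma degX_diff_le: "degX f \<le> m \<Longrightarrow> degX g \<le> m \<Longrightarrow> degX (f - g) \<le> m"
  by (simp add: degX_def swapXY_diff degree_diff_le)

lemma degX_sum_le: "(\<And>i. i \<in> I \<Longrightarrow> degX (f i) \<le> m) \<Longrightarrow> degX (sum f I) \<le> m"
  by (induction I rule: infinite_finite_induct) (auto intro: degX_add_le)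

lemma dvd_imp_degX_le: "f dvd g \<Longrightarrow> g \<noteq> 0 \<Longrightarrow> degX f \<le> degX (g :: 'a::idom poly poly)"
  by (auto simp: dvd_def degX_mult)

definition polyX :: "'a::comm_ring_1 poly poly" where "polyX = [:[:0, 1:]:]"

definition polyY :: "'a::comm_ring_1 poly poly" where "polyY = [:0, 1:]"

lemma swapXY_polyX [simp]: "swapXY polyX = polyY"
  by (rule poly_poly_eqI) (auto simp: coeff_swapXY polyX_def polyY_def coeff_pCons split: nat.splits)

lemma swapXY_polyY [simp]: "swapXY polyY = polyX"
  using swapXY_swapXY[of polyX] by (simp only: swapXY_polyX)

lemma polyX_neq_0 [simp]: "polyX \<noteq> 0" and polyY_neq_0 [simp]: "polyY \<noteq> 0"
  by (simp_all add: polyX_def polyY_def)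

lemma degY_polyX [simp]: "degY polyX = 0" and degY_polyY [simp]: "degY polyY = 1"
  and degX_polyX [simp]: "degX polyX = 1" and degX_polyY [simp]: "degX polyY = 0"
  unfolding degX_def swapXY_polyX swapXY_polyY by (simp_all add: polyX_def polyY_def)

definition const2 :: "'a::comm_ring_1 \<Rightarrow> 'a poly poly" where "const2 c = [:[:c:]:]"

lemma const2_0 [simp]: "const2 0 = 0" and const2_1 [simp]: "const2 1 = 1"
  and const2_add: "const2 (a + b) = const2 a + const2 b"
  and const2_diff: "const2 (a - b) = const2 a - const2 b"
  and const2_mult: "const2 (a * b) = const2 a * const2 b"
  and const2_eq_0_iff [simp]: "const2 a = 0 \<longleftrightarrow> a = 0"
  and degY_const2 [simp]: "degY (const2 a) = 0"
  by (simp_all add: const2_def one_pCons)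

lemma coeff_const2: "coeff (coeff (const2 c) i) j = (if i = 0 \<and> j = 0 then c else 0)"
  by (auto simp: const2_def coeff_pCons split: nat.splits)

lemma swapXY_const2 [simp]: "swapXY (const2 c) = const2 c"
  by (rule poly_poly_eqI) (auto simp: coeff_swapXY coeff_const2)

lemma degX_const2 [simp]: "degX (const2 a) = 0"
  by (simp add: degX_def)

lemma coeff_const2_mult: "coeff (coeff (const2 c * g) i) j = c * coeff (coeff g i) j"
  by (simp add: const2_def)

lemma of_nat_eq_const2: "of_nat n = const2 (of_nat n)"
  by (induction n) (simp_all add: const2_add)

definition pderivX :: "'a::idom poly poly \<Rightarrow> 'a poly poly" where
  "pderivX g = swapXY (pderiv (swapXY g))"

lemma coeff_pderivX: "coeff (coeff (pderivX g) i) j = of_nat (Suc j) * coeff (coeff g i) (Suc j)"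
proof -
  have *: "coeff (of_nat n * q) i = of_nat n * coeff q i" for n and q :: "'a poly"
    by (induction n) (simp_all add: algebra_simps)
  show ?thesis
    unfolding pderivX_def coeff_swapXY coeff_pderiv * by (simp add: coeff_swapXY)
qed

lemma pderivX_add: "pderivX (f + g) = pderivX f + pderivX g"
  and pderivX_diff: "pderivX (f - g) = pderivX f - pderivX g"
  and pderivX_mult: "pderivX (f * g) = f * pderivX g + g * pderivX f"
  by (simp_all add: pderivX_def swapXY_add swapXY_diff swapXY_mult pderiv_add pderiv_diff pderiv_mult)

lemma pderivX_0 [simp]: "pderivX 0 = 0"
  by (simp add: pderivX_def)

lemma pderivX_pCons: "pderivX (pCons c g) = pCons (pderiv c) (pderivX g)"
  by (rule poly_poly_eqI) (auto simp: coeff_pderivX coeff_pCons coeff_pderiv split: nat.splits)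

lemma degX_pderivX_le: "degX (pderivX g) \<le> degX g - 1"
  unfolding degX_def pderivX_def swapXY_swapXY by (rule degree_pderiv_le)

lemma coeff_of_nat_mult: "coeff (of_nat n * q) i = of_nat n * coeff q i"
  by (induction n) (simp_all add: algebra_simps)

lemma degX_pderiv_le: "degX (pderiv g) \<le> degX g"
  by (rule degX_le) (simp add: coeff_pderiv coeff_of_nat_mult coeff_eq_0_degX del: of_nat_Suc)

lemma degY_pderivX_le: "degY (pderivX g) \<le> degY g"
  by (rule degY_le) (simp add: coeff_pderivX coeff_eq_0)

section \<open>Counting polynomials, and a Bezout inequality\<close>

text \<open>Stands in for rank and nullity: over a finite field, dimensions are compared through
  cardinalities, which are powers of \<open>CARD('a)\<close>.\<close>

lemma card_le_fibres:
  assumes "finite A" "finite B" "f \<in> A \<rightarrow> B" and fibre: "\<And>b. b \<in> B \<Longrightarrow> card {a \<in> A. f a = b} \<le> t"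
  shows "card A \<le> card B * t"
proof -
  have "(\<Union>b\<in>B. {a \<in> A. f a = b}) = A"
    using assms(3) by auto
  then have "card A \<le> (\<Sum>b\<in>B. card {a \<in> A. f a = b})"
    using card_UN_le[OF assms(2), of "\<lambda>b. {a \<in> A. f a = b}"] by (simp only:)
  also have "\<dots> \<le> card B * t"
    using fibre sum_bounded_above[of B "\<lambda>b. card {a \<in> A. f a = b}" t] by simp
  finally show ?thesis .
qed

text \<open>The coefficient set is arbitrary because the count is applied twice: to polynomials over
  the field, and then to polynomials whose coefficients are polynomials of bounded degree.\<close>

lemma poly_coeffs_in_finite_card:
  fixes S :: "'b::zero set"
  assumes "finite S" "0 \<in> S"
  shows "finite {p. (\<forall>i. coeff p i \<in> S) \<and> (\<forall>i\<ge>n. coeff p i = 0)} \<and>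
    card {p. (\<forall>i. coeff p i \<in> S) \<and> (\<forall>i\<ge>n. coeff p i = 0)} = card S ^ n"
proof (induction n)
  case 0
  have "{p :: 'b poly. (\<forall>i. coeff p i \<in> S) \<and> (\<forall>i\<ge>0. coeff p i = 0)} = {0}"
    using assms(2) by (auto intro: poly_eqI)
  then show ?case
    by simp
next
  case (Suc n)
  define P where "P n = {p :: 'b poly. (\<forall>i. coeff p i \<in> S) \<and> (\<forall>i\<ge>n. coeff p i = 0)}" for n
  have "P (Suc n) = (\<lambda>(c, p). pCons c p) ` (S \<times> P n)"
  proof (intro equalityI subsetI)
    fix p assume p: "p \<in> P (Suc n)"
    obtain c q where q: "p = pCons c q"
      by (cases p)
    have "coeff q i = coeff p (Suc i)" for i
      by (simp add: q)
    then have "q \<in> P n"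
      using p by (simp add: P_def)
    moreover have "c = coeff p 0"
      by (simp add: q)
    then have "c \<in> S"
      using p by (simp add: P_def)
    ultimately show "p \<in> (\<lambda>(c, p). pCons c p) ` (S \<times> P n)"
      using q by auto
  next
    fix p assume "p \<in> (\<lambda>(c, p). pCons c p) ` (S \<times> P n)"
    then show "p \<in> P (Suc n)"
      by (auto simp: P_def coeff_pCons split: nat.splits)
  qed
  moreover have "inj_on (\<lambda>(c, p). pCons c p) (S \<times> P n)"
    by (auto simp: inj_on_def)
  ultimately show ?case
    using Suc assms(1) by (simp add: P_def[symmetric] card_image card_cartesian_product)
qed

text \<open>The strict bounds make this a vector space of dimension \<open>a * b\<close>, containing
  the zero polynomial even if \<open>a\<close> or \<open>b\<close> is 0.\<close>

definition box :: "nat \<Rightarrow> nat \<Rightarrow> 'a::comm_ring_1 poly poly set" where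
  "box a b = {g. \<forall>i j. coeff (coeff g i) j \<noteq> 0 \<longrightarrow> j < a \<and> i < b}"

lemma finite_box: "finite (box a b :: 'a::{comm_ring_1,finite} poly poly set)" (is ?fin)
  and card_box: "card (box a b :: 'a::{comm_ring_1,finite} poly poly set) = CARD('a) ^ (a * b)" (is ?card)
proof -
  define S where "S = {p :: 'a poly. (\<forall>i. coeff p i \<in> UNIV) \<and> (\<forall>i\<ge>a. coeff p i = 0)}"
  have S: "finite S" "card S = CARD('a) ^ a"
    unfolding S_def using poly_coeffs_in_finite_card[of "UNIV :: 'a set" a] by auto
  have "0 \<in> S"
    by (simp add: S_def)
  have *: "(\<forall>j. coeff p j \<noteq> 0 \<longrightarrow> j < a \<and> i < b) \<longleftrightarrow> p \<in> S \<and> (b \<le> i \<longrightarrow> p = 0)" for p i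
    by (auto simp: S_def poly_eq_iff not_less intro: leI)
  have "box a b = {g :: 'a poly poly. (\<forall>i. coeff g i \<in> S) \<and> (\<forall>i\<ge>b. coeff g i = 0)}"
    unfolding box_def * by auto
  then show ?fin ?card
    using poly_coeffs_in_finite_card[OF \<open>finite S\<close> \<open>0 \<in> S\<close>, of b] S by (simp_all add: power_mult)
qed

lemma box_iff: "g \<in> box a b \<longleftrightarrow> g = 0 \<or> degX g < a \<and> degY g < b"
proof (cases "g = 0")
  case False
  have 1: "degX g < a \<longleftrightarrow> (\<forall>i j. coeff (coeff g i) j \<noteq> 0 \<longrightarrow> j < a)"
  proof
    assume *: "\<forall>i j. coeff (coeff g i) j \<noteq> 0 \<longrightarrow> j < a"
    have "coeff (swapXY g) (degX g) \<noteq> 0"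
      unfolding degX_def using False by simp
    then obtain i where "coeff (coeff g i) (degX g) \<noteq> 0"
      by (metis coeff_swapXY leading_coeff_0_iff)
    then show "degX g < a"
      using * by blast
  qed (metis coeff_eq_0_degX le_less_trans not_le)
  have 2: "degY g < b \<longleftrightarrow> (\<forall>i j. coeff (coeff g i) j \<noteq> 0 \<longrightarrow> i < b)"
  proof
    assume *: "\<forall>i j. coeff (coeff g i) j \<noteq> 0 \<longrightarrow> i < b"
    have "coeff g (degY g) \<noteq> 0"
      using False by simp
    then obtain j where "coeff (coeff g (degY g)) j \<noteq> 0"
      by (metis leading_coeff_0_iff)
    then show "degY g < b"
      using * by blast
  next
    assume "degY g < b"
    then show "\<forall>i j. coeff (coeff g i) j \<noteq> 0 \<longrightarrow> i < b"
      by (metis coeff_0 coeff_eq_0 le_less_trans not_le)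
  qed
  show ?thesis
    using False 1 2 by (auto simp: box_def)
qed (simp add: box_def)

lemma box_0 [simp]: "0 \<in> box a b"
  by (simp add: box_iff)

lemma box_add: "f \<in> box a b \<Longrightarrow> g \<in> box a b \<Longrightarrow> f + g \<in> box a b"
  unfolding box_def mem_Collect_eq coeff_add by (metis add_0)

lemma box_uminus: "g \<in> box a b \<Longrightarrow> - g \<in> box a b"
  by (simp add: box_def)

lemma box_diff: "f \<in> box a b \<Longrightarrow> g \<in> box a b \<Longrightarrow> f - g \<in> box a b"
  using box_add[of f a b "- g"] box_uminus[of g a b] by simp

lemma box_sum: "(\<And>i. i \<in> I \<Longrightarrow> f i \<in> box a b) \<Longrightarrow> sum f I \<in> box a b"
  by (induction I rule: infinite_finite_induct) (auto intro: box_add)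

lemma box_mono: "g \<in> box a b \<Longrightarrow> a \<le> a' \<Longrightarrow> b \<le> b' \<Longrightarrow> g \<in> box a' b'"
  by (auto simp: box_iff)

lemma box_mult_degrees: "g \<in> box a b \<Longrightarrow> f * g \<in> box (degX f + a) (degY f + b)"
  using degX_mult_le[of f g] degree_mult_le[of f g] by (auto simp: box_iff)

lemma box_multD:
  "(f :: 'a::idom poly poly) * g \<in> box (degX f + a) (degY f + b) \<Longrightarrow> f \<noteq> 0 \<Longrightarrow> g \<in> box a b"
  by (auto simp: box_iff degX_mult degree_mult_eq)

lemma box_const2: "g \<in> box a b \<Longrightarrow> const2 c * g \<in> box a b"
  unfolding box_def mem_Collect_eq coeff_const2_mult by (metis mult_zero_right)

text \<open>Dimension count: the ideal \<open>(f, g)\<close> has codimension at most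
  \<open>degX f * degY g + degY f * degX g\<close>.\<close>

lemma bezout_independent:
  fixes f g :: "'a::{idom,finite} poly poly" and h :: "'i \<Rightarrow> 'a poly poly"
  assumes f: "prime_elem f" and fg: "\<not> f dvd g" and I: "finite I"
    and indep: "\<And>c U V. (\<Sum>i\<in>I. const2 (c i) * h i) = f * U + g * V \<Longrightarrow> \<forall>i\<in>I. c i = 0"
  shows "card I \<le> degX f * degY g + degY f * degX g"
proof -
  have [simp]: "f \<noteq> 0" "g \<noteq> 0"
    using f fg by (auto simp: prime_elem_not_zeroI)
  define a where "a = Suc (\<Sum>i\<in>I. degX (h i))"
  define b where "b = Suc (\<Sum>i\<in>I. degY (h i))"
  define p1 p2 q1 q2 where "p1 = degX f" "p2 = degX g" "q1 = degY f" "q2 = degY g"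
  have h: "h i \<in> box a b" if "i \<in> I" for i
    using member_le_sum[OF that, of "\<lambda>i. degX (h i)"] member_le_sum[OF that, of "\<lambda>i. degY (h i)"] I
    by (auto simp: box_iff a_def b_def less_Suc_eq_le)
  \<comment> \<open>The boxes just fit into the common target \<open>B\<close>. Two preimages under
    \<open>F\<close> have the same \<open>c\<close>, by independence, and otherwise differ by a
    syzygy \<open>(g * T, - f * T)\<close> with \<open>T\<close> in \<open>box a b\<close>.
    Comparing dimensions leaves only the mixed products of degrees.\<close>
  define A where "A = (box (p2 + a) (q2 + b) :: 'a poly poly set) \<times> (box (p1 + a) (q1 + b) :: 'a poly poly set)
    \<times> (I \<rightarrow>\<^sub>E (UNIV :: 'a set))"
  define B where "B = (box (p1 + p2 + a) (q1 + q2 + b) :: 'a poly poly set)"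
  define t where "t = card (box a b :: 'a poly poly set)"
  define F where "F = (\<lambda>(U, V, c). f * U + g * V + (\<Sum>i\<in>I. const2 (c i) * h i))"
  have "card A \<le> card B * t"
  proof (rule card_le_fibres)
    show "finite A" "finite B"
      unfolding A_def B_def by (intro finite_cartesian_product finite_box finite_PiE I finite)+
    show "F \<in> A \<rightarrow> B"
    proof
      fix z assume "z \<in> A"
      then obtain U V c where z: "z = (U, V, c)" and U: "U \<in> box (p2 + a) (q2 + b)"
        and V: "V \<in> box (p1 + a) (q1 + b)"
        by (auto simp: A_def)
      have "f * U \<in> box (p1 + p2 + a) (q1 + q2 + b)" "g * V \<in> box (p1 + p2 + a) (q1 + q2 + b)"
        using box_mult_degrees[OF U, of f] box_mult_degrees[OF V, of g]
        by (simp_all add: p1_p2_q1_q2_def algebra_simps)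
      moreover have "(\<Sum>i\<in>I. const2 (c i) * h i) \<in> box (p1 + p2 + a) (q1 + q2 + b)"
        by (intro box_sum box_const2 box_mono[OF h]) auto
      ultimately show "F z \<in> B"
        unfolding z F_def B_def by (auto intro: box_add)
    qed
    fix y assume "y \<in> B"
    show "card {z \<in> A. F z = y} \<le> t"
    proof (cases "{z \<in> A. F z = y} = {}")
      case False
      then obtain U0 V0 c0 where z0: "(U0, V0, c0) \<in> A" "F (U0, V0, c0) = y"
        by auto
      have "{z \<in> A. F z = y} \<subseteq> (\<lambda>T. (U0 + g * T, V0 - f * T, c0)) ` box a b"
      proof
        fix z assume zy: "z \<in> {z \<in> A. F z = y}"
        obtain U V c where zUVc: "z = (U, V, c)"
          by (metis prod_cases3)
        then have z: "z = (U, V, c)" "(U, V, c) \<in> A" "F (U, V, c) = y"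
          using zy by simp_all
        have "(\<Sum>i\<in>I. const2 (c i - c0 i) * h i) = f * (U0 - U) + g * (V0 - V)"
          using z(3) z0(2)
          by (simp add: F_def const2_diff left_diff_distrib right_diff_distrib sum_subtractf algebra_simps)
        then have "\<forall>i\<in>I. c i - c0 i = 0"
          by (rule indep)
        then have c: "c = c0"
          using z(2) z0(1) by (intro PiE_ext[of c I _ c0]) (auto simp: A_def)
        then have "f * U + g * V = f * U0 + g * V0"
          using trans[OF z(3) z0(2)[symmetric]] by (simp add: F_def c)
        then have eq: "f * (U - U0) = g * (V0 - V)"
          by (simp add: algebra_simps)
        then have "f dvd g * (V0 - V)"
          by (metis dvd_triv_left)
        then have "f dvd V0 - V"
          using prime_elem_dvd_multD[OF f] fg by blast
        then obtain T where T: "V0 - V = f * T" ..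
        have "f * (U - U0) = f * (g * T)"
          using eq T by (simp add: algebra_simps)
        then have "U - U0 = g * T"
          by simp
        moreover have "f * T \<in> box (p1 + a) (q1 + b)"
          unfolding T[symmetric] using z(2) z0(1) by (intro box_diff) (auto simp: A_def)
        then have "T \<in> box a b"
          unfolding p1_p2_q1_q2_def by (rule box_multD) simp
        ultimately show "z \<in> (\<lambda>T. (U0 + g * T, V0 - f * T, c0)) ` box a b"
          using z(1) c T by (intro image_eqI[of _ _ T]) (auto simp: algebra_simps)
      qed
      then show ?thesis
        unfolding t_def by (meson card_image_le card_mono finite_box finite_imageI order_trans)
    next
      case True
      then show ?thesis
        by (metis card.empty le0)
    qed
  qed
  then have "CARD('a) ^ ((p2 + a) * (q2 + b) + ((p1 + a) * (q1 + b) + card I))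
      \<le> CARD('a) ^ ((p1 + p2 + a) * (q1 + q2 + b) + a * b)"
    using I by (simp add: A_def B_def t_def card_cartesian_product card_box card_PiE power_add)
  moreover have "CARD('a) > 1"
    using card_mono[of UNIV "{0, 1 :: 'a}"] by simp
  ultimately have "(p2 + a) * (q2 + b) + ((p1 + a) * (q1 + b) + card I)
      \<le> (p1 + p2 + a) * (q1 + q2 + b) + a * b"
    using power_increasing_iff by blast
  then show ?thesis
    by (simp add: p1_p2_q1_q2_def algebra_simps)
qed

section \<open>Power series points\<close>

text \<open>The ring homomorphism \<open>X \<mapsto> x + T\<close>, \<open>Y \<mapsto> y\<close> into power series in \<open>T\<close>.\<close>

definition ev :: "'a::field \<Rightarrow> 'a fps \<Rightarrow> 'a poly poly \<Rightarrow> 'a fps" where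
  "ev x y g = poly (map_poly (\<lambda>c. fps_of_poly (c \<circ>\<^sub>p [:x, 1:])) g) y"

lemma ev_0 [simp]: "ev x y 0 = 0"
  by (simp add: ev_def)

lemma ev_pCons: "ev x y (pCons c g) = fps_of_poly (c \<circ>\<^sub>p [:x, 1:]) + y * ev x y g"
proof -
  have "map_poly h (pCons c g) = pCons (h c) (map_poly h g)" if "h 0 = 0" for h :: "'a poly \<Rightarrow> 'a fps"
    using that by (intro poly_eqI) (simp add: coeff_map_poly coeff_pCons split: nat.split)
  then show ?thesis
    by (simp add: ev_def)
qed

lemma ev_add: "ev x y (f + g) = ev x y f + ev x y g"
  by (induction f g rule: poly_induct2)
     (simp_all add: ev_pCons pcompose_add fps_of_poly_add algebra_simps)

lemma ev_smult: "ev x y (smult c g) = fps_of_poly (c \<circ>\<^sub>p [:x, 1:]) * ev x y g"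
  by (induction g) (simp_all add: ev_pCons pcompose_mult fps_of_poly_mult algebra_simps)

lemma ev_mult: "ev x y (f * g) = ev x y f * ev x y g"
  by (induction f) (simp_all add: ev_pCons ev_smult ev_add algebra_simps)

lemma ev_const2 [simp]: "ev x y (const2 c) = fps_const c"
  by (simp add: const2_def ev_pCons fps_of_poly_const)

lemma ev_1 [simp]: "ev x y 1 = 1"
  using ev_const2[of x y 1] by simp

lemma ev_uminus: "ev x y (- g) = - ev x y g"
  using ev_add[of x y g "- g"] by (simp add: add_eq_0_iff)

lemma ev_diff: "ev x y (f - g) = ev x y f - ev x y g"
  using ev_add[of x y f "- g"] by (simp add: ev_uminus)

lemma ev_power: "ev x y (g ^ n) = ev x y g ^ n"
  by (induction n) (simp_all add: ev_mult)

lemma ev_sum: "ev x y (sum f I) = (\<Sum>i\<in>I. ev x y (f i))"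
  by (induction I rule: infinite_finite_induct) (simp_all add: ev_add)

lemma ev_prod: "ev x y (prod f I) = (\<Prod>i\<in>I. ev x y (f i))"
  by (induction I rule: infinite_finite_induct) (simp_all add: ev_mult)

lemma ev_polyX [simp]: "ev x y polyX = fps_const x + fps_X"
  by (simp add: polyX_def ev_pCons fps_of_poly_linear pcompose_pCons)

lemma ev_polyY [simp]: "ev x y polyY = y"
  by (simp add: polyY_def ev_pCons pcompose_1)

lemma ev_dvd: "f dvd g \<Longrightarrow> ev x y f dvd ev x y g"
  by (auto simp: dvd_def ev_mult)

definition val2 :: "'a::comm_ring_1 poly poly \<Rightarrow> 'a \<Rightarrow> 'a \<Rightarrow> 'a" where
  "val2 g x y = poly (poly g [:y:]) x"

lemma ev_nth_0: "ev x y g $ 0 = val2 g x (y $ 0)"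
proof (induction g)
  case (pCons c g)
  have "fps_of_poly (c \<circ>\<^sub>p [:x, 1:]) $ 0 = poly c x"
    using poly_pcompose[of c "[:x, 1:]" 0] by (simp add: poly_0_coeff_0)
  then show ?case
    using pCons by (simp add: ev_pCons val2_def)
qed (simp add: val2_def)

lemma poly_eq_sum_lessThan:
  fixes x :: "'a::comm_ring_1"
  assumes "degree p < m"
  shows "poly p x = (\<Sum>i<m. coeff p i * x ^ i)"
  unfolding poly_altdef
  by (rule sum.mono_neutral_left) (use assms in \<open>auto simp: coeff_eq_0\<close>)

lemma val2_swapXY: "val2 (swapXY g) x y = val2 g y x"
proof -
  define m where "m = Suc (degX g + degY g)"
  have *: "val2 h x y = (\<Sum>i<m. \<Sum>j<m. coeff (coeff h i) j * x ^ j * y ^ i)"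
    if "degX h < m" "degY h < m" for h :: "'a poly poly" and x y
  proof -
    have "val2 h x y = (\<Sum>i<m. poly (coeff h i) x * y ^ i)"
      using poly_eq_sum_lessThan[OF that(2), of "[:y:]"] by (simp add: val2_def poly_sum poly_power)
    also have "\<dots> = (\<Sum>i<m. \<Sum>j<m. coeff (coeff h i) j * x ^ j * y ^ i)"
      using poly_eq_sum_lessThan[OF le_less_trans[OF degree_coeff_le_degX that(1)], of _ x]
      by (simp add: sum_distrib_right)
    finally show ?thesis .
  qed
  have "val2 (swapXY g) x y = (\<Sum>i<m. \<Sum>j<m. coeff (coeff g j) i * x ^ j * y ^ i)"
    by (subst *) (auto simp: m_def coeff_swapXY degY_swapXY)
  also have "\<dots> = (\<Sum>j<m. \<Sum>i<m. coeff (coeff g j) i * x ^ j * y ^ i)"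
    by (rule sum.swap)
  also have "\<dots> = val2 g y x"
    by (subst *) (auto simp: m_def mult_ac)
  finally show ?thesis .
qed

lemma fps_deriv_ev:
  "fps_deriv (ev x y g) = ev x y (pderivX g) + fps_deriv y * ev x y (pderiv g)"
proof (induction g)
  case (pCons c g)
  have "fps_deriv (fps_of_poly (c \<circ>\<^sub>p [:x, 1:])) = fps_of_poly (pderiv c \<circ>\<^sub>p [:x, 1:])"
    by (simp add: fps_of_poly_pderiv[symmetric] pderiv_pcompose pderiv_pCons)
  then show ?case
    using pCons by (simp add: ev_pCons pderivX_pCons pderiv_pCons ev_add algebra_simps)
qed simp

text \<open>The tangent derivation of the curve \<open>f = 0\<close>. It kills \<open>f\<close>,
  hence acts modulo \<open>f\<close>, and unlike differentiation by \<open>X\<close> along the curve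
  it needs no division by \<open>pderiv f\<close>.\<close>

definition delta :: "'a::idom poly poly \<Rightarrow> 'a poly poly \<Rightarrow> 'a poly poly" where
  "delta f g = pderiv f * pderivX g - pderivX f * pderiv g"

text \<open>Implicit differentiation of \<open>f = 0\<close> expresses \<open>fps_deriv y\<close>
  through the partial derivatives of \<open>f\<close>; clearing the denominator turns d/dT into
  \<open>delta f\<close>.\<close>

lemma deriv_ev_delta:
  assumes "ev x y f = 0"
  shows "ev x y (pderiv f) * fps_deriv (ev x y g) = ev x y (delta f g)"
proof -
  have "ev x y (pderivX f) = - fps_deriv y * ev x y (pderiv f)"
    using fps_deriv_ev[of x y f] assms by (simp add: add_eq_0_iff)
  then show ?thesis
    by (simp add: delta_def ev_diff ev_mult fps_deriv_ev algebra_simps)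
qed

lemma fps_X_power_dvd_iff: "fps_X ^ s dvd (a :: 'a::field fps) \<longleftrightarrow> (\<forall>i<s. a $ i = 0)"
proof (cases "a = 0")
  case False
  then have "fps_X ^ s dvd a \<longleftrightarrow> s \<le> subdegree a"
    by (simp add: fps_dvd_iff)
  also have "\<dots> \<longleftrightarrow> (\<forall>i<s. a $ i = 0)"
    using False by (meson nth_less_subdegree_zero order_less_le_trans subdegree_geI)
  finally show ?thesis .
qed simp

lemma fps_prod_nth_0: "prod f I $ 0 = (\<Prod>i\<in>I. (f i :: 'a::comm_ring_1 fps) $ 0)"
  by (induction I rule: infinite_finite_induct) simp_all

text \<open>Bezout with contact order: each point contributes \<open>s\<close> test polynomials with
  orders 0 to \<open>s - 1\<close> there and at least \<open>s\<close> at the other points of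
  \<open>Z\<close>, so all of them are independent modulo \<open>(f, g)\<close>. The series
  \<open>y P\<close> solves \<open>f = 0\<close> only up to order \<open>s\<close>; for
  \<open>s = 1\<close> a constant serves.\<close>

lemma bezout_points:
  fixes f g :: "'a::{field,finite} poly poly" and Z :: "('a \<times> 'a) set"
  assumes f: "prime_elem f" and fg: "\<not> f dvd g"
    and y: "\<And>P. P \<in> Z \<Longrightarrow> y P $ 0 = snd P"
    and ord_f: "\<And>P. P \<in> Z \<Longrightarrow> fps_X ^ s dvd ev (fst P) (y P) f"
    and ord_g: "\<And>P. P \<in> Z \<Longrightarrow> fps_X ^ s dvd ev (fst P) (y P) g"
  shows "card Z * s \<le> degX f * degY g + degY f * degX g"
proof -
  \<comment> \<open>For \<open>Q\<close> other than \<open>P\<close>, \<open>L P Q\<close> is a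
    coordinate line through \<open>Q\<close> that misses \<open>P\<close>.\<close>
  define L :: "'a \<times> 'a \<Rightarrow> 'a \<times> 'a \<Rightarrow> 'a poly poly" where
    "L P Q = (if fst Q = fst P then polyY - const2 (snd Q) else polyX - const2 (fst Q))" for P Q
  define h where "h = (\<lambda>(P, l). (polyX - const2 (fst P)) ^ l * (\<Prod>Q\<in>Z - {P}. L P Q ^ s))"
  have "card (Z \<times> {..<s}) \<le> degX f * degY g + degY f * degX g"
  proof (rule bezout_independent[OF f fg, of _ h])
    fix c U V
    assume eq: "(\<Sum>i\<in>Z \<times> {..<s}. const2 (c i) * h i) = f * U + g * V"
    have "c (P, l) = 0" if P: "P \<in> Z" and l: "l < s" for P l
    proof -
      define e where "e = ev (fst P) (y P)"
      define u where "u = (\<Prod>Q\<in>Z - {P}. e (L P Q) ^ s)"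
      have u0: "u $ 0 \<noteq> 0"
      proof -
        have "e (L P Q) $ 0 \<noteq> 0" if "Q \<in> Z - {P}" for Q
          using that y[OF P] by (cases P; cases Q) (auto simp: e_def L_def ev_diff)
        then show ?thesis
          unfolding u_def by (simp add: fps_prod_nth_0)
      qed
      have other: "fps_X ^ s dvd e (h (Q, m))" if "Q \<in> Z" "Q \<noteq> P" for Q m
      proof -
        have "fps_X dvd e (L Q P)"
          using y[OF P] fps_X_power_dvd_iff[of 1 "e (L Q P)"]
          by (auto simp: e_def L_def ev_diff)
        then have "fps_X ^ s dvd e (L Q P) ^ s"
          by (rule dvd_power_same)
        also have "e (L Q P) ^ s dvd (\<Prod>R\<in>Z - {Q}. e (L Q R) ^ s)"
          using that P by (intro dvd_prodI) auto
        also have "\<dots> dvd e (h (Q, m))"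
          by (simp add: h_def e_def ev_mult ev_prod ev_power)
        finally show ?thesis .
      qed
      have "fps_X ^ s dvd e (f * U + g * V)"
        using ord_f[OF P] ord_g[OF P] by (simp add: e_def ev_add ev_mult)
      then have "fps_X ^ s dvd (\<Sum>Q\<in>Z. \<Sum>m<s. fps_const (c (Q, m)) * e (h (Q, m)))"
        unfolding eq[symmetric] by (simp add: e_def ev_sum ev_mult sum.cartesian_product)
      also have "(\<Sum>Q\<in>Z. \<Sum>m<s. fps_const (c (Q, m)) * e (h (Q, m)))
          = (\<Sum>m<s. fps_const (c (P, m)) * e (h (P, m)))
            + (\<Sum>Q\<in>Z - {P}. \<Sum>m<s. fps_const (c (Q, m)) * e (h (Q, m)))"
        using P by (simp add: sum.remove)
      finally have "fps_X ^ s dvd (\<Sum>m<s. fps_const (c (P, m)) * e (h (P, m)))"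
        by (subst (asm) dvd_add_left_iff) (auto intro!: dvd_sum dvd_mult other)
      also have "(\<Sum>m<s. fps_const (c (P, m)) * e (h (P, m)))
          = (\<Sum>m<s. fps_const (c (P, m)) * fps_X ^ m) * u"
        by (simp add: h_def e_def ev_mult ev_prod ev_power ev_diff u_def sum_distrib_right mult.assoc)
      finally have "fps_X ^ s dvd (\<Sum>m<s. fps_const (c (P, m)) * fps_X ^ m)"
        using u0 by (simp add: dvd_mult_unit_iff fps_is_unit_iff)
      then have "(\<Sum>m<s. fps_const (c (P, m)) * fps_X ^ m) $ l = 0"
        using l by (simp add: fps_X_power_dvd_iff)
      moreover have "(\<Sum>m<s. fps_const (c (P, m)) * fps_X ^ m) $ l
          = (\<Sum>m<s. if m = l then c (P, m) else 0)"
        unfolding fps_sum_nth by (intro sum.cong) auto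
      ultimately show ?thesis
        using l by simp
    qed
    then show "\<forall>i\<in>Z \<times> {..<s}. c i = 0"
      by auto
  qed (use finite in auto)
  then show ?thesis
    by (simp add: card_cartesian_product)
qed

text \<open>A branch on \<open>f\<close> has infinite contact with \<open>f\<close>, so
  \<open>bezout_points\<close> at this one point bounds every \<open>s\<close> for which
  \<open>g\<close> vanishes to order \<open>s\<close>.\<close>

lemma subdegree_ev_le:
  fixes f g :: "'a::{field,finite} poly poly"
  assumes f: "prime_elem f" "ev x y f = 0" and fg: "\<not> f dvd g"
  shows "ev x y g \<noteq> 0 \<and> subdegree (ev x y g) \<le> degX f * degY g + degY f * degX g"
proof -
  have *: "s \<le> degX f * degY g + degY f * degX g" if "fps_X ^ s dvd ev x y g" for s
    using bezout_points[OF f(1) fg, of "{(x, y $ 0)}" "\<lambda>_. y" s] f(2) that by simp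
  from *[of "Suc (degX f * degY g + degY f * degX g)"] have "ev x y g \<noteq> 0"
    by auto
  moreover have "fps_X ^ subdegree (ev x y g) dvd ev x y g"
    unfolding fps_X_power_dvd_iff by (intro allI impI nth_less_subdegree_zero)
  ultimately show ?thesis
    using *[of "subdegree (ev x y g)"] by simp
qed

text \<open>A branch acts as a generic point: the kernel of evaluation is the ideal
  \<open>(f)\<close>, so divisibility by \<open>f\<close> can be tested at a single branch.\<close>

lemma ev_eq_0_iff:
  fixes f :: "'a::{field,finite} poly poly"
  assumes "prime_elem f" "ev x y f = 0"
  shows "ev x y g = 0 \<longleftrightarrow> f dvd g"
  using subdegree_ev_le[OF assms, of g] ev_dvd[of f g x y] assms(2) by auto

section \<open>Branches through regular points by Hensel lifting\<close>

lemma poly_Taylor2: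
  "\<exists>R. poly p (y + h) = poly p y + h * poly (pderiv p) y + h\<^sup>2 * (R :: 'a::idom)"
proof (induction p)
  case (pCons c p)
  then obtain R where R: "poly p (y + h) = poly p y + h * poly (pderiv p) y + h\<^sup>2 * R"
    by blast
  have "poly (pCons c p) (y + h) = c + (y + h) * (poly p y + h * poly (pderiv p) y + h\<^sup>2 * R)"
    by (simp add: R)
  also have "\<dots> = poly (pCons c p) y + h * poly (pderiv (pCons c p)) y
      + h\<^sup>2 * (poly (pderiv p) y + (y + h) * R)"
    by (simp add: pderiv_pCons algebra_simps power2_eq_square)
  finally show ?case
    by blast
qed (auto intro: exI[of _ 0])

lemma fps_hensel:
  fixes G :: "'a::field fps poly"
  assumes G0: "poly G (fps_const b) $ 0 = 0" and G1: "poly (pderiv G) (fps_const b) $ 0 \<noteq> 0"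
  shows "\<exists>y. y $ 0 = b \<and> poly G y = 0"
proof -
  define P where "P n y \<longleftrightarrow> y $ 0 = b \<and> (\<forall>i\<le>n. poly G y $ i = 0) \<and> poly (pderiv G) y $ 0 \<noteq> 0" for n y
  have "\<exists>f. \<forall>n. P n (f n) \<and> (\<forall>i\<le>n. f (Suc n) $ i = f n $ i)"
  proof (rule dependent_nat_choice)
    show "\<exists>y. P 0 y"
      using assms by (intro exI[of _ "fps_const b"]) (simp add: P_def)
    fix y n assume y: "P n y"
    \<comment> \<open>Newton step: the linear Taylor term cancels the coefficient of index
      \<open>Suc n\<close>, and the quadratic term starts only at index
      \<open>2 * Suc n\<close>.\<close>
    define c where "c = - poly G y $ Suc n / poly (pderiv G) y $ 0"
    define h where "h = fps_X ^ Suc n * fps_const c"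
    obtain R where R: "poly G (y + h) = poly G y + h * poly (pderiv G) y + h\<^sup>2 * R"
      using poly_Taylor2 by blast
    obtain R' where R': "poly (pderiv G) (y + h)
        = poly (pderiv G) y + h * poly (pderiv (pderiv G)) y + h\<^sup>2 * R'"
      using poly_Taylor2 by blast
    have h0: "(h * a) $ i = 0" if "i \<le> n" for a i
      using that by (simp add: h_def mult.assoc fps_X_power_mult_nth del: power_Suc)
    have "poly G (y + h) $ i = 0" if "i \<le> Suc n" for i
    proof (cases "i = Suc n")
      case True
      have "(h * poly (pderiv G) y) $ Suc n = c * poly (pderiv G) y $ 0"
        by (simp add: h_def mult.assoc fps_X_power_mult_nth del: power_Suc)
      moreover have "(h\<^sup>2 * R) $ Suc n = 0"
        by (simp add: h_def power2_eq_square mult.assoc mult.left_commute fps_X_power_mult_nth del: power_Suc)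
      ultimately show ?thesis
        using y by (simp add: R True c_def P_def)
    next
      case False
      then show ?thesis
        using that y h0[of i] by (simp add: R P_def power2_eq_square mult.assoc)
    qed
    moreover have "poly (pderiv G) (y + h) $ 0 \<noteq> 0"
      using y h0[of 0] by (simp add: R' P_def power2_eq_square mult.assoc del: fps_mult_nth_0)
    moreover have "(y + h) $ i = y $ i" if "i \<le> n" for i
      using h0[OF that, of 1] by simp
    ultimately show "\<exists>y'. P (Suc n) y' \<and> (\<forall>i\<le>n. y' $ i = y $ i)"
      using y by (intro exI[of _ "y + h"]) (auto simp: P_def)
  qed
  then obtain Y where Y: "\<And>n. P n (Y n)" and step: "\<And>n i. i \<le> n \<Longrightarrow> Y (Suc n) $ i = Y n $ i"
    by blast
  have stable: "Y m $ i = Y i $ i" if "i \<le> m" for i m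
    using that by (induction m rule: dec_induct) (auto simp: step)
  define y where "y = Abs_fps (\<lambda>i. Y i $ i)"
  have "poly G y $ n = 0" for n
  proof -
    define h where "h = y - Y n"
    obtain R where R: "poly G (Y n + h) = poly G (Y n) + h * poly (pderiv G) (Y n) + h\<^sup>2 * R"
      using poly_Taylor2 by blast
    have "fps_X ^ Suc n dvd h"
      unfolding fps_X_power_dvd_iff
    proof (intro allI impI)
      fix i assume "i < Suc n"
      then show "h $ i = 0"
        using stable[of i n] by (simp add: h_def y_def)
    qed
    then have "fps_X ^ Suc n dvd h * poly (pderiv G) (Y n) + h\<^sup>2 * R"
      by (simp add: power2_eq_square)
    then have "(h * poly (pderiv G) (Y n) + h\<^sup>2 * R) $ n = 0"
      unfolding fps_X_power_dvd_iff by simp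
    then show ?thesis
      using R Y[of n] by (simp add: h_def P_def)
  qed
  moreover have "y $ 0 = b"
    using Y[of 0] by (simp add: y_def P_def)
  ultimately show ?thesis
    by (intro exI[of _ y]) (auto intro: fps_ext)
qed

text \<open>Not all smooth points, only those where \<open>X\<close> is a local parameter, so that a
  branch of the form used in \<open>ev\<close> exists.\<close>

definition reg_points :: "'a::field poly poly \<Rightarrow> ('a \<times> 'a) set" where
  "reg_points f = {(x, y). val2 f x y = 0 \<and> val2 (pderiv f) x y \<noteq> 0}"

lemma reg_point_param:
  assumes "(x, b) \<in> reg_points f"
  shows "\<exists>y. y $ 0 = b \<and> ev x y f = 0"
proof -
  define G where "G = map_poly (\<lambda>c. fps_of_poly (c \<circ>\<^sub>p [:x, 1:])) f"
  have G: "poly G y = ev x y f" for y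
    by (simp add: G_def ev_def)
  have "pderiv G = map_poly (\<lambda>c. fps_of_poly (c \<circ>\<^sub>p [:x, 1:])) (pderiv f)"
    by (rule poly_eqI)
       (simp add: G_def coeff_pderiv coeff_map_poly pcompose_mult fps_of_poly_mult
          of_nat_poly pcompose_smult fps_of_poly_const fps_of_nat[symmetric])
  then have "poly (pderiv G) y = ev x y (pderiv f)" for y
    by (simp add: ev_def)
  then show ?thesis
    using assms fps_hensel[of G b] unfolding G by (simp add: ev_nth_0 reg_points_def)
qed

section \<open>Stepanov's method for plane curves\<close>

lemma CHAR_eq_CARD:
  assumes "prime CARD('a::finite_field)"
  shows "CHAR('a) = CARD('a)"
proof -
  have "CHAR('a) dvd CARD('a)"
    by (rule CHAR_dvd_CARD)
  moreover have "CHAR('a) \<noteq> 1"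
    by simp
  ultimately show ?thesis
    using assms by (auto simp: prime_nat_iff)
qed

lemma of_nat_eq_0_iff_CARD:
  assumes "prime CARD('a::finite_field)"
  shows "of_nat n = (0 :: 'a) \<longleftrightarrow> CARD('a) dvd n"
  using CHAR_eq_CARD[OF assms] by (simp add: of_nat_eq_0_iff_char_dvd)

lemma of_nat_neq_0_CARD:
  assumes "prime CARD('a::finite_field)" "0 < n" "n < CARD('a)"
  shows "of_nat n \<noteq> (0 :: 'a)"
  using assms by (auto simp: of_nat_eq_0_iff_CARD dest: dvd_imp_le)

lemma inj_on_of_nat_CARD:
  assumes p: "prime CARD('a::finite_field)"
  shows "inj_on (of_nat :: nat \<Rightarrow> 'a) {..<CARD('a)}"
proof -
  have "m = n" if "of_nat m = (of_nat n :: 'a)" "m \<le> n" "n < CARD('a)" for m n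
  proof (rule ccontr)
    assume "m \<noteq> n"
    then have "of_nat (n - m) \<noteq> (0 :: 'a)"
      using that by (intro of_nat_neq_0_CARD p) auto
    then show False
      using that by (simp add: of_nat_diff)
  qed
  then show ?thesis
    unfolding inj_on_def by (metis lessThan_iff nle_le)
qed

section \<open>Derivations of power series in characteristic p\<close>

lemma fps_deriv_power_CARD:
  assumes "prime CARD('a::finite_field)"
  shows "fps_deriv ((a :: 'a fps) ^ CARD('a)) = 0"
  using of_nat_eq_0_iff_CARD[OF assms, of "CARD('a)"] by (simp add: fps_deriv_power)

text \<open>The form that \<open>delta f\<close> takes on a branch, with \<open>u\<close> the value
  of \<open>pderiv f\<close> there.\<close>

definition dmul :: "'a::field fps \<Rightarrow> 'a fps \<Rightarrow> 'a fps" where "dmul u a = u * fps_deriv a"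

lemma dmul_0 [simp]: "dmul u 0 = 0"
  by (simp add: dmul_def)

lemma dmul_sum: "dmul u (sum f I) = (\<Sum>i\<in>I. dmul u (f i))"
  by (simp add: dmul_def fps_deriv_sum sum_distrib_left)

lemma dmul_mult: "dmul u (a * b) = dmul u a * b + a * dmul u b"
  by (simp add: dmul_def algebra_simps)

lemma ev_delta_funpow:
  assumes "ev x y f = 0"
  shows "ev x y ((delta f ^^ i) g) = (dmul (ev x y (pderiv f)) ^^ i) (ev x y g)"
  by (induction i) (simp_all add: deriv_ev_delta[OF assms, symmetric] dmul_def)

text \<open>Differentiating a relation by the Leibniz rule moves one derivation from
  \<open>\<Phi> j\<close> to \<open>v j\<close>, at the cost of one relation.\<close>

lemma dmul_orth_shift:
  assumes "\<And>i. i < s \<Longrightarrow> (\<Sum>j\<in>I. v j * (dmul u ^^ i) (\<Phi> j)) = 0" and "i + l < s"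
  shows "(\<Sum>j\<in>I. (dmul u ^^ l) (v j) * (dmul u ^^ i) (\<Phi> j)) = 0"
  using assms(2)
proof (induction l arbitrary: i)
  case 0
  then show ?case
    using assms(1) by simp
next
  case (Suc l)
  have "dmul u (\<Sum>j\<in>I. (dmul u ^^ l) (v j) * (dmul u ^^ i) (\<Phi> j))
      = (\<Sum>j\<in>I. (dmul u ^^ Suc l) (v j) * (dmul u ^^ i) (\<Phi> j))
        + (\<Sum>j\<in>I. (dmul u ^^ l) (v j) * (dmul u ^^ Suc i) (\<Phi> j))"
    by (simp add: dmul_sum dmul_mult sum.distrib)
  then show ?case
    using Suc.IH[of i] Suc.IH[of "Suc i"] Suc.prems by simp
qed

text \<open>The Euler operator \<open>T d/dT\<close>; unlike \<open>dmul u\<close> it is diagonal on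
  the powers of \<open>T\<close>.\<close>

definition theta :: "'a::field fps \<Rightarrow> 'a fps" where "theta = dmul fps_X"

lemma theta_funpow_nth: "(theta ^^ i) a $ n = of_nat n ^ i * a $ n"
proof (induction i)
  case (Suc i)
  have "theta b $ n = of_nat n * b $ n" for b :: "'a fps"
    by (cases n) (simp_all add: theta_def dmul_def)
  then show ?case
    using Suc by simp
qed simp

text \<open>\<open>theta\<close> is \<open>dmul u\<close> times the series
  \<open>fps_X * inverse u\<close>, which does not depend on \<open>j\<close> and can be pulled out
  of the sums. In the induction one derivation passes to \<open>v\<close>, which consumes one of the
  \<open>s\<close> relations.\<close>

lemma theta_orth:
  assumes "u $ 0 \<noteq> 0"
    and "\<And>i. i < s \<Longrightarrow> (\<Sum>j\<in>I. v j * (dmul u ^^ i) (\<Phi> j)) = 0" and "i < s"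
  shows "(\<Sum>j\<in>I. v j * (theta ^^ i) (\<Phi> j)) = 0"
  using assms(2,3)
proof (induction i arbitrary: v s)
  case 0
  then show ?case
    by force
next
  case (Suc i)
  have theta: "theta a = fps_X * inverse u * dmul u a" for a
    using assms(1) by (simp add: theta_def dmul_def mult.assoc) (simp add: mult.assoc[symmetric] inverse_mult_eq_1)
  have "(\<Sum>j\<in>I. theta (v j) * (dmul u ^^ l) (\<Phi> j)) = 0" if "l < s - 1" for l
  proof -
    have "(\<Sum>j\<in>I. dmul u (v j) * (dmul u ^^ l) (\<Phi> j)) = 0"
      using dmul_orth_shift[where v = v and u = u and l = 1 and i = l and s = s and I = I and \<Phi> = \<Phi>]
        Suc.prems that by simp
    then show ?thesis
      by (simp add: theta mult.assoc sum_distrib_left[symmetric])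
  qed
  then have "(\<Sum>j\<in>I. theta (v j) * (theta ^^ i) (\<Phi> j)) = 0"
    using Suc.prems by (intro Suc.IH[of "s - 1"]) auto
  moreover have "(\<Sum>j\<in>I. v j * (theta ^^ i) (\<Phi> j)) = 0"
    using Suc.prems by (intro Suc.IH[of s]) auto
  then have "theta (\<Sum>j\<in>I. v j * (theta ^^ i) (\<Phi> j)) = 0"
    by (simp add: theta_def)
  then have "(\<Sum>j\<in>I. theta (v j) * (theta ^^ i) (\<Phi> j)) + (\<Sum>j\<in>I. v j * theta ((theta ^^ i) (\<Phi> j))) = 0"
    by (simp add: theta_def dmul_sum dmul_mult sum.distrib)
  ultimately show ?case
    by simp
qed

text \<open>Testing the relations against the polynomial that vanishes at all nodes except those of
  \<open>k\<close> and \<open>l\<close> leaves only two terms, so \<open>c k\<close> and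
  \<open>c l\<close> vanish together.\<close>

lemma vandermonde_kernel_all_nonzero:
  fixes x c :: "'i \<Rightarrow> 'a::field"
  assumes I: "finite I" "card I = Suc s" and inj: "inj_on x I"
    and orth: "\<And>i. i < s \<Longrightarrow> (\<Sum>j\<in>I. c j * x j ^ i) = 0"
    and k: "k \<in> I" "c k \<noteq> 0" and l: "l \<in> I"
  shows "c l \<noteq> 0"
proof
  assume cl: "c l = 0"
  with k have "k \<noteq> l"
    by auto
  define q where "q = (\<Prod>j\<in>I - {k, l}. [:- x j, 1:])"
  have "card (I - {k, l}) = s - 1" "s > 0"
    using I k l \<open>k \<noteq> l\<close> card_mono[of I "{k, l}"] by (auto simp: card_Diff_subset)
  then have deg: "degree q < s"
    unfolding q_def by (subst degree_prod_eq_sum_degree) auto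
  have "(\<Sum>j\<in>I. c j * poly q (x j)) = (\<Sum>i<s. coeff q i * (\<Sum>j\<in>I. c j * x j ^ i))"
    unfolding poly_eq_sum_lessThan[OF deg]
    by (simp add: sum_distrib_left sum.swap[of _ I] mult_ac)
  also have "\<dots> = 0"
    using orth by simp
  finally have "(\<Sum>j\<in>I. c j * poly q (x j)) = 0" .
  moreover have "c j * poly q (x j) = 0" if "j \<in> I - {k}" for j
    using that cl I(1) by (cases "j = l") (auto simp: q_def poly_prod)
  then have "(\<Sum>j\<in>I - {k}. c j * poly q (x j)) = 0"
    by (intro sum.neutral) blast
  then have "(\<Sum>j\<in>I. c j * poly q (x j)) = c k * poly q (x k)"
    using I(1) k(1) by (simp add: sum.remove[OF I(1) k(1)])
  moreover have "poly q (x k) \<noteq> 0"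
    using I(1) inj k(1) by (auto simp: q_def poly_prod inj_on_def)
  ultimately show False
    using k by simp
qed

text \<open>All \<open>v j\<close> turn out to have order exactly \<open>\<nu> - subdegree (\<Phi> j)\<close>, so the summands of
  the conclusion have distinct orders.\<close>

lemma sum_power_CARD_neq_0:
  fixes v \<Phi> :: "'i \<Rightarrow> 'a::finite_field fps"
  assumes p: "prime CARD('a)" and I: "finite I" "card I = Suc s" and u: "u $ 0 \<noteq> 0"
    and \<Phi>: "\<And>j. j \<in> I \<Longrightarrow> \<Phi> j \<noteq> 0 \<and> subdegree (\<Phi> j) < CARD('a)"
    and inj: "inj_on (\<lambda>j. subdegree (\<Phi> j)) I"
    and orth: "\<And>i. i < s \<Longrightarrow> (\<Sum>j\<in>I. v j * (dmul u ^^ i) (\<Phi> j)) = 0"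
    and k: "k \<in> I" "v k \<noteq> 0"
  shows "(\<Sum>j\<in>I. v j * \<Phi> j ^ CARD('a)) \<noteq> 0"
proof -
  define o' where "o' j = subdegree (\<Phi> j)" for j
  define J where "J = {j \<in> I. v j \<noteq> 0}"
  define \<nu> where "\<nu> = Min ((\<lambda>j. subdegree (v j) + o' j) ` J)"
  have J: "finite J" "k \<in> J"
    using I k by (auto simp: J_def)
  have \<nu>_le: "\<nu> \<le> subdegree (v j) + o' j" if "j \<in> J" for j
    unfolding \<nu>_def using J that by (intro Min_le) auto
  have "\<nu> \<in> (\<lambda>j. subdegree (v j) + o' j) ` J"
    unfolding \<nu>_def using J by (intro Min_in) auto
  then obtain k0 where k0: "k0 \<in> J" "\<nu> = subdegree (v k0) + o' k0"
    by blast
  \<comment> \<open>Minimality of \<open>\<nu>\<close> leaves a single term in the coefficient of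
    index \<open>\<nu>\<close>, made from the lowest coefficient of \<open>\<Phi> j\<close>. The
    case distinction guards the truncated subtraction \<open>\<nu> - o' j\<close>.\<close>
  define c where "c j = (if o' j \<le> \<nu> then v j $ (\<nu> - o' j) * \<Phi> j $ o' j else 0)" for j
  have coeff: "(v j * (theta ^^ i) (\<Phi> j)) $ \<nu> = c j * of_nat (o' j) ^ i" if j: "j \<in> I" for i j
  proof -
    have "(v j * (theta ^^ i) (\<Phi> j)) $ \<nu>
        = (\<Sum>b\<le>\<nu>. v j $ (\<nu> - b) * (of_nat b ^ i * \<Phi> j $ b))"
      unfolding mult.commute[of "v j"] fps_mult_nth theta_funpow_nth atLeast0AtMost
      by (intro sum.cong) (auto simp: mult_ac)
    also have "\<dots> = (\<Sum>b\<le>\<nu>. if b = o' j then c j * of_nat (o' j) ^ i else 0)"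
    proof (intro sum.cong refl)
      fix b assume b: "b \<in> {..\<nu>}"
      consider "b < o' j" | "b = o' j" | "o' j < b" "v j = 0" | "o' j < b" "v j \<noteq> 0"
        by linarith
      then show "v j $ (\<nu> - b) * (of_nat b ^ i * \<Phi> j $ b) = (if b = o' j then c j * of_nat (o' j) ^ i else 0)"
      proof cases
        case 1
        then show ?thesis
          using nth_less_subdegree_zero[of b "\<Phi> j"] by (simp add: o'_def)
      next
        case 2
        then show ?thesis
          using b by (simp add: c_def)
      next
        case 4
        then have "\<nu> - b < subdegree (v j)"
          using \<nu>_le[of j] j b by (simp add: J_def)
        then show ?thesis
          using 4 nth_less_subdegree_zero[of "\<nu> - b" "v j"] by simp
      qed simp
    qed
    also have "\<dots> = c j * of_nat (o' j) ^ i"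
      by (simp add: c_def)
    finally show ?thesis .
  qed
  have c_orth: "(\<Sum>j\<in>I. c j * of_nat (o' j) ^ i) = 0" if "i < s" for i
  proof -
    have "(\<Sum>j\<in>I. v j * (theta ^^ i) (\<Phi> j)) = 0"
      by (rule theta_orth[OF u orth that])
    then have "(\<Sum>j\<in>I. v j * (theta ^^ i) (\<Phi> j)) $ \<nu> = 0"
      by simp
    then show ?thesis
      by (simp add: fps_sum_nth coeff)
  qed
  have inj': "inj_on (\<lambda>j. of_nat (o' j) :: 'a) I"
  proof (rule inj_onI)
    fix j l assume jl: "j \<in> I" "l \<in> I" "of_nat (o' j) = (of_nat (o' l) :: 'a)"
    then have "o' j = o' l"
      using inj_onD[OF inj_on_of_nat_CARD[OF p] jl(3)] \<Phi> by (simp add: o'_def)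
    then show "j = l"
      using inj_onD[OF inj] jl by (simp add: o'_def)
  qed
  have "c k0 \<noteq> 0"
    using k0 \<Phi>[of k0] by (simp add: c_def J_def) (simp add: o'_def)
  \<comment> \<open>The relations \<open>c_orth\<close> are an \<open>s\<close> by
    \<open>s + 1\<close> Vandermonde system with nodes \<open>o' j\<close>, distinct in the field
    because the orders lie below \<open>CARD('a)\<close>.\<close>
  then have c: "c j \<noteq> 0" if "j \<in> I" for j
    using vandermonde_kernel_all_nonzero[OF I inj' c_orth, of k0 j] k0 that by (auto simp: J_def)
  have v: "v j \<noteq> 0" "o' j \<le> \<nu>" "subdegree (v j) = \<nu> - o' j" if "j \<in> I" for j
  proof -
    have nz: "o' j \<le> \<nu>" "v j $ (\<nu> - o' j) \<noteq> 0"
      using c[OF that] by (auto simp: c_def split: if_splits)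
    then show "v j \<noteq> 0" "o' j \<le> \<nu>"
      by auto
    then have "\<nu> \<le> subdegree (v j) + o' j"
      using that by (intro \<nu>_le) (simp add: J_def)
    then show "subdegree (v j) = \<nu> - o' j"
      using subdegree_leI[OF nz(2)] nz(1) by linarith
  qed
  obtain m where m: "m \<in> I" "\<And>j. j \<in> I \<Longrightarrow> o' m \<le> o' j"
    using ex_min_if_finite[of "o' ` I"] I k by (metis (no_types, lifting) arg_min_if_finite(1,2) empty_iff not_le)
  define N where "N = subdegree (v m * \<Phi> m ^ CARD('a))"
  have sub: "subdegree (v j * \<Phi> j ^ CARD('a)) = \<nu> - o' j + CARD('a) * o' j" if "j \<in> I" for j
    using v[OF that] \<Phi>[OF that] by (simp add: subdegree_mult subdegree_power o'_def)
  \<comment> \<open>The orders equal \<open>\<nu> + (CARD('a) - 1) * o' j\<close>, so the summand of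
    index \<open>m\<close> is the only one of lowest order.\<close>
  have "(v j * \<Phi> j ^ CARD('a)) $ N = 0" if "j \<in> I - {m}" for j
  proof -
    have "o' m \<noteq> o' j"
      using that m inj by (auto simp: inj_on_def o'_def)
    then have "o' m < o' j"
      using m(2)[of j] that by simp
    moreover have "2 \<le> CARD('a)"
      using p prime_ge_2_nat by blast
    then have "2 * (o' j - o' m) \<le> CARD('a) * (o' j - o' m)"
      by (rule mult_right_mono) simp
    then have "2 * o' j + CARD('a) * o' m \<le> 2 * o' m + CARD('a) * o' j"
      using \<open>o' m < o' j\<close> by (simp add: algebra_simps diff_mult_distrib2)
    ultimately have "N < subdegree (v j * \<Phi> j ^ CARD('a))"
      using v(2)[of j] v(2)[of m] that m(1) sub[of j] sub[of m] unfolding N_def by simp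
    then show ?thesis
      by (rule nth_less_subdegree_zero)
  qed
  then have "(\<Sum>j\<in>I. v j * \<Phi> j ^ CARD('a)) $ N = (v m * \<Phi> m ^ CARD('a)) $ N"
    using sum.remove[OF I(1) m(1), of "\<lambda>j. (v j * \<Phi> j ^ CARD('a)) $ N"] by (simp add: fps_sum_nth)
  moreover have "(v m * \<Phi> m ^ CARD('a)) $ N \<noteq> 0"
    unfolding N_def using v(1)[OF m(1)] \<Phi>[OF m(1)] by (intro nth_subdegree_nonzero) auto
  ultimately show ?thesis
    by auto
qed

text \<open>Recovering \<open>a\<close> from its derivative divides by 1 to \<open>s - 1\<close>,
  which are invertible in the field as long as \<open>s\<close> does not exceed the
  characteristic.\<close>

lemma dmul_vanishing_order:
  assumes p: "prime CARD('a::finite_field)" and u: "(u :: 'a fps) $ 0 \<noteq> 0"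
    and "\<And>l. l < s \<Longrightarrow> (dmul u ^^ l) a $ 0 = 0" and "s \<le> CARD('a)"
  shows "fps_X ^ s dvd a"
  using assms(3,4)
proof (induction s arbitrary: a)
  case (Suc s)
  have "fps_X ^ s dvd dmul u a"
  proof (rule Suc.IH)
    fix l assume "l < s"
    then show "(dmul u ^^ l) (dmul u a) $ 0 = 0"
      using Suc.prems(1)[of "Suc l"] by (simp add: funpow_swap1)
  qed (use Suc.prems in auto)
  then have "fps_X ^ s dvd fps_deriv a"
    using u by (simp add: dmul_def dvd_mult_unit_iff' fps_is_unit_iff)
  then have deriv: "of_nat (Suc i) * a $ Suc i = 0" if "i < s" for i
    using that by (simp add: fps_X_power_dvd_iff)
  have "a $ i = 0" if "i < Suc s" for i
  proof (cases i)
    case 0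
    then show ?thesis
      using Suc.prems(1)[of 0] by simp
  next
    case (Suc i')
    then have "of_nat (Suc i') \<noteq> (0 :: 'a)"
      using that \<open>Suc s \<le> CARD('a)\<close> by (intro of_nat_neq_0_CARD p) auto
    then show ?thesis
      using deriv[of i'] that Suc by simp
  qed
  then show ?case
    unfolding fps_X_power_dvd_iff by blast
qed simp

section \<open>Construction of the auxiliary polynomial\<close>

lemma box_mult: "f \<in> box a b \<Longrightarrow> g \<in> box c d \<Longrightarrow> f * g \<in> box (a + c) (b + d)"
  using degX_mult_le[of f g] degree_mult_le[of f g] by (auto simp: box_iff)

lemma box_delta:
  assumes "g \<in> box a b"
  shows "delta f g \<in> box (degX f + a) (degY f + b)"
proof -
  have "pderivX g \<in> box a b" "pderiv g \<in> box a b"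
    using assms degX_pderivX_le[of g] degY_pderivX_le[of g] degX_pderiv_le[of g] degree_pderiv_le[of g]
    by (auto simp: box_iff)
  then have "pderiv f * pderivX g \<in> box (degX (pderiv f) + a) (degY (pderiv f) + b)"
    and "pderivX f * pderiv g \<in> box (degX (pderivX f) + a) (degY (pderivX f) + b)"
    by (simp_all add: box_mult_degrees)
  moreover have "degX (pderiv f) \<le> degX f" "degY (pderiv f) \<le> degY f"
    and "degX (pderivX f) \<le> degX f" "degY (pderivX f) \<le> degY f"
    using degX_pderivX_le[of f] degY_pderivX_le[of f] degX_pderiv_le[of f] degree_pderiv_le[of f]
    by linarith+
  ultimately show ?thesis
    unfolding delta_def by (intro box_diff) (auto elim!: box_mono)
qed

text \<open>Siegel's lemma on the curve, with \<open>s\<close> equations in \<open>s + 1\<close>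
  unknowns. If all small solutions were divisible by \<open>f\<close>, the map \<open>F\<close> from
  \<open>(w, U)\<close> to left sides plus multiples of \<open>f\<close> would have fibres no larger
  than \<open>C\<close>, too small for the size of its domain.\<close>

lemma siegel_mod:
  fixes f :: "'a::{field,finite} poly poly"
  assumes f: "f \<noteq> 0" "0 < degX f + degY f"
    and c: "\<And>i j. i < s \<Longrightarrow> j < Suc s \<Longrightarrow> c i j \<in> box e e"
    and a: "a = s * e + degX f + degY f"
  shows "\<exists>w. (\<forall>j<Suc s. w j \<in> box a a) \<and> (\<forall>i<s. f dvd (\<Sum>j<Suc s. w j * c i j))
    \<and> (\<exists>j<Suc s. \<not> f dvd w j)"
proof (rule ccontr)
  assume "\<nexists>w. (\<forall>j<Suc s. w j \<in> box a a) \<and> (\<forall>i<s. f dvd (\<Sum>j<Suc s. w j * c i j))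
    \<and> (\<exists>j<Suc s. \<not> f dvd w j)"
  then have triv: "f dvd w j"
    if "\<And>j. j < Suc s \<Longrightarrow> w j \<in> box a a" "\<And>i. i < s \<Longrightarrow> f dvd (\<Sum>j<Suc s. w j * c i j)" "j < Suc s"
    for w j
    using that by blast
  define d1 d2 where "d1 = degX f" and "d2 = degY f"
  define A where "A = ({..<Suc s} \<rightarrow>\<^sub>E (box a a :: 'a poly poly set))
    \<times> ({..<s} \<rightarrow>\<^sub>E (box (a + e - d1) (a + e - d2) :: 'a poly poly set))"
  define B where "B = {..<s} \<rightarrow>\<^sub>E (box (a + e) (a + e) :: 'a poly poly set)"
  define C where "C = {..<Suc s} \<rightarrow>\<^sub>E (box (a - d1) (a - d2) :: 'a poly poly set)"
  define F where "F = (\<lambda>(w, U). \<lambda>i\<in>{..<s}. (\<Sum>j<Suc s. w j * c i j) + f * U i)"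
  have "card A \<le> card B * card C"
  proof (rule card_le_fibres)
    show "finite A" "finite B"
      unfolding A_def B_def by (intro finite_cartesian_product finite_box finite_PiE finite_lessThan)+
    show "F \<in> A \<rightarrow> B"
    proof
      fix z assume "z \<in> A"
      then obtain w U where z: "z = (w, U)" and w: "\<And>j. j < Suc s \<Longrightarrow> w j \<in> box a a"
        and U: "\<And>i. i < s \<Longrightarrow> U i \<in> box (a + e - d1) (a + e - d2)"
        by (auto simp: A_def)
      have "(\<Sum>j<Suc s. w j * c i j) + f * U i \<in> box (a + e) (a + e)" if "i < s" for i
      proof (intro box_add box_sum)
        show "w j * c i j \<in> box (a + e) (a + e)" if "j \<in> {..<Suc s}" for j
          using that \<open>i < s\<close> by (intro box_mult w c) auto
        show "f * U i \<in> box (a + e) (a + e)"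
          using box_mult_degrees[OF U[OF that], of f] a by (simp add: d1_def d2_def add_ac)
      qed
      then show "F z \<in> B"
        by (auto simp: F_def B_def z)
    qed
    fix b assume "b \<in> B"
    show "card {z \<in> A. F z = b} \<le> card C"
    proof (cases "{z \<in> A. F z = b} = {}")
      case False
      then obtain w0 U0 where z0: "(w0, U0) \<in> A" "F (w0, U0) = b"
        by auto
      define E where "E = (\<lambda>T. (\<lambda>j\<in>{..<Suc s}. w0 j + f * T j, \<lambda>i\<in>{..<s}. U0 i - (\<Sum>j<Suc s. T j * c i j)))"
      have "{z \<in> A. F z = b} \<subseteq> E ` C"
      proof
        fix z assume z: "z \<in> {z \<in> A. F z = b}"
        obtain w U where wU: "z = (w, U)"
          by (cases z)
        have eq: "(\<Sum>j<Suc s. w j * c i j) + f * U i = (\<Sum>j<Suc s. w0 j * c i j) + f * U0 i" if "i < s" for i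
        proof -
          have "F (w, U) i = F (w0, U0) i"
            using z z0 wU by simp
          then show ?thesis
            using that by (simp add: F_def)
        qed
        then have eq': "(\<Sum>j<Suc s. (w j - w0 j) * c i j) = f * (U0 i - U i)" if "i < s" for i
          using that by (simp add: left_diff_distrib right_diff_distrib sum_subtractf algebra_simps)
        have w_box: "w j - w0 j \<in> box a a" if "j < Suc s" for j
        proof (rule box_diff)
          show "w j \<in> box a a" "w0 j \<in> box a a"
            using z z0 wU that by (auto simp: A_def)
        qed
        have "f dvd w j - w0 j" if "j < Suc s" for j
          using eq' by (intro triv[of "\<lambda>j. w j - w0 j"] w_box that) auto
        then have "\<forall>j. \<exists>t. j < Suc s \<longrightarrow> w j - w0 j = f * t"
          by (auto simp: dvd_def)
        then have "\<exists>T. \<forall>j. j < Suc s \<longrightarrow> w j - w0 j = f * T j"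
          by (rule choice)
        then obtain T0 where T0: "\<And>j. j < Suc s \<Longrightarrow> w j - w0 j = f * T0 j"
          by blast
        define T where "T = restrict T0 {..<Suc s}"
        have T: "w j - w0 j = f * T j" if "j < Suc s" for j
          using T0 that by (simp add: T_def)
        have "T j \<in> box (a - d1) (a - d2)" if "j < Suc s" for j
        proof (rule box_multD[OF _ f(1)])
          show "f * T j \<in> box (degX f + (a - d1)) (degY f + (a - d2))"
            using w_box[OF that] T[OF that] a by (simp add: d1_def d2_def add_ac)
        qed
        then have "T \<in> C"
          by (auto simp: C_def T_def)
        moreover have "w = (\<lambda>j\<in>{..<Suc s}. w0 j + f * T j)"
        proof (rule PiE_ext)
          show "w \<in> {..<Suc s} \<rightarrow>\<^sub>E UNIV" "(\<lambda>j\<in>{..<Suc s}. w0 j + f * T j) \<in> {..<Suc s} \<rightarrow>\<^sub>E UNIV"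
            using z wU by (auto simp: A_def PiE_def)
          fix j assume "j \<in> {..<Suc s}"
          then show "w j = (\<lambda>j\<in>{..<Suc s}. w0 j + f * T j) j"
            using T[of j] by (simp add: algebra_simps)
        qed
        moreover have "U = (\<lambda>i\<in>{..<s}. U0 i - (\<Sum>j<Suc s. T j * c i j))"
        proof (rule PiE_ext)
          show "U \<in> {..<s} \<rightarrow>\<^sub>E UNIV" "(\<lambda>i\<in>{..<s}. U0 i - (\<Sum>j<Suc s. T j * c i j)) \<in> {..<s} \<rightarrow>\<^sub>E UNIV"
            using z wU by (auto simp: A_def PiE_def)
          fix i assume i: "i \<in> {..<s}"
          have "(\<Sum>j<Suc s. (w j - w0 j) * c i j) = f * (\<Sum>j<Suc s. T j * c i j)"
            unfolding sum_distrib_left by (intro sum.cong) (auto simp: T mult.assoc)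
          moreover have "(\<Sum>j<Suc s. (w j - w0 j) * c i j) = f * (U0 i - U i)"
            using eq' i by blast
          ultimately have "f * (U0 i - U i) = f * (\<Sum>j<Suc s. T j * c i j)"
            by (rule trans[OF sym, rotated])
          then have "U0 i - U i = (\<Sum>j<Suc s. T j * c i j)"
            using f(1) by (simp del: sum.lessThan_Suc)
          then show "U i = (\<lambda>i\<in>{..<s}. U0 i - (\<Sum>j<Suc s. T j * c i j)) i"
            using i by (simp add: algebra_simps)
        qed
        ultimately show "z \<in> E ` C"
          unfolding wU E_def by blast
      qed
      moreover have "finite C"
        unfolding C_def by (intro finite_PiE finite_box finite_lessThan)
      ultimately show ?thesis
        by (meson card_image_le card_mono finite_imageI order_trans)
    next
      case True
      then show ?thesis
        by (metis card.empty le0)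
    qed
  qed
  then have "CARD('a) ^ (a * a * Suc s + (a + e - d1) * (a + e - d2) * s)
      \<le> CARD('a) ^ ((a + e) * (a + e) * s + (a - d1) * (a - d2) * Suc s)"
    by (simp only: A_def B_def C_def card_cartesian_product card_box card_PiE finite_lessThan
        prod_constant card_lessThan power_mult power_add)
  moreover have "CARD('a) > 1"
    using card_mono[of UNIV "{0, 1 :: 'a}"] by simp
  ultimately have "a * a * Suc s + (a + e - d1) * (a + e - d2) * s
      \<le> (a + e) * (a + e) * s + (a - d1) * (a - d2) * Suc s"
    using power_increasing_iff by blast
  \<comment> \<open>The inequality amounts to \<open>(a - s * e) * (d1 + d2) \<le> d1 * d2\<close>,
    which the choice \<open>a = s * e + d1 + d2\<close> makes impossible.\<close>
  moreover have "a - d1 = s * e + d2" "a - d2 = s * e + d1"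
    and "a + e - d1 = s * e + e + d2" "a + e - d2 = s * e + e + d1"
    and "a = s * e + d1 + d2"
    by (simp_all add: a d1_def d2_def)
  ultimately have "d1 * d1 + d1 * d2 + d2 * d2 \<le> 0"
    by (simp add: algebra_simps)
  then show False
    using f(2) by (auto simp: d1_def d2_def)
qed

text \<open>The orders attained on a space number at least its dimension: an element is determined
  by its coefficients at those indices, since a nonzero difference of two elements has one of those
  orders.\<close>

lemma distinct_orders:
  fixes f :: "'a::{field,finite} poly poly"
  assumes f: "prime_elem f" "ev x y f = 0" and V: "\<And>g. g \<in> box m m \<Longrightarrow> f dvd g \<Longrightarrow> g = 0"
  shows "\<exists>\<phi>. (\<forall>j<m * m. \<phi> j \<in> box m m \<and> \<phi> j \<noteq> 0) \<and> inj_on (\<lambda>j. subdegree (ev x y (\<phi> j))) {..<m * m}"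
proof -
  define V' where "V' = (box m m - {0} :: 'a poly poly set)"
  define ord where "ord g = subdegree (ev x y g)" for g
  define Os where "Os = ord ` V'"
  have fin: "finite Os"
    by (simp add: Os_def V'_def finite_box)
  define R where "R g = restrict (\<lambda>i. ev x y g $ i) Os" for g
  have "inj_on R (box m m)"
  proof (rule inj_onI, rule ccontr)
    fix g h assume gh: "g \<in> box m m" "h \<in> box m m" "R g = R h" "g \<noteq> h"
    then have "g - h \<in> V'"
      by (simp add: V'_def box_diff)
    then have "ord (g - h) \<in> Os"
      by (simp add: Os_def)
    then have "ev x y g $ ord (g - h) = ev x y h $ ord (g - h)"
      using fun_cong[OF gh(3), of "ord (g - h)"] by (simp add: R_def)
    then have "ev x y (g - h) $ ord (g - h) = 0"
      by (simp add: ev_diff)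
    then have "ev x y (g - h) = 0"
      unfolding ord_def using nth_subdegree_nonzero by blast
    then show False
      using V[of "g - h"] gh ev_eq_0_iff[OF f, of "g - h"] by (simp add: box_diff)
  qed
  then have "card (box m m :: 'a poly poly set) \<le> card (Os \<rightarrow>\<^sub>E (UNIV :: 'a set))"
    using fin by (intro card_inj_on_le[of R]) (auto simp: R_def intro: finite_PiE)
  then have "CARD('a) ^ (m * m) \<le> CARD('a) ^ card Os"
    using fin by (simp add: card_box card_PiE)
  moreover have "CARD('a) > 1"
    using card_mono[of UNIV "{0, 1 :: 'a}"] by simp
  ultimately have "m * m \<le> card Os"
    using power_increasing_iff by blast
  then obtain S where S: "S \<subseteq> Os" "card S = m * m" "finite S"
    using fin by (metis obtain_subset_with_card_n)
  then obtain h where h: "bij_betw h {..<m * m} S"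
    using ex_bij_betw_nat_finite[OF S(3)] by (auto simp: atLeast0LessThan)
  define \<phi> where "\<phi> j = inv_into V' ord (h j)" for j
  have "h j \<in> ord ` V'" if "j < m * m" for j
    using h that S(1) by (auto simp: bij_betw_def Os_def)
  then have \<phi>: "\<phi> j \<in> V'" "ord (\<phi> j) = h j" if "j < m * m" for j
    using that by (simp_all add: \<phi>_def inv_into_into f_inv_into_f)
  have "inj_on (\<lambda>j. ord (\<phi> j)) {..<m * m}"
    using h \<phi>(2) by (auto simp: bij_betw_def inj_on_def)
  then show ?thesis
    using \<phi>(1) by (intro exI[of _ \<phi>]) (auto simp: V'_def ord_def)
qed

text \<open>The left side counts zeros of \<open>G\<close> with multiplicity \<open>s\<close>; the
  right side is Bezout's bound with both degrees of \<open>G\<close> at most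
  \<open>CARD('a) * m + a\<close>, where \<open>a\<close> comes from \<open>siegel_mod\<close>. One
  relation fewer than the \<open>m * m\<close> basis functions leaves a nontrivial solution.\<close>

theorem stepanov:
  fixes f :: "'a::finite_field poly poly"
  assumes p: "prime CARD('a)" and f: "prime_elem f" and ne: "reg_points f \<noteq> {}"
    and m: "2 \<le> m" "\<not> (degX f < m \<and> degY f < m)" "m * m \<le> CARD('a)"
    and small: "(degX f + degY f) * m < CARD('a)"
    and D: "degX f \<le> D" "degY f \<le> D" and s: "s = m * m - 1"
  shows "card (reg_points f) * s
    \<le> (degX f + degY f) * (CARD('a) * m + s * (m + s * D) + degX f + degY f)"
proof -
  have "\<exists>y. y $ 0 = snd P \<and> ev (fst P) y f = 0" if "P \<in> reg_points f" for P
    using reg_point_param[of "fst P" "snd P" f] that by simp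
  then obtain y where y: "\<And>P. P \<in> reg_points f \<Longrightarrow> y P $ 0 = snd P"
    and evf: "\<And>P. P \<in> reg_points f \<Longrightarrow> ev (fst P) (y P) f = 0"
    by metis
  have unit: "ev (fst P) (y P) (pderiv f) $ 0 \<noteq> 0" if "P \<in> reg_points f" for P
    using that y[OF that] by (cases P) (auto simp: ev_nth_0 reg_points_def)
  obtain P where P: "P \<in> reg_points f"
    using ne by blast
  have ms: "m * m = Suc s"
    using m(1) s by (cases m) auto
  have f0: "f \<noteq> 0"
    using f by (simp add: prime_elem_not_zeroI)
  \<comment> \<open>Nonzero multiples of \<open>f\<close> have at least the bidegree of
    \<open>f\<close> and do not fit into \<open>box m m\<close>, so this space embeds into the
    functions on the curve.\<close>
  have V: "g = 0" if "g \<in> box m m" "f dvd g" for g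
  proof (rule ccontr)
    assume "g \<noteq> 0"
    then have "degX g < m" "degY g < m" "degX f \<le> degX g" "degY f \<le> degY g"
      using that dvd_imp_degX_le[of f g] dvd_imp_degree_le[of f g] by (auto simp: box_iff)
    then show False
      using m(2) by linarith
  qed
  have "\<exists>\<phi>. (\<forall>j<m * m. \<phi> j \<in> box m m \<and> \<phi> j \<noteq> 0)
      \<and> inj_on (\<lambda>j. subdegree (ev (fst P) (y P) (\<phi> j))) {..<m * m}"
    by (rule distinct_orders[OF f evf[OF P] V])
  then obtain \<phi> where \<phi>': "\<forall>j<Suc s. \<phi> j \<in> box m m \<and> \<phi> j \<noteq> 0"
    and inj: "inj_on (\<lambda>j. subdegree (ev (fst P) (y P) (\<phi> j))) {..<Suc s}"
    unfolding ms by (elim exE conjE)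
  then have \<phi>: "\<phi> j \<in> box m m \<and> \<phi> j \<noteq> 0" if "j < Suc s" for j
    using that by blast
  \<comment> \<open>Each application of \<open>delta f\<close> raises both degrees by at most
    \<open>D\<close>, so \<open>e\<close> serves for all iterates below \<open>s\<close>.\<close>
  define e where "e = m + s * D"
  define a where "a = s * e + degX f + degY f"
  have iter: "(delta f ^^ i) g \<in> box (m + i * D) (m + i * D)" if "g \<in> box m m" for i g
  proof (induction i)
    case (Suc i)
    show ?case
      using box_delta[OF Suc, of f] D by (auto elim!: box_mono)
  qed (use that in simp)
  have "(delta f ^^ i) (\<phi> j) \<in> box e e" if "i < s" "j < Suc s" for i j
    using iter[of "\<phi> j" i] \<phi>[OF that(2)] that(1) by (auto simp: e_def elim!: box_mono)
  then have "\<exists>w. (\<forall>j<Suc s. w j \<in> box a a) \<and> (\<forall>i<s. f dvd (\<Sum>j<Suc s. w j * (delta f ^^ i) (\<phi> j)))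
    \<and> (\<exists>j<Suc s. \<not> f dvd w j)"
    using m(1,2) by (intro siegel_mod[OF f0 _ _ a_def]) auto
  then obtain w k where w: "\<And>j. j < Suc s \<Longrightarrow> w j \<in> box a a"
    and orth: "\<And>i. i < s \<Longrightarrow> f dvd (\<Sum>j<Suc s. w j * (delta f ^^ i) (\<phi> j))"
    and k: "k < Suc s" "\<not> f dvd w k"
    by blast
  define G where "G = (\<Sum>j<Suc s. w j * \<phi> j ^ CARD('a))"
  have ev_orth: "(\<Sum>j<Suc s. ev (fst Q) (y Q) (w j)
      * (dmul (ev (fst Q) (y Q) (pderiv f)) ^^ i) (ev (fst Q) (y Q) (\<phi> j))) = 0"
    if "Q \<in> reg_points f" "i < s" for Q i
    using ev_dvd[OF orth[OF that(2)], of "fst Q" "y Q"] evf[OF that(1)]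
    by (simp only: ev_sum ev_mult ev_delta_funpow[OF evf[OF that(1)]] dvd_0_left_iff)
  have ev_G: "ev x' y' G = (\<Sum>j<Suc s. ev x' y' (w j) * ev x' y' (\<phi> j) ^ CARD('a))" for x' y'
    by (simp only: G_def ev_sum ev_mult ev_power)
  \<comment> \<open>One branch suffices for nonvanishing; \<open>small\<close> keeps the orders of
    the basis functions there below the characteristic.\<close>
  have "ev (fst P) (y P) G \<noteq> 0"
    unfolding ev_G
  proof (rule sum_power_CARD_neq_0[OF p _ _ unit[OF P] _ inj ev_orth[OF P]])
    fix j assume j: "j \<in> {..<Suc s}"
    have "degX (\<phi> j) < m" "degY (\<phi> j) < m" "\<not> f dvd \<phi> j"
      using j \<phi>[of j] V[of "\<phi> j"] by (auto simp: box_iff)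
    then have "degX f * degY (\<phi> j) + degY f * degX (\<phi> j) \<le> (degX f + degY f) * m"
      unfolding add_mult_distrib by (intro add_mono mult_mono) auto
    then show "ev (fst P) (y P) (\<phi> j) \<noteq> 0 \<and> subdegree (ev (fst P) (y P) (\<phi> j)) < CARD('a)"
      using subdegree_ev_le[OF f evf[OF P] \<open>\<not> f dvd \<phi> j\<close>] small by linarith
  qed (use k ev_eq_0_iff[OF f evf[OF P]] in auto)
  then have fG: "\<not> f dvd G"
    using ev_eq_0_iff[OF f evf[OF P]] by blast
  have "fps_X ^ s dvd ev (fst Q) (y Q) G" if Q: "Q \<in> reg_points f" for Q
  proof (rule dmul_vanishing_order[OF p unit[OF Q]])
    define e where "e = ev (fst Q) (y Q)"
    define d where "d = dmul (e (pderiv f))"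
    have d_pow: "d (a ^ CARD('a)) = 0" for a
      using fps_deriv_power_CARD[OF p] by (simp add: d_def dmul_def)
    have "(d ^^ l) (e G) = (\<Sum>j<Suc s. (d ^^ l) (e (w j)) * e (\<phi> j) ^ CARD('a))" for l
    proof (induction l)
      case (Suc l)
      have "(d ^^ Suc l) (e G) = d (\<Sum>j<Suc s. (d ^^ l) (e (w j)) * e (\<phi> j) ^ CARD('a))"
        using Suc by simp
      also have "\<dots> = (\<Sum>j<Suc s. (d ^^ Suc l) (e (w j)) * e (\<phi> j) ^ CARD('a))"
        unfolding d_def dmul_sum dmul_mult unfolding d_def[symmetric] d_pow by simp
      finally show ?case .
    qed (simp add: e_def ev_G)
    \<comment> \<open>Rationality of the point enters here: constant terms are fixed by Frobenius,
      which brings back the relations defining \<open>w\<close>, with the derivations shifted to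
      \<open>w\<close>.\<close>
    moreover have "(\<Sum>j<Suc s. (d ^^ l) (e (w j)) * e (\<phi> j) ^ CARD('a)) $ 0
        = (\<Sum>j<Suc s. (d ^^ l) (e (w j)) * e (\<phi> j)) $ 0" for l
      unfolding fps_sum_nth fps_mult_nth_0 fps_nth_power_0 finite_field_power_card_eq_same ..
    moreover have "(\<Sum>j<Suc s. (d ^^ l) (e (w j)) * e (\<phi> j)) = 0" if "l < s" for l
      using dmul_orth_shift[OF ev_orth[OF Q], of s 0 l] that by (simp add: d_def e_def)
    ultimately show "(dmul (ev (fst Q) (y Q) (pderiv f)) ^^ l) (ev (fst Q) (y Q) G) $ 0 = 0" if "l < s" for l
      using that by (simp only: d_def e_def fps_zero_nth)
    show "s \<le> CARD('a)"
      using m(3) ms by simp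
  qed
  then have "card (reg_points f) * s \<le> degX f * degY G + degY f * degX G"
    by (intro bezout_points[OF f fG, of _ y]) (simp_all add: y evf)
  also have "degX G \<le> CARD('a) * m + a \<and> degY G \<le> CARD('a) * m + a"
  proof -
    have "degX (w j * \<phi> j ^ CARD('a)) \<le> CARD('a) * m + a \<and> degY (w j * \<phi> j ^ CARD('a)) \<le> CARD('a) * m + a"
      if "j < Suc s" for j
    proof -
      have "degX (\<phi> j) * CARD('a) \<le> CARD('a) * m" "degY (\<phi> j) * CARD('a) \<le> CARD('a) * m"
        and "degX (w j) \<le> a" "degY (w j) \<le> a"
        using \<phi>[OF that] w[OF that] by (auto simp: box_iff)
      then show ?thesis
        using degX_mult_le[of "w j" "\<phi> j ^ CARD('a)"] degree_mult_le[of "w j" "\<phi> j ^ CARD('a)"]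
          degX_power_le[of "\<phi> j" "CARD('a)"] degree_power_le[of "\<phi> j" "CARD('a)"] by linarith
    qed
    then show ?thesis
      unfolding G_def by (intro conjI degX_sum_le degree_sum_le) auto
  qed
  then have "degX f * degY G + degY f * degX G \<le> (degX f + degY f) * (CARD('a) * m + a)"
    unfolding add_mult_distrib by (intro add_mono mult_mono) auto
  finally show ?thesis
    by (simp add: a_def e_def algebra_simps)
qed

section \<open>Components of small degree\<close>

definition bideg_le :: "'a::comm_ring_1 poly poly \<Rightarrow> nat \<Rightarrow> nat \<Rightarrow> bool" where
  "bideg_le g a b \<longleftrightarrow> degX g \<le> a \<and> degY g \<le> b"

lemma bideg_le_mono: "bideg_le g a b \<Longrightarrow> a \<le> a' \<Longrightarrow> b \<le> b' \<Longrightarrow> bideg_le g a' b'"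
  by (auto simp: bideg_le_def)

lemma bideg_le_mult: "bideg_le g a b \<Longrightarrow> bideg_le h c d \<Longrightarrow> bideg_le (g * h) (a + c) (b + d)"
  unfolding bideg_le_def
  by (meson add_mono degX_mult_le degree_mult_le order_trans)

lemma bideg_le_power: "bideg_le g a b \<Longrightarrow> bideg_le (g ^ n) (a * n) (b * n)"
  unfolding bideg_le_def
  by (meson degX_power_le degree_power_le mult_le_mono1 order_trans)

lemma bideg_le_add: "bideg_le g a b \<Longrightarrow> bideg_le h a b \<Longrightarrow> bideg_le (g + h) a b"
  by (simp add: bideg_le_def degX_add_le degree_add_le)

lemma bideg_le_uminus: "bideg_le g a b \<Longrightarrow> bideg_le (- g) a b"
  by (simp add: bideg_le_def)

lemma bideg_le_diff: "bideg_le g a b \<Longrightarrow> bideg_le h a b \<Longrightarrow> bideg_le (g - h) a b"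
  by (simp add: bideg_le_def degX_diff_le degree_diff_le)

lemma bideg_le_const2: "bideg_le (const2 c) 0 0"
  and bideg_le_1: "bideg_le 1 0 0"
  and bideg_le_polyX: "bideg_le polyX 1 0"
  and bideg_le_polyY: "bideg_le polyY 0 1"
  by (simp_all add: bideg_le_def)

lemma bideg_le_const2_mult: "bideg_le g a b \<Longrightarrow> bideg_le (const2 c * g) a b"
  using bideg_le_mult[OF bideg_le_const2, of g a b c] by simp

lemma bideg_le_of_nat_mult: "bideg_le g a b \<Longrightarrow> bideg_le (of_nat m * g) a b"
  unfolding of_nat_eq_const2[of m] by (rule bideg_le_const2_mult)

lemma bideg_le_delta:
  assumes "bideg_le g a b"
  shows "bideg_le (delta f g) (degX f + a) (degY f + b)"
proof -
  have "g \<in> box (Suc a) (Suc b)"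
    using assms by (auto simp: box_iff bideg_le_def)
  then show ?thesis
    using box_delta[of g "Suc a" "Suc b" f] by (auto simp: box_iff bideg_le_def)
qed

lemma delta_0 [simp]: "delta f 0 = 0" and delta_1 [simp]: "delta f 1 = 0"
  and delta_add: "delta f (g + h) = delta f g + delta f h"
  and delta_diff: "delta f (g - h) = delta f g - delta f h"
  and delta_mult: "delta f (g * h) = delta f g * h + g * delta f h"
  and delta_self: "delta f f = 0"
  by (simp_all add: delta_def pderiv_add pderiv_diff pderiv_mult pderivX_add pderivX_diff
      pderivX_mult algebra_simps) (simp add: pderivX_def)

lemma delta_power: "delta f (g ^ n) = of_nat n * g ^ (n - 1) * delta f g"
proof (induction n)
  case (Suc n)
  then show ?case
    by (cases n) (simp_all add: delta_mult algebra_simps)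
qed simp

lemma delta_polyX: "delta f polyX = pderiv f" and delta_polyY: "delta f polyY = - pderivX f"
proof -
  have 1: "pderivX polyX = (1 :: 'a poly poly)" "pderiv polyY = (1 :: 'a poly poly)"
    by (simp_all add: polyX_def polyY_def pderivX_pCons pderiv_pCons one_pCons)
  have 0: "pderiv polyX = (0 :: 'a poly poly)" "pderivX polyY = (0 :: 'a poly poly)"
    by (simp_all add: polyX_def polyY_def pderivX_pCons pderiv_pCons one_pCons)
  show "delta f polyX = pderiv f" "delta f polyY = - pderivX f"
    by (simp_all add: delta_def 0 1)
qed

lemma dvd_delta: "f dvd g \<Longrightarrow> f dvd delta f g"
  by (auto simp: dvd_def delta_mult delta_self)

lemma not_dvd_const2: "prime_elem f \<Longrightarrow> c \<noteq> 0 \<Longrightarrow> \<not> f dvd const2 (c :: 'a::field)"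
proof
  assume f: "prime_elem f" "c \<noteq> 0" "f dvd const2 c"
  then have "f dvd const2 c * const2 (inverse c)"
    by simp
  then have "f dvd 1"
    using f(2) by (simp add: const2_mult[symmetric])
  then show False
    using f(1) prime_elem_not_unit by blast
qed

text \<open>Number of nonzero roots, with multiplicity, in an algebraic closure.\<close>

definition nzroots :: "'a::idom poly \<Rightarrow> nat" where "nzroots q = degree q - order 0 q"

lemma nzroots_mult:
  assumes "q \<noteq> 0" "r \<noteq> (0 :: 'a::idom poly)"
  shows "nzroots (q * r) = nzroots q + nzroots r"
  using assms order_degree[of q 0] order_degree[of r 0]
  by (simp add: nzroots_def degree_mult_eq order_mult)

lemma nzroots_dvd_monom:
  assumes "q dvd monom (1 :: 'a::idom) j"
  shows "nzroots q = 0"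
proof -
  obtain r where r: "monom 1 j = q * r"
    using assms ..
  have "monom (1 :: 'a) j \<noteq> 0"
    by simp
  then have "q \<noteq> 0" "r \<noteq> 0"
    using r by (metis mult_zero_left, metis mult_zero_right r)
  then have "nzroots q + nzroots r = nzroots (monom (1 :: 'a) j)"
    by (simp add: r nzroots_mult)
  also have "order 0 (monom (1 :: 'a) j) = j"
    using order_power_n_n[of 0 j] by (simp add: monom_altdef)
  then have "nzroots (monom (1 :: 'a) j) = 0"
    by (simp add: nzroots_def degree_monom_eq)
  finally show ?thesis
    by simp
qed

text \<open>Split off from \<open>q\<close> its power of \<open>X\<close>; the remaining factor is
  coprime to \<open>X\<close> and has to divide \<open>r\<close>.\<close>

lemma dvd_monom_mult_imp_nzroots_le:
  fixes q :: "'a::field_gcd poly"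
  assumes "q dvd monom 1 L * r" "r \<noteq> 0"
  shows "nzroots q \<le> degree r"
proof -
  have "q \<noteq> 0"
    using assms by auto
  then obtain g where g: "q = [:-0, 1:] ^ order 0 q * g" "\<not> [:-0, 1:] dvd g"
    using order_decomp[of q 0] by blast
  then have "g \<noteq> 0"
    by auto
  have "prime_elem [:0, 1 :: 'a:]"
    by (intro prime_elem_linear_field_poly) simp
  then have "coprime [:0, 1:] g"
    using g(2) by (intro prime_elem_imp_coprime) auto
  then have "coprime g ([:0, 1:] ^ L)"
    by (simp add: coprime_commute)
  moreover have "g dvd [:0, 1:] ^ L * r"
    using assms(1) g(1) by (metis dvd_mult_right monom_altdef smult_1_left)
  ultimately have "g dvd r"
    using coprime_dvd_mult_right_iff by blast
  then have "degree g \<le> degree r"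
    using assms(2) by (rule dvd_imp_degree_le)
  moreover have "degree q = order 0 q + degree g"
    using \<open>g \<noteq> 0\<close> by (subst g(1)) (simp add: degree_mult_eq degree_power_eq)
  ultimately show ?thesis
    by (simp add: nzroots_def)
qed

text \<open>The monomials \<open>Y\<^sup>i X\<^sup>l\<close> with \<open>i < N\<close> and \<open>l < nzroots (coeff f 0)\<close> are independent modulo \<open>(f, K)\<close>.\<close>

lemma chain_bound:
  fixes f H K :: "'a::{finite,field_gcd} poly poly"
  assumes f: "prime_elem f" and f0: "coeff f 0 \<noteq> 0"
    and dvd: "f dvd polyY ^ N * H - polyX ^ L * K" and fK: "\<not> f dvd K"
  shows "N * nzroots (coeff f 0) \<le> degX f * degY K + degY f * degX K"
proof -
  define \<gamma> where "\<gamma> = nzroots (coeff f 0)"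
  have "card ({..<N} \<times> {..<\<gamma>}) \<le> degX f * degY K + degY f * degX K"
  proof (rule bezout_independent[OF f fK, of _ "\<lambda>(i, l). polyY ^ i * polyX ^ l"])
    fix c :: "nat \<times> nat \<Rightarrow> 'a" and U V
    assume eq: "(\<Sum>i\<in>{..<N} \<times> {..<\<gamma>}. const2 (c i) * (case i of (i, l) \<Rightarrow> polyY ^ i * polyX ^ l)) = f * U + K * V"
    define q where "q i = (\<Sum>l<\<gamma>. monom (c (i, l)) l)" for i
    have "const2 a * (polyY ^ i * polyX ^ l) = monom (monom a l) i" for a :: 'a and i l
    proof -
      have "polyX ^ l = [:monom (1 :: 'a) l:]"
        by (induction l) (simp_all add: polyX_def one_pCons monom_Suc)
      moreover have "polyY ^ i = monom (1 :: 'a poly) i"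
        by (induction i) (simp_all add: polyY_def monom_Suc)
      ultimately show ?thesis
        by (simp add: const2_def smult_monom mult.commute)
    qed
    then have "(\<Sum>i<N. monom (q i) i) = (\<Sum>i<N. \<Sum>l<\<gamma>. const2 (c (i, l)) * (polyY ^ i * polyX ^ l))"
      by (simp add: q_def monom_sum)
    also have "\<dots> = f * U + K * V"
      unfolding eq[symmetric] by (simp add: sum.cartesian_product split_def)
    finally have lhs: "(\<Sum>i<N. monom (q i) i) = f * U + K * V" .
    have "q i = 0" if "i < N" for i
      using that
    proof (induction i rule: less_induct)
      case (less i)
      obtain W where W: "polyY ^ N * H - polyX ^ L * K = f * W"
        using dvd ..
      \<comment> \<open>After multiplication by \<open>polyX ^ L\<close> the congruence turns
        \<open>K\<close> into a multiple of \<open>polyY ^ N\<close>, so the coefficients below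
        \<open>N\<close> come from \<open>f * U'\<close> alone.\<close>
      define U' where "U' = polyX ^ L * U - W * V"
      define Z where "Z = (\<Sum>i<N. monom (q i) i)"
      have Z: "polyX ^ L * Z = f * U' + polyY ^ N * (H * V)"
      proof -
        have "polyX ^ L * Z = f * (polyX ^ L * U) + (polyX ^ L * K) * V"
          unfolding Z_def lhs by (simp add: algebra_simps)
        also have "polyX ^ L * K = polyY ^ N * H - f * W"
          using W by (simp add: algebra_simps)
        finally show ?thesis
          by (simp add: U'_def algebra_simps)
      qed
      have X: "polyX ^ L = [:monom (1 :: 'a) L:]"
        by (induction L) (simp_all add: polyX_def one_pCons monom_Suc)
      have Y: "polyY ^ N = monom (1 :: 'a poly) N"
        by (induction N) (simp_all add: polyY_def monom_Suc)
      have coeffs: "monom 1 L * q j = coeff (f * U') j" if "j < N" for j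
      proof -
        have "coeff Z j = q j"
          using that by (simp add: Z_def coeff_sum if_distrib cong: if_cong)
        then have "coeff (polyX ^ L * Z) j = monom 1 L * q j"
          by (simp add: X)
        then show ?thesis
          using that by (simp add: Z Y coeff_monom_mult)
      qed
      have U'0: "coeff U' j = 0" if "j < i" for j
        using that
      proof (induction j rule: less_induct)
        case (less j)
        have "coeff (f * U') j = (\<Sum>a\<le>j. coeff f a * coeff U' (j - a))"
          by (rule coeff_mult)
        also have "\<dots> = coeff f 0 * coeff U' j"
          using less by (subst sum.remove[of _ 0]) auto
        finally show ?case
          using coeffs[of j] less.prems \<open>i < N\<close> \<open>\<And>y. y < i \<Longrightarrow> y < N \<Longrightarrow> q y = 0\<close> f0 by simp
      qed
      have "coeff (f * U') i = (\<Sum>a\<le>i. coeff f a * coeff U' (i - a))"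
        by (rule coeff_mult)
      also have "\<dots> = coeff f 0 * coeff U' i"
        using U'0 by (subst sum.remove[of _ 0]) auto
      \<comment> \<open>With the lower coefficients of \<open>U'\<close> gone, only the product with
        \<open>coeff f 0\<close> remains, and \<open>coeff f 0\<close> has more nonzero roots than
        the degree of \<open>q i\<close> allows.\<close>
      finally have "coeff f 0 dvd monom 1 L * q i"
        using coeffs[OF less.prems] by simp
      moreover have "degree (q i) < \<gamma>" if "q i \<noteq> 0"
      proof -
        have "\<gamma> \<noteq> 0"
          using that by (cases \<gamma>) (auto simp: q_def)
        then have "degree (q i) \<le> \<gamma> - 1"
          unfolding q_def by (intro degree_sum_le) (auto intro: order_trans[OF degree_monom_le])
        then show ?thesis
          using \<open>\<gamma> \<noteq> 0\<close> by simp
      qed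
      ultimately show ?case
        using dvd_monom_mult_imp_nzroots_le[of "coeff f 0" L "q i"] unfolding \<gamma>_def by linarith
    qed
    moreover have "coeff (q i) l = c (i, l)" if "l < \<gamma>" for i l
      using that by (simp add: q_def coeff_sum if_distrib cong: if_cong)
    ultimately have "c (i, l) = 0" if "i < N" "l < \<gamma>" for i l
      using that by (metis coeff_0)
    then show "\<forall>i\<in>{..<N} \<times> {..<\<gamma>}. c i = 0"
      by auto
  qed simp
  then show ?thesis
    by (simp add: card_cartesian_product \<gamma>_def)
qed

section \<open>Prime factors of the curve and their contact with the line
  \<open>Y = 0\<close>\<close>

definition fermat_poly :: "nat \<Rightarrow> 'a::comm_ring_1 poly poly" where
  "fermat_poly n = polyX ^ n + polyY ^ n - 1"

text \<open>The \<open>delta f\<close>-derivative of \<open>fermat_poly n\<close> with its factor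
  \<open>n\<close> removed.\<close>

definition flow :: "'a::idom poly poly \<Rightarrow> nat \<Rightarrow> 'a poly poly" where
  "flow f n = polyX ^ (n - 1) * pderiv f - polyY ^ (n - 1) * pderivX f"

lemma delta_fermat_poly: "delta f (fermat_poly n) = of_nat n * flow f n"
  by (simp add: fermat_poly_def flow_def delta_add delta_diff delta_power delta_polyX delta_polyY
      algebra_simps)

lemma bideg_le_fermat_poly: "bideg_le (fermat_poly n) n n"
  using bideg_le_power[OF bideg_le_polyX, of n] bideg_le_power[OF bideg_le_polyY, of n]
  unfolding fermat_poly_def
  by (intro bideg_le_diff bideg_le_add) (auto elim!: bideg_le_mono intro: bideg_le_mono[OF bideg_le_1])

lemma bideg_le_pderiv: "bideg_le (pderiv f) (degX f) (degY f)"
  and bideg_le_pderivX: "bideg_le (pderivX f) (degX f) (degY f)"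
  using degX_pderivX_le[of f] degY_pderivX_le[of f] degX_pderiv_le[of f] degree_pderiv_le[of f]
  by (auto simp: bideg_le_def)

lemma bideg_le_flow: "bideg_le (flow f n) (n + degX f) (n + degY f)"
proof -
  have "bideg_le (polyX ^ (n - 1) * pderiv f) (n - 1 + degX f) (0 + degY f)"
    using bideg_le_power[OF bideg_le_polyX, of "n - 1"] by (intro bideg_le_mult bideg_le_pderiv) simp
  moreover have "bideg_le (polyY ^ (n - 1) * pderivX f) (0 + degX f) (n - 1 + degY f)"
    using bideg_le_power[OF bideg_le_polyY, of "n - 1"] by (intro bideg_le_mult bideg_le_pderivX) simp
  ultimately show ?thesis
    unfolding flow_def by (intro bideg_le_diff) (auto elim!: bideg_le_mono)
qed

text \<open>In the application \<open>\<kappa>\<close> and \<open>\<nu>\<close> are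
  \<open>k / r\<close> and \<open>n / r\<close>. The degrees of \<open>f\<close> and the exponents
  \<open>k\<close>, \<open>n\<close>, \<open>\<kappa>\<close> are nonzero in the field. The last two
  conditions say that \<open>Y\<close> does not divide \<open>f\<close> and that, over an algebraic
  closure, the curve meets \<open>Y = 0\<close> somewhere with \<open>X\<close> nonzero.\<close>

locale fermat_component =
  fixes f :: "'a::{finite_field,field_gcd} poly poly" and k n \<kappa> \<nu> :: nat
  assumes p: "prime CARD('a)" and f: "prime_elem f"
    and dvd: "f dvd fermat_poly n ^ \<kappa> - fermat_poly k ^ \<nu>"
    and \<kappa>\<nu>: "\<kappa> * n = \<nu> * k" "0 < \<kappa>" "0 < \<nu>" "\<kappa> < CARD('a)"
    and kn: "0 < k" "k < CARD('a)" "0 < n" "n < CARD('a)" "k \<noteq> n"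
    and deg: "0 < degX f" "degX f < CARD('a)" "0 < degY f" "degY f < CARD('a)"
    and f0: "coeff f 0 \<noteq> 0" and nz: "0 < nzroots (coeff f 0)"
begin

abbreviation "A \<equiv> fermat_poly n :: 'a poly poly"
abbreviation "B \<equiv> fermat_poly k :: 'a poly poly"
abbreviation "a1 \<equiv> flow f n"
abbreviation "b1 \<equiv> flow f k"
abbreviation "x1 \<equiv> pderiv f"
abbreviation "y1 \<equiv> - pderivX f"

lemma dvd_multD: "f dvd g * h \<Longrightarrow> f dvd g \<or> f dvd h"
  using prime_elem_dvd_multD[OF f] .

lemma dvd_powerD: "f dvd g ^ m \<Longrightarrow> f dvd g"
  using prime_elem_dvd_power[OF f] .

lemma not_dvd_pderiv: "\<not> f dvd pderiv f"
proof
  assume "f dvd pderiv f"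
  moreover have "of_nat (degY f) \<noteq> (0 :: 'a)"
    using deg by (intro of_nat_neq_0_CARD p) auto
  then have "coeff (pderiv f) (degY f - 1) \<noteq> 0"
    using deg f by (auto simp: coeff_pderiv of_nat_poly simp del: of_nat_Suc)
  then have "pderiv f \<noteq> 0"
    by auto
  ultimately have "degY f \<le> degY (pderiv f)"
    by (rule dvd_imp_degree_le)
  then show False
    using degree_pderiv_le[of f] deg by simp
qed

lemma not_dvd_polyX: "\<not> f dvd polyX"
  using deg dvd_imp_degree_le[of f polyX] by auto

lemma not_dvd_polyY: "\<not> f dvd polyY"
  using deg dvd_imp_degX_le[of f polyY] by auto

lemma not_dvd_of_nat: "0 < m \<Longrightarrow> m < CARD('a) \<Longrightarrow> \<not> f dvd of_nat m"
  unfolding of_nat_eq_const2[of m] by (intro not_dvd_const2 f of_nat_neq_0_CARD p)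

lemma dvd_A_iff: "f dvd A \<longleftrightarrow> f dvd B"
proof
  assume "f dvd A"
  then have "f dvd A ^ \<kappa>"
    using \<kappa>\<nu> by (meson dvd_power dvd_trans)
  then show "f dvd B"
    using dvd dvd_powerD dvd_diff_left_iff[of f "B ^ \<nu>" "A ^ \<kappa>"] dvd_diff_right_iff[of f "A ^ \<kappa>" "B ^ \<nu>"] by blast
next
  assume "f dvd B"
  then have "f dvd B ^ \<nu>"
    using \<kappa>\<nu> by (meson dvd_power dvd_trans)
  then show "f dvd A"
    using dvd dvd_powerD dvd_diff_left_iff[of f "B ^ \<nu>" "A ^ \<kappa>"] dvd_diff_right_iff[of f "A ^ \<kappa>" "B ^ \<nu>"] by blast
qed

text \<open>Equality of logarithmic derivatives: as \<open>\<kappa> * n = \<nu> * k\<close>,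
  applying \<open>delta f\<close> to \<open>A ^ \<kappa> - B ^ \<nu>\<close> produces the same
  invertible constant in both terms. Multiplying by \<open>A * B\<close> and cancelling
  \<open>A ^ \<kappa>\<close> removes the outer exponents.\<close>

lemma first_relation: "f dvd B * a1 - A * b1"
proof (cases "f dvd A")
  case True
  then show ?thesis
    using dvd_A_iff by (intro dvd_diff dvd_mult2) auto
next
  case False
  have pow: "A ^ \<kappa> = A * A ^ (\<kappa> - 1)" "B ^ \<nu> = B * B ^ (\<nu> - 1)"
    using \<kappa>\<nu> by (simp_all add: power_eq_if)
  have "f dvd delta f (A ^ \<kappa> - B ^ \<nu>)"
    by (rule dvd_delta[OF dvd])
  also have "delta f (A ^ \<kappa> - B ^ \<nu>) = of_nat (\<kappa> * n) * A ^ (\<kappa> - 1) * a1 - of_nat (\<nu> * k) * B ^ (\<nu> - 1) * b1"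
    by (simp add: delta_diff delta_power delta_fermat_poly algebra_simps)
  also have "\<dots> = of_nat (\<kappa> * n) * (A ^ (\<kappa> - 1) * a1 - B ^ (\<nu> - 1) * b1)"
    unfolding \<kappa>\<nu>(1) by (simp add: algebra_simps)
  finally have "f dvd of_nat \<kappa> * (of_nat n * (A ^ (\<kappa> - 1) * a1 - B ^ (\<nu> - 1) * b1))"
    by (simp add: mult.assoc)
  then have "f dvd A ^ (\<kappa> - 1) * a1 - B ^ (\<nu> - 1) * b1"
    using dvd_multD not_dvd_of_nat[of \<kappa>] not_dvd_of_nat[of n] \<kappa>\<nu> kn by blast
  then have "f dvd A * B * (A ^ (\<kappa> - 1) * a1 - B ^ (\<nu> - 1) * b1) - (A ^ \<kappa> - B ^ \<nu>) * (A * b1)"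
    using dvd_diff[OF dvd_mult dvd_mult2[OF dvd]] by blast
  also have "\<dots> = A ^ \<kappa> * (B * a1 - A * b1)"
    unfolding pow by (simp add: algebra_simps)
  finally show ?thesis
    using False dvd_multD dvd_powerD by blast
qed

text \<open>Membership in the ideal \<open>(f, polyY ^ j)\<close>, which expresses contact of order
  \<open>j\<close> with \<open>f\<close> along \<open>Y = 0\<close>; applying \<open>delta f\<close>
  lowers \<open>j\<close> by one.\<close>

definition mod_ideal :: "nat \<Rightarrow> 'a poly poly \<Rightarrow> bool" where
  "mod_ideal j g \<longleftrightarrow> (\<exists>U V. g = f * U + polyY ^ j * V)"

lemma mod_ideal_mult: "mod_ideal j g \<Longrightarrow> mod_ideal j (h * g)"
  unfolding mod_ideal_def
proof (elim exE)
  fix U V assume "g = f * U + polyY ^ j * V"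
  then have "h * g = f * (h * U) + polyY ^ j * (h * V)"
    by (simp add: algebra_simps)
  then show "\<exists>U V. h * g = f * U + polyY ^ j * V"
    by blast
qed

lemma mod_ideal_diff: "mod_ideal j g \<Longrightarrow> mod_ideal j h \<Longrightarrow> mod_ideal j (g - h)"
  unfolding mod_ideal_def
proof (elim exE)
  fix U V U' V' assume "g = f * U + polyY ^ j * V" "h = f * U' + polyY ^ j * V'"
  then have "g - h = f * (U - U') + polyY ^ j * (V - V')"
    by (simp add: algebra_simps)
  then show "\<exists>U V. g - h = f * U + polyY ^ j * V"
    by blast
qed

lemma mod_ideal_Suc: "mod_ideal (Suc j) g \<Longrightarrow> mod_ideal j g"
  unfolding mod_ideal_def by (metis mult.assoc power_Suc2)

lemma mod_ideal_delta: "mod_ideal (Suc j) g \<Longrightarrow> mod_ideal j (delta f g)"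
  unfolding mod_ideal_def
proof (elim exE)
  fix U V assume "g = f * U + polyY ^ Suc j * V"
  then have "delta f g = f * delta f U + (delta f (polyY ^ Suc j) * V + polyY ^ Suc j * delta f V)"
    by (simp add: delta_add delta_mult delta_self algebra_simps del: power_Suc)
  also have "\<dots> = f * delta f U + polyY ^ j * (of_nat (Suc j) * y1 * V + polyY * delta f V)"
    unfolding delta_power delta_polyY by (simp add: algebra_simps)
  finally have "delta f g = f * delta f U + polyY ^ j * (of_nat (Suc j) * y1 * V + polyY * delta f V)" .
  then show "\<exists>U V. delta f g = f * U + polyY ^ j * V"
    by blast
qed

lemma polyX_delta_power: "polyX * delta f (polyX ^ m) = of_nat m * polyX ^ m * x1"
  unfolding delta_power delta_polyX by (cases m) (simp_all add: algebra_simps)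

text \<open>Modulo \<open>polyY ^ (\<mu> - 1)\<close> all powers of \<open>Y\<close> drop out of
  \<open>first_relation\<close>, and the terms with \<open>polyX ^ (k + n - 1)\<close>
  cancel.\<close>

lemma contact_first_order:
  assumes \<mu>: "\<mu> = min k n"
  shows "mod_ideal (\<mu> - 1) (x1 * (polyX ^ (k - 1) - polyX ^ (n - 1)))"
proof -
  define z where "z = (polyY :: 'a poly poly) ^ (\<mu> - 1)"
  define \<alpha> where "\<alpha> = (polyY :: 'a poly poly) ^ (n - (\<mu> - 1))"
  define \<beta> where "\<beta> = (polyY :: 'a poly poly) ^ (k - (\<mu> - 1))"
  define \<alpha>1 where "\<alpha>1 = polyY ^ (n - \<mu>) * y1"
  define \<beta>1 where "\<beta>1 = polyY ^ (k - \<mu>) * y1"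
  define c where "c = polyX ^ (n - 1) * x1"
  define d where "d = polyX ^ (k - 1) * x1"
  have "0 < \<mu>" "\<mu> \<le> k" "\<mu> \<le> n"
    using \<mu> kn by auto
  then have "\<mu> - 1 + (n - (\<mu> - 1)) = n" "\<mu> - 1 + (k - (\<mu> - 1)) = k"
    and "\<mu> - 1 + (n - \<mu>) = n - 1" "\<mu> - 1 + (k - \<mu>) = k - 1"
    by linarith+
  then have Y: "(polyY :: 'a poly poly) ^ n = z * \<alpha>" "(polyY :: 'a poly poly) ^ k = z * \<beta>"
    and Y1: "polyY ^ (n - 1) * y1 = z * \<alpha>1" "polyY ^ (k - 1) * y1 = z * \<beta>1"
    unfolding z_def \<alpha>_def \<beta>_def \<alpha>1_def \<beta>1_def mult.assoc[symmetric] power_add[symmetric] by simp_all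
  have flow: "a1 = c + z * \<alpha>1" "b1 = d + z * \<beta>1"
    unfolding flow_def c_def d_def Y1[symmetric] by simp_all
  have AB: "A = polyX ^ n - 1 + z * \<alpha>" "B = polyX ^ k - 1 + z * \<beta>"
    by (simp_all add: fermat_poly_def Y)
  have X: "(polyX :: 'a poly poly) ^ n = polyX * polyX ^ (n - 1)"
    "(polyX :: 'a poly poly) ^ k = polyX * polyX ^ (k - 1)"
    using kn by (simp_all add: power_eq_if)
  obtain W where W: "B * a1 - A * b1 = f * W"
    using first_relation ..
  define E where "E = (polyX ^ k - 1) * \<alpha>1 + \<beta> * c + z * \<beta> * \<alpha>1
    - (polyX ^ n - 1) * \<beta>1 - \<alpha> * d - z * \<alpha> * \<beta>1"
  have "(polyX ^ k - 1) * c - (polyX ^ n - 1) * d = (B * a1 - A * b1) - z * E"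
    unfolding flow AB E_def by (simp add: algebra_simps)
  moreover have "(polyX ^ k - 1) * c - (polyX ^ n - 1) * d = x1 * (polyX ^ (k - 1) - polyX ^ (n - 1))"
    unfolding c_def d_def X by (simp add: algebra_simps)
  ultimately have "x1 * (polyX ^ (k - 1) - polyX ^ (n - 1)) = f * W + z * (- E)"
    by (simp add: W)
  then show ?thesis
    unfolding mod_ideal_def z_def by blast
qed

text \<open>From the relation \<open>contact_first_order\<close> and its derivative,
  \<open>polyX ^ (n - 1)\<close> can be eliminated. A power of \<open>X\<close> times
  \<open>K\<close> remains, so the cube of \<open>pderiv f\<close> has high contact along
  \<open>Y = 0\<close> away from \<open>X = 0\<close>. The derivative costs one order, whence
  \<open>\<mu> - 2\<close>.\<close>

lemma min_exponent_bound:
  assumes \<mu>: "\<mu> = min k n" "2 \<le> \<mu>"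
  shows "(\<mu> - 2) * nzroots (coeff f 0) \<le> 6 * (degX f * degY f)"
proof -
  define W where "W = (polyX :: 'a poly poly) ^ (k - 1) - polyX ^ (n - 1)"
  define g where "g = x1 * W"
  have "Suc (\<mu> - 2) = \<mu> - 1"
    using \<mu>(2) by linarith
  then have g: "mod_ideal (Suc (\<mu> - 2)) g"
    using contact_first_order[OF \<mu>(1)] by (simp add: g_def W_def)
  define x2 where "x2 = delta f x1"
  have \<delta>g: "delta f g = x2 * W + x1 * delta f W"
    by (simp add: g_def x2_def delta_mult)
  have XW: "polyX * delta f W = (of_nat (k - 1) * polyX ^ (k - 1) - of_nat (n - 1) * polyX ^ (n - 1)) * x1"
    by (simp add: W_def delta_diff right_diff_distrib polyX_delta_power algebra_simps)
  define c where "c = of_nat k - (of_nat n :: 'a)"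
  have "c \<noteq> 0"
    using kn inj_onD[OF inj_on_of_nat_CARD[OF p], of k n] by (auto simp: c_def)
  have c: "const2 c = of_nat (k - 1) - of_nat (n - 1)"
  proof -
    have "of_nat (k - 1) - of_nat (n - 1) = of_nat k - (of_nat n :: 'a poly poly)"
      using kn by (simp add: of_nat_diff)
    then show ?thesis
      unfolding c_def const2_diff of_nat_eq_const2[symmetric] by (rule sym)
  qed
  define K where "K = const2 c * x1 ^ 3"
  \<comment> \<open>The second term removes \<open>x2\<close>, the third removes
    \<open>polyX ^ (n - 1)\<close>; the factor \<open>k - n\<close> that is left is nonzero in the
    field.\<close>
  have "mod_ideal (\<mu> - 2) (polyX * x1 * delta f g - (polyX * x2) * g - (of_nat (n - 1) * x1 ^ 2) * g)"
    by (intro mod_ideal_diff mod_ideal_mult mod_ideal_delta[OF g] mod_ideal_Suc[OF g])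
  also have "polyX * x1 * delta f g - (polyX * x2) * g - (of_nat (n - 1) * x1 ^ 2) * g
      = x1 ^ 2 * (polyX * delta f W) - of_nat (n - 1) * x1 ^ 3 * W"
    unfolding \<delta>g unfolding g_def by (simp add: algebra_simps power2_eq_square power3_eq_cube)
  also have "\<dots> = polyX ^ (k - 1) * K"
    unfolding XW K_def c by (simp add: W_def algebra_simps power2_eq_square power3_eq_cube)
  finally obtain U V where UV: "polyX ^ (k - 1) * K = f * U + polyY ^ (\<mu> - 2) * V"
    unfolding mod_ideal_def by blast
  then have "polyY ^ (\<mu> - 2) * V - polyX ^ (k - 1) * K = f * (- U)"
    by simp
  then have dvd': "f dvd polyY ^ (\<mu> - 2) * V - polyX ^ (k - 1) * K"
    by (rule dvdI)
  have "\<not> f dvd K"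
    using not_dvd_pderiv dvd_multD dvd_powerD not_dvd_const2[OF f \<open>c \<noteq> 0\<close>] unfolding K_def by blast
  then have "(\<mu> - 2) * nzroots (coeff f 0) \<le> degX f * degY K + degY f * degX K"
    by (rule chain_bound[OF f f0 dvd'])
  moreover have "bideg_le K (degX f * 3) (degY f * 3)"
    unfolding K_def by (intro bideg_le_const2_mult bideg_le_power bideg_le_pderiv)
  then have "degX f * degY K + degY f * degX K \<le> degX f * (degY f * 3) + degY f * (degX f * 3)"
    unfolding bideg_le_def by (intro add_mono mult_mono) auto
  ultimately show ?thesis
    by (simp add: mult.commute)
qed

end

section \<open>Functions with vanishing Wronskian\<close>

lemma fps_mult_nth_sum_orders:
  assumes "fps_X ^ a dvd (g :: 'a::field fps)" "fps_X ^ b dvd h"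
  shows "(g * h) $ (a + b) = g $ a * h $ b"
proof -
  obtain g' h' where gh: "g = fps_X ^ a * g'" "h = fps_X ^ b * h'"
    using assms by (auto simp: dvd_def)
  have "(g * h) $ (a + b) = (fps_X ^ (a + b) * (g' * h')) $ (a + b)"
    by (simp add: gh power_add mult_ac)
  then show ?thesis
    by (simp add: gh fps_X_power_mult_nth)
qed

lemma fps_X_power_subdegree_dvd: "fps_X ^ subdegree g dvd (g :: 'a::field fps)"
  unfolding fps_X_power_dvd_iff by (intro allI impI nth_less_subdegree_zero)

text \<open>Compare the lowest coefficients of \<open>theta g * h\<close> and
  \<open>g * theta h\<close>; the characteristic permits a conclusion only about the images of the
  orders in the field.\<close>

lemma subdegree_cong_if_deriv_proportional:
  assumes "fps_deriv g * h = g * fps_deriv h" "g \<noteq> 0" "h \<noteq> (0 :: 'a::field fps)"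
  shows "of_nat (subdegree g) = (of_nat (subdegree h) :: 'a)"
proof -
  have theta_nth: "theta c $ i = of_nat i * c $ i" for c :: "'a fps" and i
    using theta_funpow_nth[of 1 c i] by simp
  have theta_dvd: "fps_X ^ subdegree c dvd theta c" for c :: "'a fps"
    unfolding fps_X_power_dvd_iff
  proof (intro allI impI)
    fix i assume "i < subdegree c"
    then have "c $ i = 0"
      by (rule nth_less_subdegree_zero)
    then show "theta c $ i = 0"
      by (simp add: theta_nth)
  qed
  have "theta g * h = g * theta h"
    using assms(1) by (simp add: theta_def dmul_def mult.assoc mult.left_commute)
  then have "(theta g * h) $ (subdegree g + subdegree h) = (g * theta h) $ (subdegree g + subdegree h)"
    by simp
  then have "of_nat (subdegree g) * (g $ subdegree g * h $ subdegree h)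
      = of_nat (subdegree h) * (g $ subdegree g * h $ subdegree h)"
    unfolding fps_mult_nth_sum_orders[OF theta_dvd fps_X_power_subdegree_dvd]
      fps_mult_nth_sum_orders[OF fps_X_power_subdegree_dvd theta_dvd] theta_nth
    by (simp only: mult_ac)
  moreover have "g $ subdegree g * h $ subdegree h \<noteq> 0"
    using assms(2,3) by simp
  ultimately show ?thesis
    by simp
qed

text \<open>Constants of the derivation are \<open>p\<close>-th powers, and the degree bound leaves only the
  elements of the prime field.\<close>

lemma proportional_if_wronskian_zero:
  fixes f U V :: "'a::{finite_field,field_gcd} poly poly"
  assumes p: "prime CARD('a)" and f: "prime_elem f" and ne: "reg_points f \<noteq> {}"
    and UV: "\<not> f dvd U" "\<not> f dvd V" and W: "f dvd delta f U * V - U * delta f V"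
    and bideg: "bideg_le U a b" "bideg_le V a b" and small: "degX f * b + degY f * a < CARD('a)"
  shows "\<exists>c. f dvd U - const2 c * V"
proof -
  obtain x z where xz: "(x, z) \<in> reg_points f"
    using ne by auto
  then obtain y where y: "y $ 0 = z" "ev x y f = 0"
    using reg_point_param by blast
  define u where "u = ev x y (pderiv f)"
  have "u $ 0 \<noteq> 0"
    using xz y by (simp add: u_def ev_nth_0 reg_points_def)
  then have "u \<noteq> 0"
    by auto
  have order_bound: "ev x y g \<noteq> 0 \<and> subdegree (ev x y g) < CARD('a)"
    if "\<not> f dvd g" "bideg_le g a b" for g
  proof -
    have "degX f * degY g + degY f * degX g \<le> degX f * b + degY f * a"
      using that(2) unfolding bideg_le_def by (intro add_mono mult_mono) auto
    then show ?thesis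
      using subdegree_ev_le[OF f y(2) that(1)] small by linarith
  qed
  define g h where "g = ev x y U" and "h = ev x y V"
  have gh: "g \<noteq> 0" "subdegree g < CARD('a)" "h \<noteq> 0" "subdegree h < CARD('a)"
    using order_bound UV bideg by (simp_all add: g_def h_def)
  have "ev x y (delta f U * V - U * delta f V) = 0"
    using ev_dvd[OF W, of x y] y by simp
  then have "u * (fps_deriv g * h) = u * (g * fps_deriv h)"
    by (simp add: ev_diff ev_mult deriv_ev_delta[OF y(2), symmetric] g_def h_def u_def mult_ac)
  then have prp: "fps_deriv g * h = g * fps_deriv h"
    using \<open>u \<noteq> 0\<close> by simp
  then have eq: "subdegree g = subdegree h"
    using subdegree_cong_if_deriv_proportional[OF prp] gh inj_onD[OF inj_on_of_nat_CARD[OF p]] by blast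
  \<comment> \<open>This \<open>c\<close> cancels the lowest terms. The remainder \<open>r\<close>
    satisfies the same Wronskian relation with \<open>h\<close>, so if it were nonzero its order
    would again be that of \<open>h\<close>, all orders being below \<open>CARD('a)\<close>.\<close>
  define c where "c = g $ subdegree g / h $ subdegree h"
  define r where "r = g - fps_const c * h"
  have "f dvd U - const2 c * V"
  proof (rule ccontr)
    assume "\<not> f dvd U - const2 c * V"
    moreover have "bideg_le (U - const2 c * V) a b"
      by (intro bideg_le_diff bideg_le_const2_mult bideg)
    moreover have "ev x y (U - const2 c * V) = r"
      by (simp add: r_def g_def h_def ev_diff ev_mult)
    ultimately have r: "r \<noteq> 0" "subdegree r < CARD('a)"
      using order_bound by force+
    have "fps_deriv r * h = r * fps_deriv h"
      using prp by (simp add: r_def algebra_simps)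
    then have "subdegree r = subdegree h"
      using subdegree_cong_if_deriv_proportional[of r h] r gh inj_onD[OF inj_on_of_nat_CARD[OF p]] by blast
    moreover have "r $ subdegree h = 0"
      using gh(3) by (simp add: r_def c_def eq)
    ultimately show False
      using r(1) nth_subdegree_nonzero by metis
  qed
  then show ?thesis ..
qed

section \<open>Elimination of the \<open>n\<close>-th powers for \<open>k < n\<close>\<close>

context fermat_component
begin

text \<open>If \<open>A\<close> vanished on \<open>f\<close>, so would \<open>B\<close> and both
  flows. Eliminating \<open>pderivX f\<close> from the flows leaves
  \<open>polyX ^ (n - k) - polyY ^ (n - k)\<close> divisible by \<open>f\<close>, which meets
  \<open>Y = 0\<close> only at \<open>X = 0\<close>, against \<open>nz\<close>.\<close>

lemma not_dvd_A_if_less: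
  assumes "k < n"
  shows "\<not> f dvd A"
proof
  assume fA: "f dvd A"
  then have fB: "f dvd B"
    using dvd_A_iff by blast
  have "f dvd of_nat n * a1" "f dvd of_nat k * b1"
    using dvd_delta[OF fA] dvd_delta[OF fB] by (simp_all add: delta_fermat_poly)
  then have "f dvd a1" "f dvd b1"
    using dvd_multD not_dvd_of_nat kn by blast+
  then have "f dvd polyY ^ (k - 1) * a1 - polyY ^ (n - 1) * b1"
    by (intro dvd_diff dvd_mult)
  also have "\<dots> = x1 * (polyX ^ (k - 1) * polyY ^ (k - 1) * (polyX ^ (n - k) - polyY ^ (n - k)))"
  proof -
    have pow: "(g :: 'a poly poly) ^ (n - 1) = g ^ (k - 1) * g ^ (n - k)" for g
      using assms kn by (simp add: power_add[symmetric])
    show ?thesis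
      unfolding flow_def pow by (simp add: algebra_simps)
  qed
  finally have "f dvd polyX ^ (n - k) - polyY ^ (n - k)"
    using dvd_multD dvd_powerD not_dvd_pderiv not_dvd_polyX not_dvd_polyY by metis
  then obtain h where h: "polyX ^ (n - k) - polyY ^ (n - k) = f * h" ..
  have X: "polyX ^ m = [:monom (1 :: 'a) m:]" for m
    by (induction m) (simp_all add: polyX_def one_pCons monom_Suc)
  have Y: "polyY ^ m = monom (1 :: 'a poly) m" for m
    by (induction m) (simp_all add: polyY_def monom_Suc)
  have "coeff (polyX ^ (n - k) - polyY ^ (n - k) :: 'a poly poly) 0 = monom 1 (n - k)"
    using assms by (simp add: X Y)
  then have "coeff f 0 dvd monom 1 (n - k)"
    unfolding h coeff_mult_0 by (metis dvd_triv_left)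
  then show False
    using nzroots_dvd_monom nz by force
qed

text \<open>Follows the proof of Mason's theorem. The flow \<open>a1\<close> and its derivative are
  linear in \<open>polyX ^ m\<close> and \<open>polyY ^ m\<close>; \<open>first_relation\<close> and
  its derivative express them through \<open>A\<close>, \<open>B\<close> and low degree terms. The
  quotient of the two solutions is free of \<open>A\<close> and gives a congruence for
  \<open>chain_bound\<close> with degrees governed by \<open>k\<close> instead of
  \<open>n\<close>.\<close>

lemma max_exponent_bound:
  assumes kn2: "k < n" "2 \<le> n" and ne: "reg_points f \<noteq> {}"
    and small: "degX f * (n + degY f) + degY f * (n + degX f) < CARD('a)"
  shows "(n - 2) * nzroots (coeff f 0)
      \<le> degX f * (2 * k + 1 + 3 * degY f) + degY f * (2 * k + 1 + 3 * degX f)"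
proof -
  define m where "m = n - 2"
  have n: "n = Suc (Suc m)"
    using kn2 by (simp add: m_def)
  define x2 y2 where "x2 = delta f x1" and "y2 = delta f y1"
  define a2 b2 where "a2 = delta f a1" and "b2 = delta f b1"
  define S T where "S = polyX * x2 + of_nat (Suc m) * x1 ^ 2" and "T = polyY * y2 + of_nat (Suc m) * y1 ^ 2"
  define G where "G = polyY * y1 * S - polyX * x1 * T"
  define c where "c = of_nat n - (of_nat k :: 'a poly poly)"
  define M where "M = B * b2 + c * b1 ^ 2"
  define Q1 Q2 where "Q1 = B * b1 * T - M * (polyY * y1)" and "Q2 = B * b1 * S - M * (polyX * x1)"
  have a1: "a1 = polyX ^ Suc m * x1 + polyY ^ Suc m * y1"
    by (simp add: flow_def n)
  have a2: "a2 = polyX ^ m * (polyX * x2 + of_nat (Suc m) * x1 ^ 2)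
      + polyY ^ m * (polyY * y2 + of_nat (Suc m) * y1 ^ 2)"
    unfolding a2_def a1 delta_add delta_mult delta_power delta_polyX delta_polyY x2_def y2_def
    by (simp add: algebra_simps power2_eq_square)
  \<comment> \<open>Cramer's rule for the linear system in \<open>polyX ^ m\<close> and
    \<open>polyY ^ m\<close>, with determinant \<open>G\<close> up to sign.\<close>
  have G1: "a1 * S - a2 * (polyX * x1) = polyY ^ m * G"
    unfolding a1 a2 S_def T_def G_def by (simp add: algebra_simps)
  have G2: "a1 * T - a2 * (polyY * y1) = - (polyX ^ m * G)"
    unfolding a1 a2 S_def T_def G_def by (simp add: algebra_simps)
  define R where "R = B * a1 - A * b1"
  have R: "f dvd R" "f dvd delta f R"
    using first_relation dvd_delta by (simp_all add: R_def)
  have \<delta>R: "delta f R = of_nat k * b1 * a1 + B * a2 - of_nat n * a1 * b1 - A * b2"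
    by (simp add: R_def delta_diff delta_mult delta_fermat_poly a2_def b2_def algebra_simps)
  have Ra: "B ^ 2 * a1 - A * (B * b1) = B * R"
    by (simp add: R_def algebra_simps power2_eq_square)
  have Rb: "B ^ 2 * a2 - A * M = B * delta f R + c * b1 * R"
    unfolding \<delta>R by (simp add: R_def M_def c_def algebra_simps power2_eq_square)
  \<comment> \<open>Modulo \<open>f\<close>, \<open>a1\<close> and \<open>a2\<close> are
    \<open>A * b1 / B\<close> and \<open>A * M / B ^ 2\<close>, written without
    denominators.\<close>
  have Ra': "f dvd B ^ 2 * a1 - A * (B * b1)" and Rb': "f dvd B ^ 2 * a2 - A * M"
    unfolding Ra Rb using R by (auto intro!: dvd_add dvd_mult)
  have E2: "f dvd B ^ 2 * polyY ^ m * G - A * Q2"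
  proof -
    have "f dvd (B ^ 2 * a1 - A * (B * b1)) * S - (B ^ 2 * a2 - A * M) * (polyX * x1)"
      by (rule dvd_diff[OF dvd_mult2[OF Ra'] dvd_mult2[OF Rb']])
    also have "\<dots> = B ^ 2 * (a1 * S - a2 * (polyX * x1)) - A * Q2"
      by (simp add: Q2_def algebra_simps)
    finally show ?thesis
      unfolding G1 by (simp add: mult.assoc)
  qed
  have E1: "f dvd - (B ^ 2 * polyX ^ m * G) - A * Q1"
  proof -
    have "f dvd (B ^ 2 * a1 - A * (B * b1)) * T - (B ^ 2 * a2 - A * M) * (polyY * y1)"
      by (rule dvd_diff[OF dvd_mult2[OF Ra'] dvd_mult2[OF Rb']])
    also have "\<dots> = B ^ 2 * (a1 * T - a2 * (polyY * y1)) - A * Q1"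
      by (simp add: Q1_def algebra_simps)
    finally show ?thesis
      unfolding G2 by (simp add: mult.assoc)
  qed
  have fA: "\<not> f dvd A"
    by (rule not_dvd_A_if_less[OF kn2(1)])
  have fB: "\<not> f dvd B"
    using fA dvd_A_iff by blast
  \<comment> \<open>Crosswise multiplication of \<open>E1\<close> and \<open>E2\<close> eliminates
    \<open>G\<close>.\<close>
  have "f dvd A * (polyY ^ m * Q1 - polyX ^ m * (- Q2))"
  proof -
    have "f dvd polyX ^ m * (B ^ 2 * polyY ^ m * G - A * Q2) + polyY ^ m * (- (B ^ 2 * polyX ^ m * G) - A * Q1)"
      using E1 E2 by (intro dvd_add dvd_mult)
    also have "\<dots> = - (A * (polyY ^ m * Q1 - polyX ^ m * (- Q2)))"
      by (simp add: algebra_simps)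
    finally show ?thesis
      by simp
  qed
  then have dvd_Q: "f dvd polyY ^ m * Q1 - polyX ^ m * (- Q2)"
    using fA dvd_multD by blast
  have x1: "bideg_le x1 (degX f) (degY f)" and y1: "bideg_le y1 (degX f) (degY f)"
    by (auto intro: bideg_le_pderiv bideg_le_uminus bideg_le_pderivX)
  have B: "bideg_le B k k" and b1: "bideg_le b1 (k + degX f) (k + degY f)"
    by (rule bideg_le_fermat_poly bideg_le_flow)+
  have x2: "bideg_le x2 (degX f + degX f) (degY f + degY f)"
    and b2: "bideg_le b2 (degX f + (k + degX f)) (degY f + (k + degY f))"
    unfolding x2_def b2_def by (intro bideg_le_delta x1 b1)+
  have c: "bideg_le c 0 0"
    unfolding c_def of_nat_eq_const2[of n] of_nat_eq_const2[of k] by (intro bideg_le_diff bideg_le_const2)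
  have Xx1: "bideg_le (polyX * x1) (1 + degX f) (0 + degY f)"
    by (intro bideg_le_mult bideg_le_polyX x1)
  have S: "bideg_le S (1 + 2 * degX f) (1 + 2 * degY f)"
  proof -
    have "bideg_le (polyX * x2) (1 + (degX f + degX f)) (0 + (degY f + degY f))"
      by (intro bideg_le_mult bideg_le_polyX x2)
    moreover have "bideg_le (of_nat (Suc m) * x1 ^ 2) (degX f * 2) (degY f * 2)"
      by (intro bideg_le_of_nat_mult bideg_le_power x1)
    ultimately show ?thesis
      unfolding S_def by (intro bideg_le_add) (auto elim!: bideg_le_mono)
  qed
  have M: "bideg_le M (2 * k + 2 * degX f) (2 * k + 2 * degY f)"
  proof -
    have "bideg_le (B * b2) (k + (degX f + (k + degX f))) (k + (degY f + (k + degY f)))"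
      by (intro bideg_le_mult B b2)
    moreover have "bideg_le (c * b1 ^ 2) (0 + (k + degX f) * 2) (0 + (k + degY f) * 2)"
      by (intro bideg_le_mult c bideg_le_power b1)
    ultimately show ?thesis
      unfolding M_def by (intro bideg_le_add) (auto elim!: bideg_le_mono)
  qed
  have Q2: "bideg_le (- Q2) (2 * k + 1 + 3 * degX f) (2 * k + 1 + 3 * degY f)"
  proof -
    have "bideg_le (B * b1 * S) (k + (k + degX f) + (1 + 2 * degX f)) (k + (k + degY f) + (1 + 2 * degY f))"
      by (intro bideg_le_mult B b1 S)
    moreover have "bideg_le (M * (polyX * x1)) (2 * k + 2 * degX f + (1 + degX f)) (2 * k + 2 * degY f + (0 + degY f))"
      by (intro bideg_le_mult[OF M] Xx1)
    ultimately show ?thesis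
      unfolding Q2_def by (intro bideg_le_uminus bideg_le_diff) (auto elim!: bideg_le_mono)
  qed
  show ?thesis
  proof (cases "f dvd Q2")
    case False
    then have "m * nzroots (coeff f 0) \<le> degX f * degY (- Q2) + degY f * degX (- Q2)"
      by (intro chain_bound[OF f f0 dvd_Q]) simp
    also have "\<dots> \<le> degX f * (2 * k + 1 + 3 * degY f) + degY f * (2 * k + 1 + 3 * degX f)"
      using Q2 unfolding bideg_le_def by (intro add_mono mult_mono) auto
    finally show ?thesis
      by (simp add: m_def)
  next
    case True
    then have "f dvd B ^ 2 * polyY ^ m * G"
      using E2 dvd_diff_left_iff[of f "A * Q2"] by simp
    then have "f dvd G"
      using dvd_multD dvd_powerD fB not_dvd_polyY by metis
    \<comment> \<open>Degenerate case: up to monomials, \<open>G\<close> is the Wronskian of the two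
      terms of \<open>a1\<close>, so these are proportional modulo \<open>f\<close>. That
      proportionality is itself a congruence for \<open>chain_bound\<close>, with
      \<open>K = x1\<close>.\<close>
    define U V where "U = polyX ^ Suc m * x1" and "V = polyY ^ Suc m * y1"
    have "delta f U * V - U * delta f V = polyX ^ m * polyY ^ m * G"
      unfolding U_def V_def G_def S_def T_def delta_mult delta_power delta_polyX delta_polyY x2_def y2_def
      by (simp add: algebra_simps power2_eq_square)
    then have W: "f dvd delta f U * V - U * delta f V"
      using \<open>f dvd G\<close> by simp
    have "\<not> f dvd pderivX f"
    proof
      assume *: "f dvd pderivX f"
      have "of_nat (degX f) \<noteq> (0 :: 'a)"
        using deg by (intro of_nat_neq_0_CARD p) auto
      moreover have "swapXY f \<noteq> 0"
        using f by (simp add: prime_elem_not_zeroI)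
      ultimately have "coeff (pderiv (swapXY f)) (degX f - 1) \<noteq> 0"
        using deg by (auto simp: coeff_pderiv of_nat_poly degX_def simp del: of_nat_Suc)
      then have "pderivX f \<noteq> 0"
        by (auto simp: pderivX_def)
      then have "degX f \<le> degX (pderivX f)"
        using * by (rule dvd_imp_degX_le[rotated])
      then show False
        using degX_pderivX_le[of f] deg by simp
    qed
    then have V: "\<not> f dvd V"
      unfolding V_def using dvd_multD dvd_powerD not_dvd_polyY by (metis dvd_minus_iff)
    have U: "\<not> f dvd U"
      unfolding U_def using dvd_multD dvd_powerD not_dvd_polyX not_dvd_pderiv by metis
    have "bideg_le U (n + degX f) (n + degY f)"
    proof -
      have "bideg_le U (1 * Suc m + degX f) (0 * Suc m + degY f)"
        unfolding U_def by (intro bideg_le_mult bideg_le_power bideg_le_polyX x1)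
      then show ?thesis
        by (rule bideg_le_mono) (auto simp: n)
    qed
    moreover have "bideg_le V (n + degX f) (n + degY f)"
    proof -
      have "bideg_le V (0 * Suc m + degX f) (1 * Suc m + degY f)"
        unfolding V_def by (intro bideg_le_mult bideg_le_power bideg_le_polyY y1)
      then show ?thesis
        by (rule bideg_le_mono) (auto simp: n)
    qed
    ultimately obtain d where "f dvd U - const2 d * V"
      using proportional_if_wronskian_zero[OF p f ne U V W _ _ small] by blast
    then have "f dvd polyY ^ Suc m * (const2 d * y1) - polyX ^ Suc m * x1"
      unfolding U_def V_def by (subst dvd_minus_iff[symmetric]) (simp add: algebra_simps)
    then have "Suc m * nzroots (coeff f 0) \<le> degX f * degY x1 + degY f * degX x1"
      by (intro chain_bound[OF f f0 _ not_dvd_pderiv])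
    also have "\<dots> \<le> degX f * (2 * k + 1 + 3 * degY f) + degY f * (2 * k + 1 + 3 * degX f)"
      using x1 unfolding bideg_le_def by (intro add_mono mult_mono) auto
    finally have "Suc m * nzroots (coeff f 0)
      \<le> degX f * (2 * k + 1 + 3 * degY f) + degY f * (2 * k + 1 + 3 * degX f)" .
    then show ?thesis
      unfolding m_def[symmetric] by (simp add: order_trans[rotated])
  qed
qed

text \<open>For \<open>32 * k \<le> n\<close> use \<open>max_exponent_bound\<close>; otherwise
  \<open>min k n\<close> is at least \<open>n / 32\<close> and \<open>min_exponent_bound\<close> is
  strong enough. With at least \<open>degX f / 2\<close> nonzero roots, either bound would force
  \<open>n\<close> below \<open>1000 * (degX f + 1)\<close>.\<close>

lemma few_nonzero_roots:
  assumes ne: "reg_points f \<noteq> {}" and le: "degY f \<le> degX f"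
    and big: "1000 * (degX f + 1) \<le> n"
    and small: "2 * degX f * (n + degX f) < CARD('a)"
  shows "2 * nzroots (coeff f 0) < degX f"
proof (rule ccontr)
  define D where "D = degX f"
  define \<gamma> where "\<gamma> = nzroots (coeff f 0)"
  assume "\<not> 2 * nzroots (coeff f 0) < degX f"
  then have \<gamma>: "D \<le> 2 * \<gamma>"
    by (simp add: D_def \<gamma>_def)
  have D: "0 < D" "degY f \<le> D"
    using deg le by (simp_all add: D_def)
  show False
  proof (cases "k < n \<and> 32 * k \<le> n")
    case True
    have "degX f * (n + degY f) + degY f * (n + degX f) \<le> D * (n + D) + D * (n + D)"
      using D by (intro add_mono mult_mono) (auto simp: D_def)
    also have "\<dots> < CARD('a)"
      using small by (simp add: D_def)
    finally have "(n - 2) * \<gamma> \<le> degX f * (2 * k + 1 + 3 * degY f) + degY f * (2 * k + 1 + 3 * degX f)"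
      unfolding \<gamma>_def using True big by (intro max_exponent_bound ne) auto
    also have "\<dots> \<le> D * (2 * k + 1 + 3 * D) + D * (2 * k + 1 + 3 * D)"
      using D by (intro add_mono mult_mono) (auto simp: D_def)
    finally have "(n - 2) * (2 * \<gamma>) \<le> D * (8 * k + 4 + 12 * D)"
      by (simp add: algebra_simps)
    moreover have "(n - 2) * D \<le> (n - 2) * (2 * \<gamma>)"
      using \<gamma> by (rule mult_left_mono) simp
    ultimately have "D * (n - 2) \<le> D * (8 * k + 4 + 12 * D)"
      by (simp only: mult.commute[of D])
    then have "n - 2 \<le> 8 * k + 4 + 12 * D"
      using D(1) by simp
    then have "n \<le> 8 * k + 6 + 12 * D"
      by simp
    moreover have "1000 * D + 1000 \<le> n"
      using big by (simp add: D_def)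
    moreover have "32 * k \<le> n"
      using True by simp
    ultimately show False
      by linarith
  next
    case False
    define \<mu> where "\<mu> = min k n"
    have \<mu>: "n \<le> 32 * \<mu>"
      using False kn by (auto simp: \<mu>_def)
    have "(\<mu> - 2) * \<gamma> \<le> 6 * (degX f * degY f)"
      unfolding \<gamma>_def using \<mu> big by (intro min_exponent_bound \<mu>_def) auto
    also have "\<dots> \<le> 6 * (D * D)"
      using D by (intro mult_mono) (auto simp: D_def)
    finally have "(\<mu> - 2) * (2 * \<gamma>) \<le> D * (12 * D)"
      by (simp add: mult.commute)
    moreover have "(\<mu> - 2) * D \<le> (\<mu> - 2) * (2 * \<gamma>)"
      using \<gamma> by (rule mult_left_mono) simp
    ultimately have "D * (\<mu> - 2) \<le> D * (12 * D)"
      by (simp only: mult.commute[of D])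
    then have "\<mu> \<le> 12 * D + 2"
      using D(1) by simp
    moreover have "1000 * D + 1000 \<le> n"
      using big by (simp add: D_def)
    ultimately show False
      using \<mu> by linarith
  qed
qed

end

section \<open>Counting the zeros\<close>

lemma coeff_binomial_power:
  assumes "0 < k"
  shows "coeff ((monom 1 k + [:b:]) ^ m) i =
    (if k dvd i \<and> i div k \<le> m then of_nat (m choose (i div k)) * (b :: 'a::comm_ring_1) ^ (m - i div k) else 0)"
proof -
  have "(monom 1 k + [:b:]) ^ m = (\<Sum>j\<le>m. monom (of_nat (m choose j) * b ^ (m - j)) (k * j))"
    unfolding binomial_ring
    by (intro sum.cong refl) (simp add: Polynomial.monom_power of_nat_poly poly_const_pow
        smult_monom mult.commute)
  then have "coeff ((monom 1 k + [:b:]) ^ m) i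
      = (\<Sum>j\<le>m. if j = i div k \<and> k dvd i then of_nat (m choose j) * b ^ (m - j) else 0)"
    using assms by (auto simp: coeff_sum intro!: sum.cong)
  also have "\<dots> = (if k dvd i \<and> i div k \<le> m then of_nat (m choose (i div k)) * b ^ (m - i div k) else 0)"
    by (cases "k dvd i") auto
  finally show ?thesis .
qed

text \<open>The power with inner exponent \<open>n\<close> has only exponents divisible by
  \<open>n\<close>; since \<open>k < n\<close>, neither \<open>k\<close> nor
  \<open>\<kappa> * n - k\<close> is one, so both coefficients come from the other power.\<close>

lemma fermat_slice_coeffs:
  fixes a b :: "'a::idom"
  assumes eq: "\<kappa> * n = \<nu> * k" and kn: "0 < k" "k < n" and pos: "0 < \<nu>"
    and q: "q = (monom 1 n + [:a:]) ^ \<kappa> - (monom 1 k + [:b:]) ^ \<nu>"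
  shows "coeff q (\<nu> * k - k) = - (of_nat \<nu> * b)" and "coeff q k = - (of_nat \<nu> * b ^ (\<nu> - 1))"
proof -
  have "0 < \<kappa>"
    using eq kn pos by (cases \<kappa>) auto
  have ndvd: "\<not> n dvd k"
    using kn by (auto dest: dvd_imp_le)
  moreover have "\<nu> * k - k + k = \<kappa> * n"
    using pos eq by (cases \<nu>) auto
  ultimately have "\<not> n dvd \<nu> * k - k"
    by (metis dvd_add_right_iff dvd_triv_right)
  moreover have "\<nu> * k - k = (\<nu> - 1) * k"
    by (simp add: diff_mult_distrib)
  then have "(\<nu> * k - k) div k = \<nu> - 1" "k dvd \<nu> * k - k"
    using kn by simp_all
  moreover have "\<nu> choose (\<nu> - 1) = \<nu>"
    using pos by (cases \<nu>) auto
  ultimately show "coeff q (\<nu> * k - k) = - (of_nat \<nu> * b)"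
    using kn pos by (simp add: q coeff_binomial_power)
  show "coeff q k = - (of_nat \<nu> * b ^ (\<nu> - 1))"
    using kn pos ndvd by (simp add: q coeff_binomial_power)
qed

lemma order_0_le:
  assumes "coeff q i \<noteq> (0 :: 'a::idom)"
  shows "order 0 q \<le> i"
proof (rule ccontr)
  assume "\<not> order 0 q \<le> i"
  moreover have "[:-0, 1:] ^ order 0 q dvd q"
    by (rule order_1)
  then obtain r where "q = monom 1 (order 0 q) * r"
    by (auto simp: dvd_def monom_altdef)
  then have "coeff q i = (if i < order 0 q then 0 else coeff r (i - order 0 q))"
    by (metis coeff_monom_mult mult_1 not_le)
  ultimately show False
    using assms by simp
qed

lemma val2_simps [simp]:
  "val2 (f + g) x y = val2 f x y + val2 g x y"
  "val2 (f - g) x y = val2 f x y - val2 g x y"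
  "val2 (f * g) x y = val2 f x y * val2 g x y"
  "val2 (f ^ m) x y = val2 f x y ^ m"
  "val2 1 x y = 1" "val2 polyX x y = x" "val2 polyY x y = y"
  by (simp_all add: val2_def poly_power polyX_def polyY_def)

lemma val2_dvd: "f dvd g \<Longrightarrow> val2 f x y = 0 \<Longrightarrow> val2 g x y = 0"
  by (auto simp: dvd_def)

lemma val2_prod_mset_eq_0: "val2 (prod_mset M) x y = (0 :: 'a::idom) \<Longrightarrow> \<exists>f\<in>#M. val2 f x y = 0"
  by (induction M) auto

lemma degree_poly_const_le: "degree (poly g [:x:]) \<le> degX g"
  unfolding poly_altdef
proof (rule degree_sum_le)
  fix i
  have "coeff g i * [:x:] ^ i = smult (x ^ i) (coeff g i)"
    by (simp add: poly_const_pow mult.commute)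
  then have "degree (coeff g i * [:x:] ^ i) \<le> degree (coeff g i)"
    by (simp add: degree_smult_le)
  then show "degree (coeff g i * [:x:] ^ i) \<le> degX g"
    using degree_coeff_le_degX order_trans by blast
qed simp

text \<open>Additivity is assumed on factors of \<open>F\<close> only, because \<open>defect\<close>
  is additive only while \<open>Y\<close> does not divide the product.\<close>

lemma sum_le_if_additive:
  fixes \<phi> :: "'a::comm_semiring_1 \<Rightarrow> nat"
  assumes add: "\<And>g h. g * h dvd F \<Longrightarrow> \<phi> (g * h) = \<phi> g + \<phi> h"
    and S: "finite S" "(\<Prod>f\<in>S. f) dvd F"
  shows "sum \<phi> S \<le> \<phi> F"
proof -
  have "\<phi> 1 = 0"
    using add[of 1 1] by simp
  have "sum \<phi> T = \<phi> (\<Prod>f\<in>T. f)" if "T \<subseteq> S" for T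
    using finite_subset[OF that S(1)] that
  proof (induction T rule: finite_induct)
    case (insert f T)
    then have "(\<Prod>f\<in>insert f T. f) dvd F"
      using S by (meson dvd_trans prod_dvd_prod_subset)
    then have "\<phi> (f * (\<Prod>f\<in>T. f)) = \<phi> f + \<phi> (\<Prod>f\<in>T. f)"
      using insert by (intro add) simp
    then show ?case
      using insert by simp
  qed (simp add: \<open>\<phi> 1 = 0\<close>)
  then have "sum \<phi> S = \<phi> (\<Prod>f\<in>S. f)"
    by blast
  moreover obtain h where h: "F = (\<Prod>f\<in>S. f) * h"
    using S(2) ..
  ultimately show ?thesis
    using add[of "\<Prod>f\<in>S. f" h] by simp
qed

text \<open>The part of the intersection with the line \<open>Y = 0\<close> that lies at \<open>X = 0\<close> or at infinity.\<close>

definition defect :: "'a::idom poly poly \<Rightarrow> nat" where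
  "defect g = degX g - nzroots (coeff g 0)"

lemma nzroots_le_degX: "nzroots (coeff g 0) \<le> degX g"
  unfolding nzroots_def using degree_coeff_le_degX[of g 0] by linarith

lemma defect_mult:
  assumes "coeff (g * h) 0 \<noteq> 0"
  shows "defect (g * h) = defect g + defect h"
proof -
  have "coeff g 0 \<noteq> 0" "coeff h 0 \<noteq> 0" "g \<noteq> 0" "h \<noteq> 0"
    using assms by (auto simp: coeff_mult_0)
  then show ?thesis
    using nzroots_le_degX[of g] nzroots_le_degX[of h]
    by (simp add: defect_def coeff_mult_0 nzroots_mult degX_mult)
qed

section \<open>The whole curve and its factors\<close>

lemma swapXY_fermat_poly [simp]: "swapXY (fermat_poly n) = fermat_poly n"
  by (simp add: fermat_poly_def swapXY_add swapXY_diff swapXY_power add.commute)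

lemma poly_fermat_poly: "poly (fermat_poly n) [:x:] = monom 1 n + [:x ^ n - 1:]"
proof -
  have "poly (polyX ^ n) [:x:] = (monom 1 n :: 'a poly)" for x :: 'a
    by (simp add: polyX_def poly_power monom_altdef)
  then show ?thesis
    by (simp add: fermat_poly_def polyY_def poly_power poly_const_pow one_pCons)
qed

text \<open>With \<open>\<kappa> = k / r\<close> and \<open>\<nu> = n / r\<close>, the common value
  \<open>d\<close> of \<open>\<kappa> * n\<close> and \<open>\<nu> * k\<close> is
  \<open>k * n / r\<close>.\<close>

locale fermat_curve =
  fixes k n \<kappa> \<nu> :: nat and F :: "'a::{finite_field,field_gcd} poly poly"
  assumes p: "prime CARD('a)"
    and F: "F = fermat_poly n ^ \<kappa> - fermat_poly k ^ \<nu>"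
    and \<kappa>\<nu>: "\<kappa> * n = \<nu> * k" "0 < \<kappa>" "0 < \<nu>" "\<kappa> < CARD('a)" "\<nu> < CARD('a)"
    and kn: "0 < k" "k < CARD('a)" "0 < n" "n < CARD('a)" "k \<noteq> n"
begin

abbreviation "\<mu> \<equiv> min k n"
abbreviation "d \<equiv> \<kappa> * n"

definition slice :: "'a \<Rightarrow> 'a poly" where
  "slice x = (monom 1 n + [:x ^ n - 1:]) ^ \<kappa> - (monom 1 k + [:x ^ k - 1:]) ^ \<nu>"

lemma poly_F: "poly F [:x:] = slice x"
  by (simp add: F slice_def poly_power poly_fermat_poly)

lemma swapXY_F [simp]: "swapXY F = F"
  by (simp add: F swapXY_diff swapXY_power)

lemma val2_F: "val2 F x y = (x ^ n + y ^ n - 1) ^ \<kappa> - (x ^ k + y ^ k - 1) ^ \<nu>"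
  by (simp add: F fermat_poly_def)

text \<open>The power with the smaller inner exponent has a second highest and a lowest positive
  term that the other power cannot cancel. They show that the line \<open>Y = x\<close> lies on the
  curve only if \<open>x ^ \<mu> = 1\<close>, and at \<open>x = 0\<close> they limit the drop of
  degree and the multiplicity at \<open>X = 0\<close>.\<close>

lemma slice_coeffs:
  "\<exists>c e. c \<noteq> 0 \<and> 0 < e \<and> coeff (slice x) (d - \<mu>) = c * (x ^ \<mu> - 1) \<and> coeff (slice x) \<mu> = c * (x ^ \<mu> - 1) ^ (e - 1)"
proof (cases "k < n")
  case True
  have "- of_nat \<nu> \<noteq> (0 :: 'a)"
    using of_nat_neq_0_CARD[OF p, of \<nu>] \<kappa>\<nu> by simp
  then show ?thesis
    using fermat_slice_coeffs[OF \<kappa>\<nu>(1) kn(1) True \<kappa>\<nu>(3) slice_def] True \<kappa>\<nu>(1,3)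
    by (intro exI[of _ "- of_nat \<nu>"] exI[of _ \<nu>]) (simp add: min_def)
next
  case False
  then have less: "n < k"
    using kn by simp
  have nz: "of_nat \<kappa> \<noteq> (0 :: 'a)"
    using of_nat_neq_0_CARD[OF p, of \<kappa>] \<kappa>\<nu> by simp
  have "- slice x = (monom 1 k + [:x ^ k - 1:]) ^ \<nu> - (monom 1 n + [:x ^ n - 1:]) ^ \<kappa>"
    by (simp add: slice_def)
  from fermat_slice_coeffs[OF \<kappa>\<nu>(1)[symmetric] kn(3) less \<kappa>\<nu>(2) this]
  have "coeff (slice x) (\<kappa> * n - n) = of_nat \<kappa> * (x ^ n - 1)"
    "coeff (slice x) n = of_nat \<kappa> * (x ^ n - 1) ^ (\<kappa> - 1)"
    by (simp_all add: neg_equal_iff_equal)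
  then show ?thesis
    using nz less \<kappa>\<nu>(2) by (intro exI[of _ "of_nat \<kappa>"] exI[of _ \<kappa>]) (simp add: min_def)
qed

lemma slice_eq_0: "slice x = 0 \<Longrightarrow> x ^ \<mu> = 1"
  using slice_coeffs[of x] by auto

lemma coeff_F_0: "coeff F 0 = slice 0"
  using poly_F[of 0] by (simp add: poly_0_coeff_0)

lemma coeff_F_0_neq_0: "coeff F 0 \<noteq> 0"
proof
  assume "coeff F 0 = 0"
  then have "0 ^ \<mu> = (1 :: 'a)"
    using slice_eq_0[of 0] coeff_F_0 by simp
  then show False
    using kn by (simp add: power_0_left split: if_splits)
qed

lemma F_neq_0: "F \<noteq> 0"
  using coeff_F_0_neq_0 by auto

lemma degX_F: "degX F \<le> d" and degY_F: "degY F \<le> d"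
proof -
  have "bideg_le F d d"
    using bideg_le_power[OF bideg_le_fermat_poly, of n \<kappa>] bideg_le_power[OF bideg_le_fermat_poly, of k \<nu>] \<kappa>\<nu>(1)
    unfolding F by (intro bideg_le_diff) (simp_all add: mult.commute)
  then show "degX F \<le> d" "degY F \<le> d"
    by (auto simp: bideg_le_def)
qed

text \<open>At most \<open>\<mu>\<close> is lost at infinity and at most \<open>\<mu>\<close> at
  \<open>X = 0\<close>.\<close>

lemma defect_F: "defect F \<le> 2 * \<mu>"
proof -
  have "0 ^ \<mu> - 1 \<noteq> (0 :: 'a)"
    using kn by (simp add: power_0_left)
  then have nz: "coeff (slice 0) (d - \<mu>) \<noteq> 0" "coeff (slice 0) \<mu> \<noteq> 0"
    using slice_coeffs[of 0] by auto
  have "d - \<mu> \<le> degree (coeff F 0)" "order 0 (coeff F 0) \<le> \<mu>"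
    unfolding coeff_F_0 by (rule le_degree[OF nz(1)], rule order_0_le[OF nz(2)])
  then show ?thesis
    unfolding defect_def nzroots_def using degX_F by linarith
qed

definition zeros :: "'a poly poly \<Rightarrow> ('a \<times> 'a) set" where
  "zeros g = {(x, y). val2 g x y = 0}"

text \<open>Factors in one variable only are left out; their zeros lie on the axis-parallel lines
  counted in \<open>zeros_subset\<close>.\<close>

definition components :: "'a poly poly set" where
  "components = {f \<in> prime_factors F. 0 < degX f \<and> 0 < degY f}"

lemma finite_components: "finite components"
  by (simp add: components_def)

lemma component_prime: "f \<in> components \<Longrightarrow> prime_elem f"
  by (auto simp: components_def in_prime_factors_iff prime_def)

lemma component_dvd: "f \<in> components \<Longrightarrow> f dvd F"
  by (auto simp: components_def)

lemma component_degrees: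
  assumes "f \<in> components"
  shows "0 < degX f" "0 < degY f" "degX f \<le> d" "degY f \<le> d"
  using assms dvd_imp_degX_le[OF component_dvd F_neq_0] dvd_imp_degree_le[OF component_dvd F_neq_0]
    degX_F degY_F by (auto simp: components_def intro: order_trans)

lemma prod_components_dvd: "(\<Prod>f\<in>components. f) dvd F"
proof -
  have "(\<Prod>f\<in>components. f) dvd (\<Prod>f\<in>prime_factors F. f)"
    by (intro prod_dvd_prod_subset) (auto simp: components_def)
  also have "(\<Prod>f\<in>prime_factors F. f) = prod_mset (mset_set (prime_factors F))"
    by (simp add: prod_unfold_prod_mset)
  also have "\<dots> dvd prod_mset (prime_factorization F)"
    by (intro prod_mset_subset_imp_dvd mset_set_set_mset_msubset)
  also have "\<dots> dvd F"
    using prod_mset_prime_factorization_weak[OF F_neq_0] by (metis associated_iff_dvd)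
  finally show ?thesis .
qed

lemma sum_components:
  "(\<Sum>f\<in>components. degX f) \<le> d" "(\<Sum>f\<in>components. degY f) \<le> d"
  "(\<Sum>f\<in>components. defect f) \<le> 2 * \<mu>" "(\<Sum>f\<in>components. defect (swapXY f)) \<le> 2 * \<mu>"
proof -
  have nz: "g \<noteq> 0 \<and> h \<noteq> 0 \<and> coeff (g * h) 0 \<noteq> 0" if "g * h dvd F" for g h
    using that F_neq_0 coeff_F_0_neq_0 by (auto simp: dvd_def coeff_mult_0)
  have "sum degX components \<le> degX F"
    by (rule sum_le_if_additive[OF _ finite_components prod_components_dvd]) (use nz degX_mult in blast)
  then show "sum degX components \<le> d"
    using degX_F by simp
  have "sum degree components \<le> degree F"
    by (rule sum_le_if_additive[OF _ finite_components prod_components_dvd]) (use nz degree_mult_eq in blast)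
  then show "sum degree components \<le> d"
    using degY_F by simp
  have "sum defect components \<le> defect F"
    by (rule sum_le_if_additive[OF _ finite_components prod_components_dvd]) (use nz defect_mult in blast)
  then show "sum defect components \<le> 2 * \<mu>"
    using defect_F by simp
  have "sum (\<lambda>f. defect (swapXY f)) components \<le> defect (swapXY F)"
  proof (rule sum_le_if_additive[OF _ finite_components prod_components_dvd])
    fix g h assume "g * h dvd F"
    then have "swapXY g * swapXY h dvd F"
      using swapXY_dvd_iff[of "g * h" F] by (simp add: swapXY_mult)
    then show "defect (swapXY (g * h)) = defect (swapXY g) + defect (swapXY h)"
      unfolding swapXY_mult using nz by (intro defect_mult) blast
  qed
  then show "sum (\<lambda>f. defect (swapXY f)) components \<le> 2 * \<mu>"
    using defect_F by simp
qed

lemma zeros_subset: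
  "zeros F \<subseteq> {x. x ^ \<mu> = 1} \<times> UNIV \<union> UNIV \<times> {y. y ^ \<mu> = 1} \<union> (\<Union>f\<in>components. zeros f)"
proof
  fix z assume z: "z \<in> zeros F"
  obtain x y where xy: "z = (x, y)"
    by (cases z)
  have "F dvd prod_mset (prime_factorization F)"
    using prod_mset_prime_factorization_weak[OF F_neq_0] by (metis associated_iff_dvd)
  then have "val2 (prod_mset (prime_factorization F)) x y = 0"
    using z val2_dvd by (auto simp: xy zeros_def)
  then obtain f where f: "f \<in> prime_factors F" "val2 f x y = 0"
    using val2_prod_mset_eq_0 by blast
  \<comment> \<open>On \<open>Y = b\<close> a factor free of \<open>X\<close> is constant, so a
    single zero puts the whole line on the curve.\<close>
  have line: "b ^ \<mu> = 1" if "g dvd F" "degX g = 0" "val2 g a b = 0" for g a b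
  proof -
    have "degree (poly g [:b:]) = 0"
      using degree_poly_const_le[of g b] that by simp
    then obtain c where c: "poly g [:b:] = [:c:]"
      by (rule degree_eq_zeroE)
    then have "poly g [:b:] = 0"
      using that by (simp add: val2_def)
    then have "poly F [:b:] = 0"
      using that(1) by (auto simp: dvd_def)
    then show ?thesis
      using slice_eq_0 poly_F by simp
  qed
  show "z \<in> {x. x ^ \<mu> = 1} \<times> UNIV \<union> UNIV \<times> {y. y ^ \<mu> = 1} \<union> (\<Union>f\<in>components. zeros f)"
  proof (cases "f \<in> components")
    case True
    then show ?thesis
      using f by (auto simp: xy zeros_def)
  next
    case False
    then consider "degX f = 0" | "degY f = 0"
      using f(1) by (auto simp: components_def)
    then show ?thesis
    proof cases
      case 1
      then show ?thesis
        using line[of f x y] f by (auto simp: xy)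
    next
      case 2
      then show ?thesis
        using line[of "swapXY f" y x] f swapXY_dvd_iff[of f F] by (auto simp: xy val2_swapXY)
    qed
  qed
qed

lemma card_zeros_le: "card (zeros F) \<le> 2 * \<mu> * CARD('a) + (\<Sum>f\<in>components. card (zeros f))"
proof -
  have roots: "card {x :: 'a. x ^ \<mu> = 1} \<le> \<mu>"
  proof -
    have pos: "0 < \<mu>"
      using kn by simp
    define q where "q = monom 1 \<mu> - (1 :: 'a poly)"
    have "coeff q \<mu> = 1"
      using pos by (simp add: q_def)
    then have "q \<noteq> 0"
      by auto
    have "degree q \<le> \<mu>"
      unfolding q_def by (intro degree_diff_le degree_monom_le) simp
    moreover have "card {x. poly q x = 0} \<le> degree q"
      using \<open>q \<noteq> 0\<close> by (rule card_poly_roots_bound)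
    moreover have "{x. poly q x = 0} = {x. x ^ \<mu> = 1}"
      by (simp add: q_def poly_monom)
    ultimately show ?thesis
      by simp
  qed
  have "card (zeros F) \<le> card ({x :: 'a. x ^ \<mu> = 1} \<times> (UNIV :: 'a set) \<union> (UNIV :: 'a set) \<times> {y :: 'a. y ^ \<mu> = 1}
      \<union> (\<Union>f\<in>components. zeros f))"
    by (intro card_mono zeros_subset) simp
  also have "\<dots> \<le> card ({x :: 'a. x ^ \<mu> = 1} \<times> (UNIV :: 'a set)) + card ((UNIV :: 'a set) \<times> {y :: 'a. y ^ \<mu> = 1})
      + card (\<Union>f\<in>components. zeros f)"
    by (meson add_mono card_Un_le order_refl order_trans)
  also have "\<dots> \<le> \<mu> * CARD('a) + CARD('a) * \<mu> + (\<Sum>f\<in>components. card (zeros f))"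
    using roots card_UN_le[OF finite_components, of zeros]
    by (intro add_mono) (auto simp: card_cartesian_product)
  also have "\<mu> * CARD('a) + CARD('a) * \<mu> = 2 * \<mu> * CARD('a)"
    by (simp only: mult_2 distrib_right mult.commute[of "CARD('a)"])
  finally show ?thesis .
qed

lemma card_common_zeros:
  assumes "prime_elem f" "\<not> f dvd g" "\<And>x y. (x, y) \<in> Z \<Longrightarrow> val2 f x y = 0 \<and> val2 g x y = 0"
  shows "card Z \<le> degX f * degY g + degY f * degX (g :: 'a poly poly)"
proof -
  have "card Z * 1 \<le> degX f * degY g + degY f * degX g"
  proof (rule bezout_points[OF assms(1,2), of Z "\<lambda>P. fps_const (snd P)"])
    fix P assume "P \<in> Z"
    then have "val2 f (fst P) (snd P) = 0" "val2 g (fst P) (snd P) = 0"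
      using assms(3)[of "fst P" "snd P"] by simp_all
    then show "fps_X ^ 1 dvd ev (fst P) (fps_const (snd P)) f"
      and "fps_X ^ 1 dvd ev (fst P) (fps_const (snd P)) g"
      unfolding fps_X_power_dvd_iff by (simp_all add: ev_nth_0)
  qed simp
  then show ?thesis
    by simp
qed

text \<open>Intersect with \<open>polyX ^ CARD('a) - polyX\<close>, which vanishes at all rational
  points and is free of \<open>Y\<close>, hence not divisible by \<open>f\<close>.\<close>

lemma card_zeros_trivial:
  assumes f: "prime_elem f" "0 < degY f"
  shows "card (zeros f) \<le> degY f * CARD('a)"
proof -
  define g where "g = (polyX :: 'a poly poly) ^ CARD('a) - polyX"
  have X: "polyX ^ m = [:monom (1 :: 'a) m:]" for m
    by (induction m) (simp_all add: polyX_def one_pCons monom_Suc)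
  have g: "g = [:monom 1 CARD('a) - monom 1 1:]"
  proof -
    have X1: "polyX = [:monom (1 :: 'a) 1:]"
      using X[of 1] by (simp only: power_one_right)
    show ?thesis
      unfolding g_def X[of "CARD('a)"] unfolding X1 by simp
  qed
  have "coeff (coeff g 0) CARD('a) = 1"
    using prime_gt_1_nat[OF p] by (simp add: g)
  then have "g \<noteq> 0"
    by auto
  have degs: "degY g = 0" "degX g \<le> CARD('a)"
  proof -
    show "degY g = 0"
      by (simp add: g)
    have "degX (polyX ^ CARD('a) :: 'a poly poly) \<le> CARD('a)"
      using degX_power_le[of "polyX :: 'a poly poly" "CARD('a)"] by simp
    then show "degX g \<le> CARD('a)"
      unfolding g_def using prime_gt_1_nat[OF p] by (intro degX_diff_le) auto
  qed
  have "\<not> f dvd g"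
    using f \<open>g \<noteq> 0\<close> degs dvd_imp_degree_le[of f g] by auto
  then have "card (zeros f) \<le> degX f * degY g + degY f * degX g"
    by (intro card_common_zeros f(1))
       (auto simp: zeros_def g_def finite_field_power_card_eq_same)
  also have "\<dots> \<le> degY f * CARD('a)"
    using degs by simp
  finally show ?thesis .
qed

lemma card_zeros_swapXY: "card (zeros (swapXY f)) = card (zeros f)"
proof (rule bij_betw_same_card)
  show "bij_betw prod.swap (zeros (swapXY f)) (zeros f)"
    by (rule bij_betwI[of _ _ _ prod.swap]) (auto simp: zeros_def val2_swapXY)
qed

lemma card_zeros_trivial_bound: "card (zeros F) \<le> 3 * d * CARD('a)"
proof -
  have "(\<Sum>f\<in>components. card (zeros f)) \<le> (\<Sum>f\<in>components. degY f * CARD('a))"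
    using component_degrees(2) component_prime by (intro sum_mono card_zeros_trivial)
  also have "\<dots> = (\<Sum>f\<in>components. degY f) * CARD('a)"
    by (simp add: sum_distrib_right)
  also have "\<dots> \<le> d * CARD('a)"
    using sum_components(2) by simp
  finally have "card (zeros F) \<le> 2 * \<mu> * CARD('a) + d * CARD('a)"
    using card_zeros_le by linarith
  moreover have "\<mu> \<le> d"
    using \<kappa>\<nu>(2) by (intro order_trans[OF min.cobounded2]) simp
  then have "2 * \<mu> * CARD('a) \<le> 2 * d * CARD('a)"
    by (intro mult_right_mono) auto
  ultimately show ?thesis
    by linarith
qed

text \<open>Zeros with \<open>pderiv f = 0\<close> are counted by Bezout. For the others,
  \<open>stepanov\<close> applies if \<open>degX f\<close> is at least \<open>m\<close>; below
  \<open>m\<close>, more than half of the intersection with \<open>Y = 0\<close> goes into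
  \<open>defect f\<close>, so the trivial count is covered by the last term.\<close>

lemma card_zeros_component:
  assumes f: "prime_elem f" "f dvd F" and degs: "0 < degY f" "degY f \<le> degX f"
    and m: "2 \<le> m" "m * m \<le> CARD('a)" "4 * d * m < CARD('a)" "1000 * m \<le> n"
  shows "real (card (zeros f)) \<le> 4 * real (degX f) * CARD('a) / m + 10 * (real m)\<^sup>2 * (real (degX f))\<^sup>2
    + 2 * real CARD('a) * defect f"
proof -
  define D where "D = degX f"
  define P where "P = CARD('a)"
  have D: "0 < D" "degY f \<le> D" "D \<le> d"
    using degs dvd_imp_degX_le[OF f(2) F_neq_0] degX_F by (auto simp: D_def)
  have nonneg: "0 \<le> 4 * real D * P / m" "0 \<le> 10 * (real m)\<^sup>2 * (real D)\<^sup>2" "0 \<le> 2 * real P * defect f"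
    by simp_all
  have "d * 2 \<le> d * m"
    by (rule mult_le_mono2[OF m(1)])
  moreover have "4 * (d * m) < P"
    using m(3) by (simp only: P_def mult.assoc)
  ultimately have "d < P" "2 * d * m < P"
    by linarith+
  have sing: "card (zeros f - reg_points f) \<le> 2 * (D * D)"
  proof -
    have "\<not> f dvd pderiv f"
    proof
      assume *: "f dvd pderiv f"
      have "of_nat (degY f) \<noteq> (0 :: 'a)"
        using degs D \<open>d < P\<close> by (intro of_nat_neq_0_CARD p) (auto simp: P_def)
      then have "coeff (pderiv f) (degY f - 1) \<noteq> 0"
        using degs f by (auto simp: coeff_pderiv of_nat_poly simp del: of_nat_Suc)
      then have "pderiv f \<noteq> 0"
        by auto
      then have "degY f \<le> degY (pderiv f)"
        using * by (intro dvd_imp_degree_le)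
      then show False
        using degree_pderiv_le[of f] degs by simp
    qed
    then have "card (zeros f - reg_points f) \<le> degX f * degY (pderiv f) + degY f * degX (pderiv f)"
      by (intro card_common_zeros f(1)) (auto simp: zeros_def reg_points_def)
    also have "\<dots> \<le> D * D + D * D"
      using bideg_le_pderiv[of f] D unfolding bideg_le_def D_def by (intro add_mono mult_mono) auto
    finally show ?thesis
      by simp
  qed
  have split: "card (zeros f) \<le> 2 * (D * D) + card (reg_points f)"
  proof -
    have "card (zeros f) \<le> card ((zeros f - reg_points f) \<union> reg_points f)"
      by (intro card_mono) auto
    also have "\<dots> \<le> card (zeros f - reg_points f) + card (reg_points f)"
      by (rule card_Un_le)
    finally show ?thesis
      using sing by linarith
  qed
  have mD: "(real D)\<^sup>2 \<le> (real m)\<^sup>2 * (real D)\<^sup>2"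
  proof -
    have "1 \<le> (real m)\<^sup>2"
      using m(1) by (intro one_le_power) simp
    then show ?thesis
      using mult_right_mono[of 1 "(real m)\<^sup>2" "(real D)\<^sup>2"] by simp
  qed
  have "real (card (zeros f)) \<le> 4 * real D * P / m + 10 * (real m)\<^sup>2 * (real D)\<^sup>2 + 2 * real P * defect f"
  proof (cases "reg_points f = {}")
    case True
    then have "real (card (zeros f)) \<le> 2 * (real D)\<^sup>2"
      using split by (simp add: power2_eq_square del: of_nat_mult flip: of_nat_mult)
    then show ?thesis
      using nonneg mD by linarith
  next
    case ne: False
    show ?thesis
    proof (cases "D < m")
      case True
      \<comment> \<open>Immediate without nonzero roots; with them the assumptions of
        \<open>fermat_component\<close> hold.\<close>
      have "2 * nzroots (coeff f 0) < D"
      proof (cases "0 < nzroots (coeff f 0)")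
        case nz: True
        have f0: "coeff f 0 \<noteq> 0"
          using f(2) coeff_F_0_neq_0 by (auto simp: dvd_def coeff_mult_0)
        interpret fermat_component f k n \<kappa> \<nu>
          using p f \<kappa>\<nu> kn degs D \<open>d < P\<close> f0 nz by unfold_locales (auto simp: F D_def P_def)
        have "1000 * (degX f + 1) \<le> n"
          using True m(4) by (simp add: D_def)
        moreover have "2 * degX f * (n + degX f) < CARD('a)"
        proof -
          have "D \<le> n"
            using True m(4) by linarith
          then have "2 * D * (n + D) \<le> 2 * m * (d + d)"
            using True D(3) \<kappa>\<nu>(2) by (intro mult_mono add_mono) (auto simp: Suc_le_eq)
          then show ?thesis
            using m(3) by (simp add: D_def algebra_simps)
        qed
        ultimately show ?thesis
          using few_nonzero_roots[OF ne degs(2)] by (simp add: D_def)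
      qed (use D in simp)
      then have "D \<le> 2 * defect f"
        by (simp add: defect_def D_def)
      then have "degY f * CARD('a) \<le> 2 * defect f * P"
        using D unfolding P_def by (intro mult_right_mono) auto
      then have "card (zeros f) \<le> 2 * P * defect f"
        using card_zeros_trivial[OF f(1) degs(1)] by (simp add: mult_ac)
      then have "real (card (zeros f)) \<le> 2 * real P * defect f"
        by (metis of_nat_le_iff of_nat_mult of_nat_numeral)
      then show ?thesis
        using nonneg by linarith
    next
      case False
      define s where "s = m * m - 1"
      have "4 \<le> m * m"
        using mult_mono[OF m(1) m(1)] by simp
      \<comment> \<open>Dividing by \<open>s\<close> instead of \<open>m * m\<close> thus costs at
        most a factor 2.\<close>
      then have s: "m * m \<le> 2 * s" "1 \<le> s"
        by (simp_all add: s_def)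
      have "degX f + degY f \<le> 2 * d"
        using D by (simp add: D_def)
      then have small: "(degX f + degY f) * m < CARD('a)"
        using \<open>2 * d * m < P\<close> by (metis P_def le_less_trans mult_le_mono1)
      have "card (reg_points f) * s
          \<le> (degX f + degY f) * (CARD('a) * m + s * (m + s * D) + degX f + degY f)"
        using m False D small by (intro stepanov[OF p f(1) ne]) (auto simp: D_def s_def)
      also have "\<dots> \<le> (2 * D) * (P * m + s * (m + s * D) + 2 * D)"
        using D by (intro mult_mono) (auto simp: D_def P_def)
      finally have "real (card (reg_points f) * s) \<le> real ((2 * D) * (P * m + s * (m + s * D) + 2 * D))"
        by (simp only: of_nat_le_iff)
      then have "real (card (reg_points f)) * s
          \<le> 2 * real D * P * m + s * (2 * real D * m + 2 * real s * (real D)\<^sup>2) + 4 * (real D)\<^sup>2"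
        by (simp add: algebra_simps power2_eq_square)
      also have "\<dots> \<le> s * (4 * real D * P / m) + s * (2 * real D * m + 2 * real s * (real D)\<^sup>2) + s * (4 * (real D)\<^sup>2)"
      proof (intro add_mono order_refl)
        have "real m * real m \<le> 2 * real s"
          using s(1) by (metis of_nat_le_iff of_nat_mult of_nat_numeral)
        then have "2 * real D * P * (real m * real m) \<le> 2 * real D * P * (2 * real s)"
          by (intro mult_left_mono) auto
        then show "2 * real D * P * m \<le> s * (4 * real D * P / m)"
          using m(1) by (simp add: field_simps)
        show "4 * (real D)\<^sup>2 \<le> s * (4 * (real D)\<^sup>2)"
          using mult_right_mono[of 1 "real s" "4 * (real D)\<^sup>2"] s(2) by simp
      qed
      also have "\<dots> = s * (4 * real D * P / m + (2 * real D * m + 2 * real s * (real D)\<^sup>2) + 4 * (real D)\<^sup>2)"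
        by (simp add: algebra_simps)
      finally have "real (card (reg_points f)) \<le> 4 * real D * P / m + (2 * real D * m + 2 * real s * (real D)\<^sup>2) + 4 * (real D)\<^sup>2"
        using s(2) by (simp add: mult.commute[of _ "real s"])
      moreover have "2 * real D * m \<le> 2 * ((real m)\<^sup>2 * (real D)\<^sup>2)"
      proof -
        have "real D * m * 1 \<le> real D * m * (real D * m)"
          using D(1) m(1) by (intro mult_left_mono) (auto simp flip: of_nat_mult)
        then show ?thesis
          by (simp add: power2_eq_square mult_ac)
      qed
      moreover have "2 * real s * (real D)\<^sup>2 \<le> 2 * ((real m)\<^sup>2 * (real D)\<^sup>2)"
      proof -
        have "real s \<le> (real m)\<^sup>2"
          by (simp add: s_def power2_eq_square flip: of_nat_mult)
        then show ?thesis
          by (simp add: mult_right_mono)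
      qed
      moreover have "real (card (zeros f)) \<le> 2 * (real D)\<^sup>2 + real (card (reg_points f))"
        using split by (simp add: power2_eq_square flip: of_nat_mult of_nat_add of_nat_le_iff)
      ultimately have "real (card (zeros f)) \<le> 4 * real D * P / m + 4 * ((real m)\<^sup>2 * (real D)\<^sup>2) + 6 * (real D)\<^sup>2"
        by linarith
      then show ?thesis
        using nonneg mD by linarith
    qed
  qed
  then show ?thesis
    by (simp add: D_def P_def)
qed

theorem card_zeros_bound:
  assumes m: "2 \<le> m" "m * m \<le> CARD('a)" "4 * d * m < CARD('a)" "1000 * m \<le> n"
  shows "real (card (zeros F)) \<le> 8 * real d * CARD('a) / m + 40 * (real m)\<^sup>2 * (real d)\<^sup>2 + 10 * real \<mu> * CARD('a)"
proof -
  define P where "P = real CARD('a)"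
  define D where "D f = degX f + degY f" for f :: "'a poly poly"
  have bound: "real (card (zeros f)) \<le> 4 * real (D f) * P / m + 10 * (real m)\<^sup>2 * (real (D f))\<^sup>2
      + 2 * P * (real (defect f) + real (defect (swapXY f)))" if f: "f \<in> components" for f
  proof -
    \<comment> \<open>\<open>card_zeros_component\<close> expects the larger degree in
      \<open>X\<close>. As \<open>F\<close> is symmetric, the other factors are replaced by their
      mirror images, which brings in the defect of \<open>swapXY f\<close>.\<close>
    define g where "g = (if degY f \<le> degX f then f else swapXY f)"
    have "g dvd F"
      using component_dvd[OF f] swapXY_dvd_iff[of f F] by (simp add: g_def)
    moreover have "prime_elem g"
      using component_prime[OF f] by (auto simp: g_def intro: prime_elem_swapXY)
    ultimately have "real (card (zeros g)) \<le> 4 * real (degX g) * P / m + 10 * (real m)\<^sup>2 * (real (degX g))\<^sup>2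
        + 2 * P * defect g"
      unfolding P_def using component_degrees[OF f]
      by (intro card_zeros_component m) (auto simp: g_def degY_swapXY)
    also have "\<dots> \<le> 4 * real (D f) * P / m + 10 * (real m)\<^sup>2 * (real (D f))\<^sup>2
        + 2 * P * (real (defect f) + real (defect (swapXY f)))"
      by (intro add_mono mult_left_mono divide_right_mono mult_right_mono power_mono)
         (auto simp: g_def D_def P_def)
    also have "card (zeros g) = card (zeros f)"
      by (simp add: g_def card_zeros_swapXY)
    finally show ?thesis .
  qed
  have D_sum: "(\<Sum>f\<in>components. real (D f)) \<le> 2 * real d"
  proof -
    have "(\<Sum>f\<in>components. D f) \<le> 2 * d"
      using sum_components(1,2) by (simp add: D_def sum.distrib)
    then show ?thesis
      by (metis of_nat_le_iff of_nat_mult of_nat_numeral of_nat_sum)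
  qed
  have D2_sum: "(\<Sum>f\<in>components. (real (D f))\<^sup>2) \<le> (2 * real d)\<^sup>2"
  proof -
    have "(\<Sum>f\<in>components. (real (D f))\<^sup>2) \<le> (\<Sum>f\<in>components. real (D f) * (\<Sum>g\<in>components. real (D g)))"
      unfolding power2_eq_square
      by (intro sum_mono mult_left_mono member_le_sum) (auto simp: finite_components)
    also have "\<dots> = (\<Sum>f\<in>components. real (D f))\<^sup>2"
      by (simp add: power2_eq_square sum_distrib_right)
    also have "\<dots> \<le> (2 * real d)\<^sup>2"
      using D_sum by (intro power_mono sum_nonneg) auto
    finally show ?thesis .
  qed
  have def_sum: "(\<Sum>f\<in>components. real (defect f) + real (defect (swapXY f))) \<le> 4 * real \<mu>"
  proof -
    have "(\<Sum>f\<in>components. defect f + defect (swapXY f)) \<le> 4 * \<mu>"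
      using sum_components(3,4) by (simp add: sum.distrib)
    then have "real (\<Sum>f\<in>components. defect f + defect (swapXY f)) \<le> real (4 * \<mu>)"
      by (simp only: of_nat_le_iff)
    then show ?thesis
      by (simp del: of_nat_min)
  qed
  have "real (card (zeros F)) \<le> 2 * real \<mu> * P + (\<Sum>f\<in>components. real (card (zeros f)))"
  proof -
    have "real (card (zeros F)) \<le> real (2 * \<mu> * CARD('a) + (\<Sum>f\<in>components. card (zeros f)))"
      using card_zeros_le by (simp only: of_nat_le_iff)
    then show ?thesis
      by (simp add: P_def del: of_nat_min)
  qed
  also have "(\<Sum>f\<in>components. real (card (zeros f))) \<le> (\<Sum>f\<in>components. 4 * real (D f) * P / m
      + 10 * (real m)\<^sup>2 * (real (D f))\<^sup>2 + 2 * P * (real (defect f) + real (defect (swapXY f))))"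
    by (intro sum_mono bound)
  also have "\<dots> = 4 * P / m * (\<Sum>f\<in>components. real (D f)) + 10 * (real m)\<^sup>2 * (\<Sum>f\<in>components. (real (D f))\<^sup>2)
      + 2 * P * (\<Sum>f\<in>components. real (defect f) + real (defect (swapXY f)))"
    by (simp add: sum.distrib sum_distrib_left sum_divide_distrib algebra_simps)
  also have "\<dots> \<le> 4 * P / m * (2 * real d) + 10 * (real m)\<^sup>2 * (2 * real d)\<^sup>2 + 2 * P * (4 * real \<mu>)"
    using D_sum D2_sum def_sum by (intro add_mono mult_left_mono) (auto simp: P_def)
  finally show ?thesis
    by (simp add: P_def algebra_simps power2_eq_square del: of_nat_min)
qed

end

text \<open>In \<open>card_zeros_bound\<close> the terms \<open>d * p / m\<close> and
  \<open>m ^ 2 * d ^ 2\<close> balance for \<open>m\<close> near the cube root of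
  \<open>p / d\<close>. A cap on \<open>m\<close> by a multiple of \<open>sqrt n\<close> is
  compatible with the first term of the estimate and secures
  \<open>1000 * m \<le> n\<close>.\<close>

lemma (in fermat_curve) card_zeros_estimate:
  assumes r: "\<kappa> * r = k" "real r \<le> sqrt n"
  shows "real (card (zeros F)) \<le> 2000 * (real k * sqrt n * real CARD('a) / real r
    + (real k * real n / real r) powr (4/3) * real CARD('a) powr (2/3))"
proof -
  define P \<delta> \<sigma> where "P = real CARD('a)" and "\<delta> = real d" and "\<sigma> = sqrt n"
  define t where "t = (P / \<delta>) powr (1/3)"
  have pos: "0 < P" "1 \<le> \<delta>" "0 < \<sigma>" "0 < t" "0 < r"
  proof -
    have "1 \<le> d"
      using \<kappa>\<nu>(2) kn by (simp add: Suc_le_eq)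
    then have "real 1 \<le> real d"
      by (simp only: of_nat_le_iff)
    then show "1 \<le> \<delta>"
      by (simp only: \<delta>_def of_nat_1)
    show "0 < P" "0 < \<sigma>" "0 < r"
      using kn r by (auto simp: P_def \<sigma>_def intro: Nat.gr0I)
    then show "0 < t"
      using \<open>1 \<le> \<delta>\<close> by (simp add: t_def)
  qed
  have \<delta>: "\<delta> = real k * real n / real r"
    using r(1) pos(5) by (auto simp: \<delta>_def)
  have "\<sigma> * \<sigma> = n"
    by (simp add: \<sigma>_def)
  then have T1: "real k * \<sigma> * P / real r = \<delta> * P / \<sigma>"
    using pos by (simp add: \<delta> field_simps)
  have "t ^ 3 = P / \<delta>"
    using pos by (simp add: t_def powr_power)
  then have P: "P = \<delta> * t ^ 3"
    using pos by (simp add: field_simps)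
  have T2: "\<delta> powr (4/3) * P powr (2/3) = \<delta>\<^sup>2 * t\<^sup>2"
  proof -
    have "(t ^ 3) powr (2/3) = t\<^sup>2"
      using pos by (simp add: powr_powr flip: powr_numeral)
    then have "\<delta> powr (4/3) * P powr (2/3) = \<delta> powr (4/3) * \<delta> powr (2/3) * t\<^sup>2"
      using pos by (simp add: P powr_mult)
    also have "\<delta> powr (4/3) * \<delta> powr (2/3) = \<delta>\<^sup>2"
      using pos by (simp add: powr_numeral flip: powr_add)
    finally show ?thesis .
  qed
  \<comment> \<open>The two terms of the estimate; the product \<open>\<delta> * P\<close> equals
    both \<open>\<sigma> * T1\<close> and \<open>t * T2\<close>.\<close>
  define T1 T2 where "T1 = \<delta> * P / \<sigma>" and "T2 = \<delta>\<^sup>2 * t\<^sup>2"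
  have nonneg: "0 \<le> T1" "0 \<le> T2"
    using pos by (simp_all add: T1_def T2_def)
  have trivial: "real (card (zeros F)) \<le> 3 * (\<delta> * P)"
  proof -
    have "real (card (zeros F)) \<le> real (3 * d * CARD('a))"
      using card_zeros_trivial_bound by (simp only: of_nat_le_iff)
    then show ?thesis
      by (simp add: P_def \<delta>_def)
  qed
  have "real (card (zeros F)) \<le> 2000 * (T1 + T2)"
  proof -
    \<comment> \<open>For bounded \<open>\<sigma>\<close> or \<open>t\<close> the trivial bound is
      good enough. The thresholds are twice the divisors 100 and 8 below, so that
      \<open>\<tau>\<close> is at least 2 otherwise.\<close>
    consider "\<sigma> < 200" | "t < 16" | "200 \<le> \<sigma>" "16 \<le> t"
      by linarith
    then show ?thesis
    proof cases
      case 1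
      then have "\<delta> * P * \<sigma> \<le> \<delta> * P * 200"
        using pos by (intro mult_left_mono) auto
      then have "\<delta> * P \<le> 200 * T1"
        using pos by (simp add: T1_def field_simps)
      then have "3 * (\<delta> * P) \<le> 2000 * (T1 + T2)"
        using nonneg by argo
      with trivial show ?thesis
        by (rule order_trans)
    next
      case 2
      have "\<delta> * P = T2 * t"
        by (simp add: P T2_def power2_eq_square power3_eq_cube)
      also have "\<dots> \<le> T2 * 16"
        using 2 nonneg by (intro mult_left_mono) auto
      finally have "3 * (\<delta> * P) \<le> 2000 * (T1 + T2)"
        using nonneg by argo
      with trivial show ?thesis
        by (rule order_trans)
    next
      case 3
      \<comment> \<open>The divisor 8 yields \<open>4 * d * m < CARD('a)\<close> because
        \<open>\<delta> * t \<le> P\<close>; the divisor 100 yields \<open>1000 * m \<le> n\<close>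
        because \<open>10 * \<sigma> \<le> \<sigma> * \<sigma>\<close>.\<close>
      define \<tau> where "\<tau> = min (\<sigma> / 100) (t / 8)"
      have \<tau>: "2 \<le> \<tau>" "\<tau> \<le> \<sigma> / 100" "\<tau> \<le> t / 8"
        using 3 by (auto simp: \<tau>_def)
      define m where "m = nat \<lfloor>\<tau>\<rfloor>"
      have "2 \<le> \<lfloor>\<tau>\<rfloor>"
        using \<tau>(1) by (simp add: le_floor_iff)
      then have m: "2 \<le> m" "real m \<le> \<tau>" "\<tau> / 2 \<le> real m"
        using \<tau>(1) unfolding m_def by linarith+
      have "t \<le> t ^ 3" "t ^ 2 \<le> t ^ 3"
        using 3 self_le_power[of t 3] power_increasing[of 2 3 t] by auto
      moreover have "t ^ 3 \<le> P"
        using pos mult_right_mono[of 1 \<delta> "t ^ 3"] by (simp add: P)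
      ultimately have "t\<^sup>2 \<le> P"
        by linarith
      have "\<delta> * t \<le> P"
        using pos \<open>t \<le> t ^ 3\<close> by (simp add: P)
      have "m * m \<le> CARD('a)"
      proof -
        have "real m * real m \<le> t * t"
          using m \<tau> pos by (intro mult_mono) auto
        then have "real (m * m) \<le> P"
          using \<open>t\<^sup>2 \<le> P\<close> by (simp add: power2_eq_square)
        then show ?thesis
          unfolding P_def by (simp only: of_nat_le_iff)
      qed
      moreover have "4 * d * m < CARD('a)"
      proof -
        have "4 * \<delta> * m \<le> 4 * \<delta> * (t / 8)"
          using m \<tau> pos by (intro mult_left_mono) auto
        also have "\<dots> < \<delta> * t"
          using pos by simp
        also have "\<dots> \<le> P"
          by fact
        finally have "real (4 * d * m) < real CARD('a)"
          by (simp add: \<delta>_def P_def)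
        then show ?thesis
          by (simp only: of_nat_less_iff)
      qed
      moreover have "1000 * m \<le> n"
      proof -
        have "1000 * real m \<le> 10 * \<sigma>"
          using m \<tau> by simp
        also have "\<dots> \<le> \<sigma> * \<sigma>"
          using 3 by (intro mult_right_mono) auto
        finally have "real (1000 * m) \<le> real n"
          using \<open>\<sigma> * \<sigma> = n\<close> by simp
        then show ?thesis
          by (simp only: of_nat_le_iff)
      qed
      ultimately have bound: "real (card (zeros F)) \<le> 8 * \<delta> * P / m + 40 * (real m)\<^sup>2 * \<delta>\<^sup>2 + 10 * real \<mu> * P"
        unfolding P_def \<delta>_def by (intro card_zeros_bound m)
      have b1: "8 * \<delta> * P / m \<le> 1600 * T1 + 128 * T2"
      proof -
        have "8 * \<delta> * P / m \<le> 8 * \<delta> * P / (\<tau> / 2)"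
          using m \<tau> pos by (intro divide_left_mono) auto
        also have "\<dots> \<le> 1600 * T1 + 128 * T2"
        proof (cases "\<tau> = \<sigma> / 100")
          case True
          have "8 * \<delta> * P / (\<tau> / 2) = 1600 * T1"
            unfolding True T1_def by simp
          then show ?thesis
            using nonneg by simp
        next
          case False
          then have \<tau>_eq: "\<tau> = t / 8"
            by (auto simp: \<tau>_def min_def split: if_splits)
          have "8 * \<delta> * P / (\<tau> / 2) = 128 * T2"
            unfolding \<tau>_eq using pos by (simp add: P T2_def power2_eq_square power3_eq_cube)
          then show ?thesis
            using nonneg by simp
        qed
        finally show ?thesis .
      qed
      have b2: "40 * (real m)\<^sup>2 * \<delta>\<^sup>2 \<le> 40 * T2"
      proof -
        have "(real m)\<^sup>2 \<le> t\<^sup>2"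
          using m \<tau> pos by (intro power_mono) auto
        then show ?thesis
          by (simp add: T2_def mult_left_mono mult.commute)
      qed
      \<comment> \<open>The bound on \<open>r\<close> enters here: it makes
        \<open>\<sigma> / r\<close> at least 1.\<close>
      have b3: "10 * real \<mu> * P \<le> 10 * T1"
      proof -
        have "real \<mu> \<le> real k"
          by simp
        also have "\<dots> \<le> real k * (\<sigma> / r)"
          using r pos mult_left_mono[of 1 "\<sigma> / r" "real k"] by (simp add: \<sigma>_def)
        finally have "real \<mu> * P \<le> real k * (\<sigma> / r) * P"
          using pos by (intro mult_right_mono) auto
        also have "\<dots> = T1"
          using T1 by (simp add: T1_def)
        finally show ?thesis
          by (simp only: mult.assoc)
      qed
      have "real (card (zeros F)) \<le> (1600 * T1 + 128 * T2) + 40 * T2 + 10 * T1"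
        by (rule order_trans[OF bound add_mono[OF add_mono[OF b1 b2] b3]])
      also have "\<dots> \<le> 2000 * (T1 + T2)"
        using nonneg by argo
      finally show ?thesis .
    qed
  qed
  then show ?thesis
    using T1 T2 unfolding T1_def T2_def P_def \<delta> \<sigma>_def by simp
qed

section \<open>From the residue ring to a field type, and the choice of that type\<close>

lemma N_zeros_eq_card:
  assumes p: "prime CARD('a::finite_field)"
  shows "N_zeros CARD('a) k n = card {(x :: 'a, y). (x ^ n + y ^ n - 1) ^ (k div gcd k n)
    = (x ^ k + y ^ k - 1) ^ (n div gcd k n)}"
    (is "_ = card ?B")
proof -
  define I where "I = {0..<int CARD('a)}"
  have eq_iff: "(of_int a = (of_int b :: 'a)) \<longleftrightarrow> [a = b] (mod int CARD('a))" for a b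
    using CHAR_eq_CARD[OF p] by (simp add: of_int_eq_iff_cong_CHAR)
  have inj: "inj_on (of_int :: int \<Rightarrow> 'a) I"
    by (rule inj_onI) (auto simp: eq_iff I_def cong_def)
  have surj: "(of_int :: int \<Rightarrow> 'a) ` I = UNIV"
    using card_image[OF inj] by (intro card_subset_eq) (auto simp: I_def)
  define A where "A = {(x, y). x \<in> I \<and> y \<in> I \<and>
    [(x ^ n + y ^ n - 1) ^ (k div gcd k n) = (x ^ k + y ^ k - 1) ^ (n div gcd k n)] (mod int CARD('a))}"
  have A: "(x, y) \<in> A \<longleftrightarrow> x \<in> I \<and> y \<in> I \<and> (of_int x, of_int y) \<in> ?B" for x y
    by (simp add: A_def eq_iff[symmetric])
  have "bij_betw (map_prod of_int of_int) A ?B"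
    unfolding bij_betw_def
  proof (intro conjI equalityI subsetI)
    show "inj_on (map_prod of_int of_int :: _ \<Rightarrow> 'a \<times> 'a) A"
      by (rule inj_onI) (use inj in \<open>auto simp: A dest: inj_onD\<close>)
    fix z :: "'a \<times> 'a" assume "z \<in> map_prod of_int of_int ` A"
    then show "z \<in> ?B"
      using A by fastforce
  next
    fix z :: "'a \<times> 'a" assume z: "z \<in> ?B"
    obtain u v where uv: "z = (u, v)"
      by (cases z)
    obtain x y where "x \<in> I" "u = of_int x" "y \<in> I" "v = of_int y"
      using surj by (metis UNIV_I imageE)
    then show "z \<in> map_prod of_int of_int ` A"
      using z A[of x y] by (intro image_eqI[of _ _ "(x, y)"]) (auto simp: uv)
  qed
  then have "card A = card ?B"
    by (rule bij_betw_same_card)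
  then show ?thesis
    unfolding N_zeros_eq[OF p] A_def I_def by simp
qed

lemma N_zeros_estimate:
  assumes p: "prime CARD('a::{finite_field,field_gcd})"
    and kn: "1 \<le> k" "k < CARD('a)" "1 \<le> n" "n < CARD('a)" "k \<noteq> n"
    and r: "r = gcd k n" "real r \<le> 0.5 * sqrt n"
  shows "real (N_zeros CARD('a) k n) \<le> 2000 * (real k * sqrt n * real CARD('a) / real r
    + (real k * real n / real r) powr (4/3) * real CARD('a) powr (2/3))"
proof -
  define \<kappa> \<nu> where "\<kappa> = k div r" and "\<nu> = n div r"
  have r_mult: "\<kappa> * r = k" "\<nu> * r = n"
    by (simp_all add: \<kappa>_def \<nu>_def r)
  have "0 < r"
    using kn r by simp
  define F :: "'a poly poly" where "F = fermat_poly n ^ \<kappa> - fermat_poly k ^ \<nu>"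
  interpret fermat_curve k n \<kappa> \<nu> F
  proof
    show "prime CARD('a)" "k \<noteq> n" "0 < k" "0 < n" "k < CARD('a)" "n < CARD('a)"
      using p kn by auto
    show "\<kappa> * n = \<nu> * k"
      using r_mult by (metis mult.assoc mult.commute)
    show "0 < \<kappa>" "0 < \<nu>"
      using r_mult kn by (auto intro!: Nat.gr0I)
    have "\<kappa> \<le> k" "\<nu> \<le> n"
      by (simp_all add: \<kappa>_def \<nu>_def)
    then show "\<kappa> < CARD('a)" "\<nu> < CARD('a)"
      using kn by simp_all
  qed (rule F_def)
  have "zeros F = {(x, y). (x ^ n + y ^ n - 1) ^ (k div gcd k n) = (x ^ k + y ^ k - 1) ^ (n div gcd k n)}"
    by (simp add: zeros_def val2_F \<kappa>_def \<nu>_def r)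
  then have "N_zeros CARD('a) k n = card (zeros F)"
    by (simp add: N_zeros_eq_card[OF p])
  moreover have "real r \<le> sqrt n"
    using r(2) real_sqrt_ge_zero[of n] by simp
  ultimately show ?thesis
    using card_zeros_estimate[OF r_mult(1)] by simp
qed

text \<open>The estimate with constant 2000 is negated for a single \<open>p\<close>, so that a
  violating prime can be chosen.\<close>

definition estimate_fails :: "nat \<Rightarrow> bool" where
  "estimate_fails p \<longleftrightarrow> (\<exists>k n r. 1 \<le> k \<and> k < p \<and> 1 \<le> n \<and> n < p \<and> k \<noteq> n \<and> r = gcd k n
    \<and> real r \<le> 0.5 * sqrt (real n)
    \<and> \<not> real (N_zeros p k n) \<le> 2000 * (real k * sqrt (real n) * real p / real r
        + (real k * real n / real r) powr (4/3) * real p powr (2/3)))"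

text \<open>The polynomial libraries need a type for the field with \<open>p\<close> elements, which cannot depend
  on a bound variable \<open>p\<close>. So \<open>p\<close> is fixed as a constant: a counterexample, if there is one.\<close>

definition critical_prime :: nat where
  "critical_prime = (if \<exists>p. prime p \<and> estimate_fails p then SOME p. prime p \<and> estimate_fails p else 2)"

text \<open>The default value 2 keeps the constant prime when no violating prime exists, so the type
  built from it always yields a field.\<close>

lemma prime_critical_prime: "prime critical_prime"
  unfolding critical_prime_def by (auto intro: someI2)

typedef critical_index = "{..<critical_prime}"
  using prime_gt_0_nat[OF prime_critical_prime] by auto

lemma CARD_critical_index: "CARD(critical_index) = critical_prime"
  using type_definition.card[OF type_definition_critical_index] by simp

instance critical_index :: prime_card
  by standard (simp add: CARD_critical_index prime_critical_prime)

text \<open>A failure at any prime would give a failure at \<open>critical_prime\<close>, where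
  \<open>critical_index mod_ring\<close> makes \<open>N_zeros_estimate\<close> available.\<close>

lemma estimate_holds: "prime p \<Longrightarrow> \<not> estimate_fails p"
proof
  assume "prime p" "estimate_fails p"
  then have ex: "\<exists>p. prime p \<and> estimate_fails p"
    by blast
  then have "estimate_fails critical_prime"
    unfolding critical_prime_def using someI_ex[OF ex] by simp
  moreover have "CARD(critical_index mod_ring) = critical_prime"
    by (simp add: CARD_critical_index)
  ultimately show False
    using N_zeros_estimate[where 'a = "critical_index mod_ring"] prime_critical_prime
    unfolding estimate_fails_def by auto
qed

theorem theorem2p6:
  shows "\<exists>c::real. c > 0 \<and>
    (\<forall>p k n r :: nat. prime p \<longrightarrow> 1 \<le> k \<longrightarrow> k < p \<longrightarrow> 1 \<le> n \<longrightarrow> n < p \<longrightarrow> k \<noteq> n \<longrightarrow>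
      r = gcd k n \<longrightarrow> real r \<le> 0.5 * sqrt (real n) \<longrightarrow>
      real (N_zeros p k n) \<le>
        c * (real k * sqrt (real n) * real p / real r
             + (real k * real n / real r) powr (4/3) * real p powr (2/3)))"
  using estimate_holds unfolding estimate_fails_def by (intro exI[of _ 2000]) auto

end
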